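(* Let $m\ge 2$ and let $(\sigma_1,\ldots,\sigma_m)$ generate the Nikishin system $\mathcal{N}(\sigma_1,\ldots,\sigma_m)$. For each fixed $n\in\mathbb{N}$, the DR Hermite-Padé polynomials and the ML Hermite-Padé polynomials of $\mathcal{N}(\sigma_1,\ldots,\sigma_m)$ coincide (that is, a vector $(a_{n,0},\ldots,a_{n,m})$ is a vector of DR Hermite-Padé polynomials if and only if it is a vector of ML Hermite-Padé polynomials), and the vector polynomial $(a_{n,0},a_{n,1},\ldots,a_{n,m})$ is uniquely determined except for constant multiples. Additionally, $\deg a_{n,j}=n-1$ for $j=0,\ldots,m-1$, and $\deg a_{n,m}=n$. Moreover, the zeros of $a_{n,m-1}$ and $a_{n,m}$ are all simple and lie in the interior $\stackrel{\circ}{\Delta}_m$ of $\Delta_m$ (with respect to the Euclidean topology of $\mathbb{R}$).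
   Context: $\mathbb{N}=\{1,2,\ldots\}$. For an interval $\Delta\subset\mathbb{R}$, $\mathcal{M}(\Delta)$ is the class of Borel measures $s$ of constant sign whose support consists of infinitely many points and is contained in $\Delta$, with $x^\nu\in L_1(s)$ for all integers $\nu\ge0$. The Cauchy transform is $\widehat{s}(z)=\int\frac{ds(x)}{z-x}$; it has the expansion $\widehat{s}(z)\sim\sum_{j\ge0}c_j/z^{j+1}$, $c_j=\int x^j\,ds(x)$, at $\infty$, convergent near $\infty$ if the support is bounded and otherwise asymptotic (limits taken along curves non-tangential to the support at $\infty$). All symbols $\mathcal{O}(1/z^N)$ refer to $z\to\infty$ in this sense. For $\sigma_\alpha\in\mathcal{M}(\Delta_\alpha)$, $\sigma_\beta\in\mathcal{M}(\Delta_\beta)$, with $\Delta_\alpha,\Delta_\beta$ having at most one common point and $\widehat\sigma_\beta\in L_1(\sigma_\alpha)$, define the measure $d\langle\sigma_\alpha,\sigma_\beta\rangle(x):=\widehat\sigma_\beta(x)\,d\sigma_\alpha(x)$. Longer products are defined recursively, $\langle\sigma_j,\sigma_{j+1},\ldots,\sigma_k\rangle:=\langle\sigma_j,\langle\sigma_{j+1},\ldots,\sigma_k\rangle\rangle$. Let $\Delta_1,\ldots,\Delta_m$ be intervals in $\mathbb{R}$ such that for each $j=1,\ldots,m-1$ either $\Delta_j\cap\Delta_{j+1}=\emptyset$ or $\Delta_j\cap\Delta_{j+1}=\{x_{j,j+1}\}$ is a single point. Let $\sigma_j\in\mathcal{M}(\Delta_j)$ with the convex hull of $\operatorname{supp}(\sigma_j)$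 equal to $\Delta_j$, $j=1,\ldots,m$; if $\Delta_j\cap\Delta_{j+1}=\{x_{j,j+1}\}$, then $x_{j,j+1}$ is not a mass point of $\sigma_j$ or of $\sigma_{j+1}$. For $1\le j\le k\le m$ put $s_{j,k}:=\langle\sigma_j,\sigma_{j+1},\ldots,\sigma_k\rangle$ and $s_{k,j}:=\langle\sigma_k,\sigma_{k-1},\ldots,\sigma_j\rangle$ (so $s_{j,j}=\sigma_j$). All these products are assumed well defined (the required integrability holds), with $s_{j,k}\in\mathcal{M}(\Delta_j)$ and $s_{k,j}\in\mathcal{M}(\Delta_k)$. The system $(s_{1,1},\ldots,s_{1,m})=\mathcal{N}(\sigma_1,\ldots,\sigma_m)$ is the Nikishin system generated by $(\sigma_1,\ldots,\sigma_m)$. DR (direct/reversed) Hermite-Padé polynomials: for $n\in\mathbb{N}$, polynomials $a_{n,0},\ldots,a_{n,m}$, not all identically zero, with $\deg a_{n,j}\le n-1$ for $j=0,\ldots,m-1$ and $\deg a_{n,m}\le n$, such that $$a_{n,0}(z)+\sum_{k=1}^m(-1)^k a_{n,k}(z)\widehat s_{1,k}(z)=\mathcal{O}(1/z^{n+1}),$$ $$(-1)^j\big(a_{n,j}-a_{n,m}\widehat s_{m,j+1}\big)(z)=\mathcal{O}(1/z),\qquad j=1,\ldots,m-1.$$ ML (multi-level) Hermite-Padé polynomials: for $n\in\mathbb{N}$, polynomials $a_{n,0},\ldots,a_{n,m}$, not all identically zero, with $\deg a_{n,j}\le n-1$ for $j=0,\ldots,m-1$ and $\deg a_{n,m}\le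 n$, such that, with $$\mathcal{A}_{n,j}:=(-1)^ja_{n,j}+\sum_{k=j+1}^m(-1)^k a_{n,k}\widehat s_{j+1,k},\qquad j=0,\ldots,m-1,$$ one has $\mathcal{A}_{n,0}(z)=\mathcal{O}(1/z^{n+1})$ and $\mathcal{A}_{n,j}(z)=\mathcal{O}(1/z)$ for $j=1,\ldots,m-1$. *)

theory Defs
  imports "HOL-Analysis.Analysis" "HOL-Library.Landau_Symbols"
    "HOL-Computational_Algebra.Polynomial"
begin

text \<open>
  A Borel measure of constant sign on the real line is encoded as a sign, \<open>1\<close> or \<open>-1\<close>, together
  with a positive Borel measure; the measure it stands for is the sign times the positive measure.
\<close>

datatype cs_measure = CS (cs_sign: real) (cs_abs: "real measure")

definition measure_support :: "real measure \<Rightarrow> real set" where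
  "measure_support M = {x. \<forall>U. open U \<longrightarrow> x \<in> U \<longrightarrow> emeasure M U \<noteq> 0}"

definition cs_class :: "real set \<Rightarrow> cs_measure set" where
  "cs_class \<Delta> = {s. cs_sign s \<in> {1, -1} \<and> sets (cs_abs s) = sets borel \<and>
     infinite (measure_support (cs_abs s)) \<and> measure_support (cs_abs s) \<subseteq> \<Delta> \<and>
     (\<forall>\<nu>::nat. integrable (cs_abs s) (\<lambda>x. x ^ \<nu>))}"

definition cauchy_transform :: "cs_measure \<Rightarrow> complex \<Rightarrow> complex" where
  "cauchy_transform s z =
     complex_of_real (cs_sign s) * (LINT x|cs_abs s. 1 / (z - complex_of_real x))"

text \<open>The Cauchy transform at a real point is real; this is its value as a real number.\<close>

definition cauchy_on_reals :: "cs_measure \<Rightarrow> real \<Rightarrow> real" where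
  "cauchy_on_reals s x = Re (cauchy_transform s (complex_of_real x))"

text \<open>
  The product has \<open>cauchy_on_reals t\<close> as density with respect to \<open>s\<close>.  The encoding presupposes that
  this density has constant sign \<open>s\<close>-almost everywhere.  That is the case in all products formed
  below: \<open>s\<close> and \<open>t\<close> live on nondegenerate intervals with at most one common point, so the first
  interval, apart from a null set, lies on one side of the second.
\<close>

definition cs_prod :: "cs_measure \<Rightarrow> cs_measure \<Rightarrow> cs_measure" where
  "cs_prod s t =
     CS (if (AE x in cs_abs s. cauchy_on_reals t x \<ge> 0) then cs_sign s else - cs_sign s)
        (density (cs_abs s) (\<lambda>x. ennreal \<bar>cauchy_on_reals t x\<bar>))"

fun cs_prod_list :: "cs_measure list \<Rightarrow> cs_measure" where
  "cs_prod_list [s] = s"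
| "cs_prod_list (s # t # ts) = cs_prod s (cs_prod_list (t # ts))"

definition nik :: "(nat \<Rightarrow> cs_measure) \<Rightarrow> nat \<Rightarrow> nat \<Rightarrow> cs_measure" where
  "nik \<sigma> j k =
     (if j \<le> k then cs_prod_list (map \<sigma> [j..<Suc k])
      else cs_prod_list (map \<sigma> (rev [k..<Suc j])))"

definition nikishin_generators ::
    "nat \<Rightarrow> (nat \<Rightarrow> real set) \<Rightarrow> (nat \<Rightarrow> cs_measure) \<Rightarrow> bool" where
  "nikishin_generators m \<Delta> \<sigma> \<longleftrightarrow>
     (\<forall>j\<in>{1..m}. is_interval (\<Delta> j) \<and> \<sigma> j \<in> cs_class (\<Delta> j) \<and>
        convex hull (measure_support (cs_abs (\<sigma> j))) = \<Delta> j) \<and>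
     (\<forall>j\<in>{1..<m}. \<Delta> j \<inter> \<Delta> (Suc j) = {} \<or>
        (\<exists>x. \<Delta> j \<inter> \<Delta> (Suc j) = {x} \<and>
             emeasure (cs_abs (\<sigma> j)) {x} = 0 \<and> emeasure (cs_abs (\<sigma> (Suc j))) {x} = 0)) \<and>
     (\<forall>j k. 1 \<le> j \<longrightarrow> j < k \<longrightarrow> k \<le> m \<longrightarrow>
        integrable (cs_abs (\<sigma> j)) (cauchy_on_reals (nik \<sigma> (j + 1) k)) \<and>
        integrable (cs_abs (\<sigma> k)) (cauchy_on_reals (nik \<sigma> (k - 1) j))) \<and>
     (\<forall>j k. 1 \<le> j \<longrightarrow> j \<le> k \<longrightarrow> k \<le> m \<longrightarrow>
        nik \<sigma> j k \<in> cs_class (\<Delta> j) \<and> nik \<sigma> k j \<in> cs_class (\<Delta> k))"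

text \<open>
  \<open>f = O(1 / z ^ N)\<close> as \<open>z\<close> tends to infinity non-tangentially to \<open>\<Delta>\<close>, i.e. with the distance from
  \<open>z\<close> to \<open>\<Delta>\<close> at least \<open>c * norm z\<close>, for every \<open>c > 0\<close>.  If \<open>\<Delta>\<close> is a half-line, the regions are
  sectors avoiding it.  If \<open>\<Delta>\<close> is bounded and nonempty, then for \<open>c < 1\<close> the region contains a
  neighbourhood of infinity, and the condition is the unrestricted one.
\<close>

definition bigo_at_infinity_off :: "real set \<Rightarrow> nat \<Rightarrow> (complex \<Rightarrow> complex) \<Rightarrow> bool" where
  "bigo_at_infinity_off \<Delta> N f \<longleftrightarrow>
     (\<forall>c>0. f \<in> O[inf at_infinity
        (principal {z. c * norm z \<le> infdist z (complex_of_real ` \<Delta>)})](\<lambda>z. 1 / z ^ N))"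

text \<open>A vector of polynomials is a function on \<open>nat\<close>, of which only the values at \<open>0..m\<close> matter.\<close>

definition hp_vector :: "nat \<Rightarrow> nat \<Rightarrow> (nat \<Rightarrow> complex poly) \<Rightarrow> bool" where
  "hp_vector m n a \<longleftrightarrow>
     (\<exists>j\<le>m. a j \<noteq> 0) \<and> (\<forall>j<m. degree (a j) \<le> n - 1) \<and> degree (a m) \<le> n"

definition HP_DR ::
    "nat \<Rightarrow> (nat \<Rightarrow> real set) \<Rightarrow> (nat \<Rightarrow> cs_measure) \<Rightarrow> nat \<Rightarrow> (nat \<Rightarrow> complex poly) \<Rightarrow> bool" where
  "HP_DR m \<Delta> \<sigma> n a \<longleftrightarrow> hp_vector m n a \<and>
     bigo_at_infinity_off (\<Delta> 1) (n + 1)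
       (\<lambda>z. poly (a 0) z
          + (\<Sum>k=1..m. (-1) ^ k * poly (a k) z * cauchy_transform (nik \<sigma> 1 k) z)) \<and>
     (\<forall>j\<in>{1..<m}. bigo_at_infinity_off (\<Delta> m) 1
       (\<lambda>z. (-1) ^ j *
          (poly (a j) z - poly (a m) z * cauchy_transform (nik \<sigma> m (j + 1)) z)))"

definition multilevel_form ::
    "nat \<Rightarrow> (nat \<Rightarrow> cs_measure) \<Rightarrow> (nat \<Rightarrow> complex poly) \<Rightarrow> nat \<Rightarrow> complex \<Rightarrow> complex" where
  "multilevel_form m \<sigma> a j z = (-1) ^ j * poly (a j) z
     + (\<Sum>k=j+1..m. (-1) ^ k * poly (a k) z * cauchy_transform (nik \<sigma> (j + 1) k) z)"

definition HP_ML ::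
    "nat \<Rightarrow> (nat \<Rightarrow> real set) \<Rightarrow> (nat \<Rightarrow> cs_measure) \<Rightarrow> nat \<Rightarrow> (nat \<Rightarrow> complex poly) \<Rightarrow> bool" where
  "HP_ML m \<Delta> \<sigma> n a \<longleftrightarrow> hp_vector m n a \<and>
     bigo_at_infinity_off (\<Delta> 1) (n + 1) (multilevel_form m \<sigma> a 0) \<and>
     (\<forall>j\<in>{1..<m}. bigo_at_infinity_off (\<Delta> (j + 1)) 1 (multilevel_form m \<sigma> a j))"

end

theory Submission
  imports Defs "HOL-Computational_Algebra.Fundamental_Theorem_Algebra"
begin

text \<open>
  Expanding the Cauchy transforms at infinity turns both systems of conditions into linear equations:
  for every level a polynomial built from the polynomials of the second kind has to vanish, and
  \<open>n\<close> moments of the first form have to vanish.  The DR system determines \<open>a 0, \<dots>, a (m - 1)\<close> from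
  \<open>a m\<close>, which leaves \<open>n\<close> homogeneous equations for \<open>n + 1\<close> coefficients, so it has a solution.  The
  identity relating the Cauchy transforms of a Nikishin system to those of the reversed chains shows
  that every DR vector is an ML vector.

  For a real ML vector, the form of level \<open>j\<close> is the Cauchy integral of the form of level \<open>j + 1\<close> with
  respect to \<open>\<sigma> (j + 1)\<close>.  The form of level 1 is orthogonal to all polynomials of degree less than
  \<open>n\<close> and therefore has \<open>n\<close> zeros inside \<open>\<Delta> 1\<close>; at these zeros the Cauchy integral vanishes, so by
  partial fractions the form of level 2, divided by the polynomial with these zeros, is orthogonal to
  the same polynomials.  Continuing, \<open>a m\<close> has \<open>n\<close> zeros inside \<open>\<Delta> m\<close>, and it vanishes if its degree
  is less than \<open>n\<close>.  This gives uniqueness of ML vectors, hence the converse implication.  The zeros of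
  \<open>a (m - 1)\<close> interlace those of \<open>a m\<close> because the weights of the associated Gauss quadrature are
  positive.
\<close>

section \<open>Integration with respect to measures of constant sign\<close>

text \<open>Neighbouring intervals may share an endpoint, where Cauchy transforms can blow up, so
  neither Fubini's theorem nor continuity up to the endpoints is automatic. Kernels
  \<open>1 / (x - y)\<close> have constant sign between neighbouring intervals, so absolute values
  of chains are iterated integrals of absolute values; Tonelli's theorem then reduces the finiteness
  questions to the total mass of one product measure. A nonreal parameter \<open>w\<close> keeps the
  final kernel of a chain bounded.

  The polynomials are complex, while counting zeros needs real ones. All measures are real, so the
  linear equations pass to coefficientwise real and imaginary parts; functionals and equations are
  therefore defined over a generic scalar type. Once \<open>coeff (a m) n\<close> is normalised to
  1, the imaginary part is a solution whose coefficient there is 0, hence zero.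

  An order condition at infinity is demanded on all nontangential regions, but the imaginary axis
  lies in one of them and already detects any nonzero polynomial part or moment.\<close>

lemma poly_shift_add: "poly_shift n (p + q) = poly_shift n p + poly_shift n q"
  by (intro poly_eqI) (simp add: coeff_poly_shift)

lemma poly_shift_smult: "poly_shift n (smult c p) = smult c (poly_shift n p)"
  by (intro poly_eqI) (simp add: coeff_poly_shift)

lemma poly_shift_eq_0: "degree p < n \<Longrightarrow> poly_shift n p = 0"
  by (intro poly_eqI) (simp add: coeff_poly_shift coeff_eq_0)

text \<open>The complement of the support is a union of open null sets; by Lindelof's theorem
  countably many of them cover it, so it is null.\<close>

lemma AE_measure_support:
  assumes sets: "sets M = sets borel"
  shows "AE x in M. x \<in> measure_support M"
proof -
  let ?F = "{U. open U \<and> emeasure M U = 0}"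
  obtain F' where F': "F' \<subseteq> ?F" "countable F'" "\<Union>F' = \<Union>?F"
    using Lindelof[of ?F] by auto
  have "(\<Union>U\<in>F'. U) \<in> null_sets M"
    using F'(1) by (intro null_sets_UN' F'(2)) (auto simp: null_sets_def sets)
  moreover have "- measure_support M \<subseteq> \<Union>F'"
    unfolding F'(3) by (auto simp: measure_support_def)
  ultimately show ?thesis
    by (intro AE_I[where N="\<Union>F'"]) (auto simp: null_sets_def)
qed

text \<open>Integration against the signed measure that the pair encodes. The generic codomain
  serves real and complex integrands alike.\<close>

definition sint :: "cs_measure \<Rightarrow> (real \<Rightarrow> 'a::{banach, second_countable_topology}) \<Rightarrow> 'a" where
  "sint s f = cs_sign s *\<^sub>R (LINT x|cs_abs s. f x)"

definition pfun :: "cs_measure \<Rightarrow> 'a::{real_normed_field, banach, second_countable_topology} poly \<Rightarrow> 'a"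
  where "pfun s p = sint s (\<lambda>x. poly p (of_real x))"

text \<open>The polynomial part at infinity of \<open>p\<close> times the Cauchy transform of
  \<open>s\<close>, that is, the integral of \<open>(p z - p x) / (z - x)\<close> with respect to
  \<open>s\<close>. The coefficient of \<open>z ^ i\<close> integrates \<open>p\<close> divided by
  \<open>x ^ Suc i\<close> with the lower terms dropped.\<close>

definition second_kind ::
    "cs_measure \<Rightarrow> 'a::{real_normed_field, banach, second_countable_topology} poly \<Rightarrow> 'a poly" where
  "second_kind s p = (\<Sum>i<degree p. monom (pfun s (poly_shift (Suc i) p)) i)"

lemma cauchy_transform_eq_sint: "cauchy_transform s z = sint s (\<lambda>x. 1 / (z - of_real x))"
  by (simp add: cauchy_transform_def sint_def scaleR_conv_of_real)

text \<open>Where the integral diverges, both Bochner integrals have the default value 0, so the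
  real and the complex value agree on the whole line.\<close>

lemma cauchy_transform_of_real: "cauchy_transform s (of_real x) = of_real (cauchy_on_reals s x)"
proof -
  have "(LINT y|cs_abs s. 1 / (complex_of_real x - complex_of_real y)) =
      of_real (LINT y|cs_abs s. 1 / (x - y))"
    by (subst integral_complex_of_real[symmetric]) simp
  then show ?thesis
    by (simp add: cauchy_on_reals_def cauchy_transform_def)
qed

lemma cauchy_on_reals_eq_sint: "cauchy_on_reals s x = sint s (\<lambda>y. 1 / (x - y))"
proof -
  have "(LINT y|cs_abs s. 1 / (complex_of_real x - complex_of_real y)) =
      of_real (LINT y|cs_abs s. 1 / (x - y))"
    by (subst integral_complex_of_real[symmetric]) simp
  then show ?thesis
    by (simp add: cauchy_on_reals_def cauchy_transform_def sint_def)
qed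

lemma sint_0 [simp]: "sint s (\<lambda>x. 0) = 0"
  by (simp add: sint_def)

lemma sint_add:
  "integrable (cs_abs s) f \<Longrightarrow> integrable (cs_abs s) g \<Longrightarrow>
     sint s (\<lambda>x. f x + g x) = sint s f + sint s g"
  by (simp add: sint_def scaleR_add_right)

lemma sint_diff:
  "integrable (cs_abs s) f \<Longrightarrow> integrable (cs_abs s) g \<Longrightarrow>
     sint s (\<lambda>x. f x - g x) = sint s f - sint s g"
  by (simp add: sint_def scaleR_diff_right)

lemma sint_sum:
  "(\<And>i. i \<in> I \<Longrightarrow> integrable (cs_abs s) (f i)) \<Longrightarrow>
     sint s (\<lambda>x. \<Sum>i\<in>I. f i x) = (\<Sum>i\<in>I. sint s (f i))"
  by (simp add: sint_def scaleR_sum_right)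

lemma sint_mult_left:
  fixes f :: "real \<Rightarrow> 'a::{real_normed_field, banach, second_countable_topology}"
  shows "sint s (\<lambda>x. c * f x) = c * sint s f"
  by (simp add: sint_def)

lemma sint_cong_AE:
  assumes "AE x in cs_abs s. f x = g x"
    and "f \<in> borel_measurable (cs_abs s)" "g \<in> borel_measurable (cs_abs s)"
  shows "sint s f = sint s g"
  unfolding sint_def using integral_cong_AE[of f "cs_abs s" g] assms by simp

text \<open>The embedding is isometric, so a convergent sequence of images comes from a Cauchy
  sequence of reals, whose limit lies in \<open>A\<close>.\<close>

lemma closed_of_real_image:
  assumes "closed (A::real set)"
  shows "closed (of_real ` A :: 'a::{real_normed_field, banach} set)"
proof -
  have "\<exists>l\<in>A. g = of_real l"
    if "\<forall>n. f n \<in> of_real ` A" and lim: "f \<longlonglongrightarrow> g" for f and g :: 'a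
  proof -
    have "\<forall>n. \<exists>r. r \<in> A \<and> f n = of_real r" using that(1) by auto
    then obtain h where h': "\<forall>n. h n \<in> A \<and> f n = of_real (h n)" by (rule choice[THEN exE])
    then have h: "\<And>n. h n \<in> A" "f = (\<lambda>n. of_real (h n))" by auto
    have "Cauchy h"
      using LIMSEQ_imp_Cauchy[OF lim] by (simp add: h(2) Cauchy_def)
    then obtain l where l: "h \<longlonglongrightarrow> l" by (auto simp: Cauchy_convergent_iff convergent_def)
    then have "f \<longlonglongrightarrow> of_real l" unfolding h(2) by (rule tendsto_of_real)
    then have "g = of_real l" using lim LIMSEQ_unique by blast
    moreover have "l \<in> A" using closed_sequentially[OF assms _ l] h(1) by blast
    ultimately show ?thesis by blast
  qed
  then show ?thesis by (auto simp: closed_sequential_limits)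
qed

text \<open>Closedness gives every point \<open>z\<close> off \<open>\<Delta>\<close> a positive
  distance from it; this bounds \<open>1 / (z - x)\<close> almost everywhere and makes division by
  \<open>z - x\<close> harmless for integrability.\<close>

locale cs_in =
  fixes s :: cs_measure and \<Delta> :: "real set"
  assumes cs: "s \<in> cs_class \<Delta>" and closed: "closed \<Delta>"
begin

lemma sgn: "cs_sign s = 1 \<or> cs_sign s = -1"
  using cs by (auto simp: cs_class_def)

lemma abs_sgn [simp]: "\<bar>cs_sign s\<bar> = 1"
  using sgn by auto

lemma sets_abs [measurable_cong, simp]: "sets (cs_abs s) = sets borel"
  using cs by (auto simp: cs_class_def)

lemma space_abs [simp]: "space (cs_abs s) = UNIV"
  using sets_eq_imp_space_eq[OF sets_abs] by simp

lemma borel_measurable_abs [simp]: "borel_measurable (cs_abs s) = borel_measurable borel"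
  by (rule measurable_cong_sets) simp_all

lemma integrable_power: "integrable (cs_abs s) (\<lambda>x. x ^ k)"
  using cs by (auto simp: cs_class_def)

sublocale finite_measure "cs_abs s"
proof
  have "integrable (cs_abs s) (\<lambda>x. 1 :: real)"
    using integrable_power[of 0] by simp
  then show "emeasure (cs_abs s) (space (cs_abs s)) \<noteq> \<infinity>"
    by (auto simp: integrable_iff_bounded)
qed

lemma infinite_support: "infinite (measure_support (cs_abs s))"
  and support_subset: "measure_support (cs_abs s) \<subseteq> \<Delta>"
  using cs by (auto simp: cs_class_def)

lemma nonempty: "\<Delta> \<noteq> {}"
  using infinite_support support_subset by auto

lemma infinite_carrier: "infinite \<Delta>"
  using infinite_support support_subset finite_subset by blast

lemma AE_in: "AE x in cs_abs s. x \<in> \<Delta>"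
  using AE_measure_support[OF sets_abs] support_subset by (auto elim: eventually_mono)

lemma emeasure_pos: "emeasure (cs_abs s) UNIV \<noteq> 0"
proof -
  obtain x where "x \<in> measure_support (cs_abs s)"
    using infinite_support by (metis finite.emptyI ex_in_conv)
  then show ?thesis by (auto simp: measure_support_def)
qed

text \<open>The complement of a finite set is open and meets an infinite support, so it has positive
  measure. This contradicts the vanishing almost everywhere of a function with finitely many
  zeros.\<close>

lemma not_AE_finite:
  assumes "finite F" shows "\<not> (AE x in cs_abs s. x \<in> F)"
proof
  assume AE: "AE x in cs_abs s. x \<in> F"
  have "{x \<in> space (cs_abs s). x \<notin> F} = - F" by auto
  moreover have "- F \<in> sets (cs_abs s)"
    using assms by (simp add: borel_closed finite_imp_closed)
  ultimately have "emeasure (cs_abs s) (- F) = 0"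
    using AE_iff_measurable[of "- F" "cs_abs s" "\<lambda>x. x \<in> F"] AE by simp
  moreover obtain x where "x \<in> measure_support (cs_abs s)" "x \<notin> F"
    using infinite_support assms by (meson finite_subset subsetI)
  ultimately show False
    using assms by (auto simp: measure_support_def dest!: spec[of _ "- F"] finite_imp_closed)
qed

lemma integrable_poly:
  fixes p :: "'a::{real_normed_field, banach, second_countable_topology} poly"
  shows "integrable (cs_abs s) (\<lambda>x. poly p (of_real x))"
proof -
  have "integrable (cs_abs s) (\<lambda>x. \<Sum>i\<le>degree p. coeff p i * of_real (x ^ i))"
    by (intro Bochner_Integration.integrable_sum integrable_mult_right integrable_of_real
        integrable_power)
  then show ?thesis by (simp add: poly_altdef)
qed

lemma off_dist:
  fixes z :: "'a::{real_normed_field, banach}"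
  assumes "z \<notin> of_real ` \<Delta>"
  obtains d where "d > 0" "\<And>x. x \<in> \<Delta> \<Longrightarrow> d \<le> norm (z - of_real x)"
proof
  let ?d = "infdist z (of_real ` \<Delta>)"
  show "?d > 0"
    using in_closed_iff_infdist_zero[OF closed_of_real_image[OF closed], of z] assms nonempty
      infdist_nonneg[of z "of_real ` \<Delta>"] by (auto simp: less_le)
  show "?d \<le> norm (z - of_real x)" if "x \<in> \<Delta>" for x
    using infdist_le[of "of_real x" "of_real ` \<Delta>" z] that by (auto simp: dist_norm)
qed

lemma integrable_divide_off:
  fixes f :: "real \<Rightarrow> 'a::{real_normed_field, banach, second_countable_topology}"
  assumes f: "integrable (cs_abs s) f" and z: "z \<notin> of_real ` \<Delta>"
  shows "integrable (cs_abs s) (\<lambda>x. f x / (z - of_real x))"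
proof -
  obtain d where d: "d > 0" "\<And>x. x \<in> \<Delta> \<Longrightarrow> d \<le> norm (z - of_real x)"
    using off_dist[OF z] by blast
  have [measurable]: "f \<in> borel_measurable borel"
    using borel_measurable_integrable[OF f] by simp
  show ?thesis
  proof (rule Bochner_Integration.integrable_bound[where f="\<lambda>x. (1 / d) *\<^sub>R f x"])
    show "AE x in cs_abs s. norm (f x / (z - of_real x)) \<le> norm ((1 / d) *\<^sub>R f x)"
      using AE_in
    proof eventually_elim
      case (elim x)
      have "norm (f x) / norm (z - of_real x) \<le> norm (f x) / d"
        using d(2)[OF elim] d(1) by (intro divide_left_mono mult_pos_pos) auto
      then show ?case using d(1) by (simp add: norm_divide)
    qed
  qed (use f in simp_all)
qed

lemma integrable_cauchy:
  fixes z :: "'a::{real_normed_field, banach, second_countable_topology}"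
  assumes "z \<notin> of_real ` \<Delta>"
  shows "integrable (cs_abs s) (\<lambda>x. 1 / (z - of_real x))"
  using integrable_divide_off[of "\<lambda>x. 1" z] assms by simp

section \<open>Linearity of the moment functional and polynomials of the second kind\<close>

lemma pfun_add: "pfun s (p + q) = pfun s p + pfun s q"
  by (simp add: pfun_def sint_add integrable_poly)

lemma pfun_0 [simp]: "pfun s 0 = 0"
  by (simp add: pfun_def)

lemma pfun_smult: "pfun s (smult c p) = c * pfun s p"
  by (simp add: pfun_def sint_mult_left)

lemma pfun_minus: "pfun s (- p) = - pfun s p"
  using pfun_smult[of "-1" p] by simp

lemma pfun_diff: "pfun s (p - q) = pfun s p - pfun s q"
  using pfun_add[of p "- q"] by (simp add: pfun_minus)

lemma pfun_sum: "pfun s (\<Sum>i\<in>I. p i) = (\<Sum>i\<in>I. pfun s (p i))"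
  by (induction I rule: infinite_finite_induct) (auto simp: pfun_add)

lemma pfun_1_nonzero: "pfun s 1 \<noteq> (0::'a::{real_normed_field, banach, second_countable_topology})"
proof -
  have "measure (cs_abs s) UNIV \<noteq> 0"
    using emeasure_pos by (simp add: emeasure_eq_measure)
  then show ?thesis using sgn by (auto simp: pfun_def sint_def)
qed

lemma coeff_second_kind: "coeff (second_kind s p) i = pfun s (poly_shift (Suc i) p)"
proof (cases "i < degree p")
  case True
  then show ?thesis by (simp add: second_kind_def coeff_sum)
next
  case False
  then have "poly_shift (Suc i) p = 0" by (intro poly_shift_eq_0) simp
  with False show ?thesis by (simp add: second_kind_def coeff_sum)
qed

lemma degree_second_kind: "degree (second_kind s p) \<le> degree p - 1"
  by (rule degree_le) (auto simp: coeff_second_kind poly_shift_eq_0)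

lemma second_kind_0 [simp]: "second_kind s 0 = 0"
  by (simp add: second_kind_def)

lemma second_kind_add: "second_kind s (p + q) = second_kind s p + second_kind s q"
  by (intro poly_eqI) (simp add: coeff_second_kind poly_shift_add pfun_add)

lemma second_kind_smult: "second_kind s (smult c p) = smult c (second_kind s p)"
  by (intro poly_eqI) (simp add: coeff_second_kind poly_shift_smult pfun_smult)

lemma second_kind_minus: "second_kind s (- p) = - second_kind s p"
  using second_kind_smult[of "-1" p] by simp

lemma second_kind_diff: "second_kind s (p - q) = second_kind s p - second_kind s q"
  using second_kind_add[of p "- q"] by (simp add: second_kind_minus)

lemma second_kind_sum: "second_kind s (\<Sum>i\<in>I. p i) = (\<Sum>i\<in>I. second_kind s (p i))"
  by (induction I rule: infinite_finite_induct) (auto simp: second_kind_add)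

text \<open>Horner's scheme: passing from \<open>p\<close> to \<open>a + x * p\<close> shifts the
  polynomial of the second kind and puts the integral of \<open>p\<close> in the constant
  term.\<close>

lemma second_kind_pCons: "second_kind s (pCons a p) = pCons (pfun s p) (second_kind s p)"
proof (rule poly_eqI)
  fix i
  have "poly_shift (Suc j) (pCons a p) = poly_shift j p" for j
    by (intro poly_eqI) (simp add: coeff_poly_shift)
  then show "coeff (second_kind s (pCons a p)) i = coeff (pCons (pfun s p) (second_kind s p)) i"
    by (cases i) (simp_all add: coeff_second_kind)
qed

text \<open>Write \<open>p z = (p z - p x) + p x\<close> under the integral: the difference, divided
  by \<open>z - x\<close>, integrates to the polynomial of the second kind. The induction carries
  this out along Horner's scheme.\<close>

lemma poly_mult_cauchy:
  fixes z :: "'a::{real_normed_field, banach, second_countable_topology}"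
  assumes z: "z \<notin> of_real ` \<Delta>"
  shows "poly p z * sint s (\<lambda>x. 1 / (z - of_real x)) =
    poly (second_kind s p) z + sint s (\<lambda>x. poly p (of_real x) / (z - of_real x))"
proof (induction p)
  case (pCons a p)
  let ?r = "\<lambda>x. 1 / (z - of_real x)"
  have int1: "integrable (cs_abs s) (\<lambda>x. poly p (of_real x) / (z - of_real x))"
    by (intro integrable_divide_off integrable_poly z)
  have int2: "integrable (cs_abs s) ?r"
    by (rule integrable_cauchy[OF z])
  have "AE x in cs_abs s. poly (pCons a p) (of_real x) / (z - of_real x) =
      a * ?r x + (z * (poly p (of_real x) / (z - of_real x)) - poly p (of_real x))"
    using AE_in
  proof eventually_elim
    case (elim x)
    then have "z - of_real x \<noteq> 0" using z by auto
    \<comment> \<open>Replacing the factor \<open>x\<close> by \<open>z - (z - x)\<close> cancels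
      the denominator in one term, which then integrates to \<open>pfun s p\<close>.\<close>
    moreover have "poly (pCons a p) (of_real x) = a + z * poly p (of_real x) - poly p (of_real x) * (z - of_real x)"
      by (simp add: algebra_simps)
    ultimately show ?case by (simp add: diff_divide_distrib add_divide_distrib)
  qed
  then have "sint s (\<lambda>x. poly (pCons a p) (of_real x) / (z - of_real x)) =
      sint s (\<lambda>x. a * ?r x + (z * (poly p (of_real x) / (z - of_real x)) - poly p (of_real x)))"
    by (rule sint_cong_AE)
       (rule borel_measurable_integrable,
        rule integrable_divide_off[OF integrable_poly z]
          Bochner_Integration.integrable_add[OF integrable_mult_right[OF int2]
            Bochner_Integration.integrable_diff[OF integrable_mult_right[OF int1] integrable_poly]])+
  also have "\<dots> = a * sint s ?r
      + (z * sint s (\<lambda>x. poly p (of_real x) / (z - of_real x)) - pfun s p)"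
    unfolding pfun_def
    by (simp only: sint_mult_left
        sint_add[OF integrable_mult_right[OF int2]
          Bochner_Integration.integrable_diff[OF integrable_mult_right[OF int1] integrable_poly]]
        sint_diff[OF integrable_mult_right[OF int1] integrable_poly])
  finally show ?case
    using pCons.IH by (simp add: second_kind_pCons algebra_simps)
qed simp

end

section \<open>Expansion at infinity\<close>

text \<open>A nonconstant polynomial is unbounded along any curve going to infinity. The imaginary
  axis is the convenient one, since it moves away from every real set.\<close>

lemma poly_zero_of_tendsto_0_imaginary:
  assumes lim: "((\<lambda>y::real. poly T (\<i> * of_real y)) \<longlongrightarrow> (0::complex)) at_top"
  shows "T = 0"
proof (cases T)
  case (pCons a p)
  show ?thesis
  proof (cases "p = 0")
    case True
    then have "((\<lambda>y::real. a) \<longlongrightarrow> 0) at_top" using lim pCons by simp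
    then show ?thesis using pCons True by (simp add: tendsto_const_iff)
  next
    case False
    obtain r where r: "\<And>z. r \<le> norm z \<Longrightarrow> 1 \<le> norm (poly T z)"
      using poly_infinity[OF False, of 1 a] pCons by auto
    have "eventually (\<lambda>y. norm (poly T (\<i> * of_real y)) < 1) at_top"
      using tendstoD[OF lim, of 1] by simp
    then have "eventually (\<lambda>y::real. False) at_top"
      using eventually_ge_at_top[of "\<bar>r\<bar>"]
    proof eventually_elim
      case (elim y)
      then have "r \<le> norm (\<i> * of_real y :: complex)" by (simp add: norm_mult)
      from r[OF this] elim show ?case by simp
    qed
    then show ?thesis by simp
  qed
qed

lemma sint_norm_le:
  assumes "\<bar>cs_sign s\<bar> = 1"
  shows "norm (sint s f) \<le> (LINT x|cs_abs s. norm (f x))"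
  using assms by (simp add: sint_def integral_norm_bound)

context cs_in
begin

text \<open>This is \<open>z / (z - x) = 1 + x / (z - x)\<close>, integrated against
  \<open>q\<close>. Iteration yields the expansion in powers of \<open>1 / z\<close> with an exact
  remainder.\<close>

lemma mult_sint_cauchy:
  fixes z :: "'a::{real_normed_field, banach, second_countable_topology}"
  assumes z: "z \<notin> of_real ` \<Delta>"
  shows "z * sint s (\<lambda>x. poly q (of_real x) / (z - of_real x)) =
    pfun s q + sint s (\<lambda>x. poly (pCons 0 q) (of_real x) / (z - of_real x))"
  using poly_mult_cauchy[OF z, of q] poly_mult_cauchy[OF z, of "pCons 0 q"]
  by (simp add: second_kind_pCons algebra_simps)

lemma power_mult_sint_cauchy:
  fixes z :: "'a::{real_normed_field, banach, second_countable_topology}"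
  assumes z: "z \<notin> of_real ` \<Delta>"
  shows "z ^ N * sint s (\<lambda>x. poly q (of_real x) / (z - of_real x)) =
    (\<Sum>\<nu><N. pfun s (monom 1 \<nu> * q) * z ^ (N - 1 - \<nu>))
      + sint s (\<lambda>x. poly (monom 1 N * q) (of_real x) / (z - of_real x))"
proof (induction N)
  case (Suc N)
  have "(\<Sum>\<nu><N. pfun s (monom 1 \<nu> * q) * z ^ (N - \<nu>)) =
      z * (\<Sum>\<nu><N. pfun s (monom 1 \<nu> * q) * z ^ (N - 1 - \<nu>))"
    unfolding sum_distrib_left
  proof (intro sum.cong refl)
    fix \<nu> assume "\<nu> \<in> {..<N}"
    then have "Suc (N - 1 - \<nu>) = N - \<nu>" by auto
    then have "z ^ (N - \<nu>) = z * z ^ (N - 1 - \<nu>)" by (metis power_Suc)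
    then show "pfun s (monom 1 \<nu> * q) * z ^ (N - \<nu>) =
        z * (pfun s (monom 1 \<nu> * q) * z ^ (N - 1 - \<nu>))" by (simp only: mult.left_commute)
  qed
  moreover have "pCons 0 (monom 1 N * q) = monom 1 (Suc N) * q"
    by (simp add: monom_Suc)
  ultimately show ?case
    using Suc mult_sint_cauchy[OF z, of "monom 1 N * q"] by (simp add: algebra_simps)
qed simp

lemma norm_sint_cauchy_le:
  fixes z :: "'a::{real_normed_field, banach, second_countable_topology}"
  assumes z: "infdist z (of_real ` \<Delta>) \<ge> d" "d > 0"
    and f: "integrable (cs_abs s) f"
  shows "norm (sint s (\<lambda>x. f x / (z - of_real x))) \<le> (LINT x|cs_abs s. norm (f x)) / d"
proof -
  have d: "norm (z - of_real x) \<ge> d" if "x \<in> \<Delta>" for x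
    using infdist_le[of "of_real x" "of_real ` \<Delta>" z] that z by (auto simp: dist_norm)
  then have z': "z \<notin> of_real ` \<Delta>" using z(2) by fastforce
  have "norm (sint s (\<lambda>x. f x / (z - of_real x))) \<le>
      (LINT x|cs_abs s. norm (f x / (z - of_real x)))"
    by (intro sint_norm_le abs_sgn)
  also have "\<dots> \<le> (LINT x|cs_abs s. norm (f x) / d)"
  proof (rule integral_mono_AE)
    show "integrable (cs_abs s) (\<lambda>x. norm (f x / (z - of_real x)))"
      by (intro integrable_norm integrable_divide_off f z')
    show "integrable (cs_abs s) (\<lambda>x. norm (f x) / d)" using f by simp
    show "AE x in cs_abs s. norm (f x / (z - of_real x)) \<le> norm (f x) / d"
      using AE_in
    proof eventually_elim
      case (elim x)
      then show ?case using d[OF elim] z(2)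
        by (simp add: norm_divide) (intro divide_left_mono mult_pos_pos, auto)
    qed
  qed
  finally show ?thesis by simp
qed

end

lemma abs_le_infdist_imaginary:
  assumes "\<Delta> \<noteq> {}"
  shows "\<bar>y\<bar> \<le> infdist (\<i> * complex_of_real y) (complex_of_real ` \<Delta>)"
proof -
  have "\<bar>y\<bar> \<le> dist (\<i> * complex_of_real y) (complex_of_real x)" for x
    using abs_Im_le_cmod[of "\<i> * complex_of_real y - complex_of_real x"] by (simp add: dist_norm)
  then show ?thesis using assms by (subst infdist_notempty) (auto intro!: cINF_greatest)
qed

text \<open>On the imaginary axis the distance to any nonempty real set is at least the modulus, so
  the axis lies in every region with \<open>c \<le> 1\<close>.\<close>

lemma filterlim_imaginary_axis:
  assumes "c \<le> 1" "\<Delta> \<noteq> {}"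
  shows "filterlim (\<lambda>y. \<i> * complex_of_real y)
    (inf at_infinity (principal {z. c * norm z \<le> infdist z (complex_of_real ` \<Delta>)})) at_top"
proof -
  have "filterlim (\<lambda>y. \<i> * complex_of_real y) at_infinity at_top"
    by (rule filterlim_norm_at_top_imp_at_infinity) (simp add: norm_mult filterlim_abs_real)
  moreover have "c * norm (\<i> * complex_of_real y) \<le> infdist (\<i> * complex_of_real y) (complex_of_real ` \<Delta>)"
    for y
  proof -
    have "\<bar>y\<bar> \<le> infdist (\<i> * complex_of_real y) (complex_of_real ` \<Delta>)"
      by (rule abs_le_infdist_imaginary[OF assms(2)])
    moreover have "c * \<bar>y\<bar> \<le> \<bar>y\<bar>" using assms(1) mult_right_mono[of c 1 "\<bar>y\<bar>"] by simp
    ultimately show ?thesis by (simp add: norm_mult)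
  qed
  ultimately show ?thesis
    by (auto simp: filterlim_inf filterlim_principal)
qed

text \<open>Multiplied by \<open>z ^ N\<close>, the form equals a polynomial \<open>T\<close> plus a
  remainder \<open>E\<close> bounded by a constant over the distance to \<open>\<Delta>\<close>. On
  each region that distance is at least a fixed multiple of the modulus, so the order condition says
  exactly that \<open>T\<close> vanishes.\<close>

lemma bigo_at_infinity_off_iff:
  fixes p :: "'k \<Rightarrow> complex poly"
  assumes \<Delta>: "closed \<Delta>" and K: "finite K" "K \<noteq> {}" and s: "\<And>k. k \<in> K \<Longrightarrow> s k \<in> cs_class \<Delta>"
  shows "bigo_at_infinity_off \<Delta> (N + 1)
      (\<lambda>z. poly p0 z + (\<Sum>k\<in>K. poly (p k) z * cauchy_transform (s k) z)) \<longleftrightarrow>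
    p0 + (\<Sum>k\<in>K. second_kind (s k) (p k)) = 0 \<and>
    (\<forall>\<nu><N. (\<Sum>k\<in>K. pfun (s k) (monom 1 \<nu> * p k)) = 0)"
    (is "bigo_at_infinity_off \<Delta> (N + 1) ?F \<longleftrightarrow> ?P = 0 \<and> (\<forall>\<nu><N. ?\<mu> \<nu> = 0)")
proof -
  have cs: "cs_in (s k) \<Delta>" if "k \<in> K" for k
    using s[OF that] \<Delta> by unfold_locales
  from K(2) obtain k0 where "k0 \<in> K" by auto
  have ne: "\<Delta> \<noteq> {}" using cs_in.nonempty[OF cs[OF \<open>k0 \<in> K\<close>]] .
  \<comment> \<open>The polynomial part occupies the degrees from \<open>N\<close> on and the
    moments the degrees below \<open>N\<close>, so \<open>T\<close> vanishes only if all of them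
    do.\<close>
  define T where "T = monom 1 N * ?P + (\<Sum>\<nu><N. monom (?\<mu> \<nu>) (N - 1 - \<nu>))"
  define E where "E z = (\<Sum>k\<in>K. sint (s k) (\<lambda>x. poly (monom 1 N * p k) (of_real x) / (z - of_real x)))"
    for z :: complex
  define G where "G = ?F"
  have F: "z ^ N * G z = poly T z + E z" if z: "z \<notin> of_real ` \<Delta>" for z
  proof -
    have "G z = poly ?P z + (\<Sum>k\<in>K. sint (s k) (\<lambda>x. poly (p k) (of_real x) / (z - of_real x)))"
      using cs_in.poly_mult_cauchy[OF cs z]
      by (simp add: G_def cauchy_transform_eq_sint poly_sum sum.distrib)
    also have "z ^ N * \<dots> = z ^ N * poly ?P z +
        (\<Sum>k\<in>K. (\<Sum>\<nu><N. pfun (s k) (monom 1 \<nu> * p k) * z ^ (N - 1 - \<nu>))) + E z"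
      using cs_in.power_mult_sint_cauchy[OF cs z, of _ N]
      by (simp add: E_def distrib_left sum_distrib_left sum.distrib)
    also have "(\<Sum>k\<in>K. (\<Sum>\<nu><N. pfun (s k) (monom 1 \<nu> * p k) * z ^ (N - 1 - \<nu>))) =
        (\<Sum>\<nu><N. ?\<mu> \<nu> * z ^ (N - 1 - \<nu>))"
      by (subst sum.swap) (simp add: sum_distrib_right)
    finally show ?thesis by (simp add: T_def poly_monom poly_sum)
  qed
  obtain C where C: "C \<ge> 0" "\<And>z d. d > 0 \<Longrightarrow> d \<le> infdist z (of_real ` \<Delta>) \<Longrightarrow> norm (E z) \<le> C / d"
  proof
    let ?C = "\<Sum>k\<in>K. LINT x|cs_abs (s k). norm (poly (monom 1 N * p k) (complex_of_real x))"
    show "?C \<ge> 0" by (intro sum_nonneg integral_nonneg_AE) auto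
    show "norm (E z) \<le> ?C / d" if "d > 0" "d \<le> infdist z (of_real ` \<Delta>)" for z d
      unfolding E_def sum_divide_distrib
      by (intro sum_norm_le cs_in.norm_sint_cauchy_le[OF cs] that cs_in.integrable_poly[OF cs])
  qed
  have T0: "T = 0 \<longleftrightarrow> ?P = 0 \<and> (\<forall>\<nu><N. ?\<mu> \<nu> = 0)"
  proof
    assume T: "T = 0"
    have c: "coeff T i = (if i < N then 0 else coeff ?P (i - N)) + (\<Sum>\<nu><N. if N - 1 - \<nu> = i then ?\<mu> \<nu> else 0)" for i
      by (simp add: T_def coeff_monom_mult coeff_sum)
    have "coeff ?P i = coeff T (N + i)" for i
      unfolding c by (auto intro!: sum.neutral)
    then have "?P = 0" using T by (simp add: poly_eq_iff)
    moreover have "?\<mu> \<nu> = 0" if "\<nu> < N" for \<nu>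
    proof -
      have "(\<Sum>\<nu>'<N. if N - 1 - \<nu>' = N - 1 - \<nu> then ?\<mu> \<nu>' else 0) =
          (\<Sum>\<nu>'<N. if \<nu> = \<nu>' then ?\<mu> \<nu>' else 0)"
        using that by (intro sum.cong) auto
      then have "coeff T (N - 1 - \<nu>) = ?\<mu> \<nu>"
        unfolding c using that by (simp add: sum.delta)
      with T show ?thesis by simp
    qed
    ultimately show "?P = 0 \<and> (\<forall>\<nu><N. ?\<mu> \<nu> = 0)" by blast
  qed (simp add: T_def)
  have off: "z \<notin> of_real ` \<Delta>" if "0 < infdist z (of_real ` \<Delta>)" for z
    using that by (metis infdist_zero less_irrefl)
  show ?thesis unfolding T0[symmetric] G_def[symmetric]
  proof
    let ?z = "\<lambda>y. \<i> * complex_of_real y"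
    assume "bigo_at_infinity_off \<Delta> (N + 1) G"
    then have "G \<in> O[inf at_infinity (principal {z. 1 * norm z \<le> infdist z (complex_of_real ` \<Delta>)})](\<lambda>z. 1 / z ^ (N + 1))"
      unfolding bigo_at_infinity_off_def by (meson zero_less_one)
    then have "(\<lambda>y. G (?z y)) \<in> O(\<lambda>y::real. 1 / ?z y ^ (N + 1))"
      by (rule landau_o.big.compose[OF _ filterlim_imaginary_axis[OF order_refl ne]])
    then obtain c where c: "eventually (\<lambda>y. norm (G (?z y)) \<le> c * norm (1 / ?z y ^ (N + 1))) at_top"
      by (auto elim: landau_o.bigE)
    have "eventually (\<lambda>y. norm (poly T (?z y)) \<le> (c + C) / y) at_top"
      using c eventually_gt_at_top[of 0]
    proof eventually_elim
      case (elim y)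
      have y: "y \<le> infdist (?z y) (of_real ` \<Delta>)"
        using abs_le_infdist_imaginary[OF ne, of y] elim by simp
      have "norm (poly T (?z y)) = norm (?z y ^ N * G (?z y) - E (?z y))"
        using F[OF off, of "?z y"] y elim by simp
      also have "\<dots> \<le> y ^ N * norm (G (?z y)) + norm (E (?z y))"
        using norm_triangle_ineq4[of "?z y ^ N * G (?z y)" "E (?z y)"] elim
        by (simp only: norm_mult norm_power) simp
      finally have 1: "norm (poly T (?z y)) \<le> y ^ N * norm (G (?z y)) + norm (E (?z y))" .
      have "norm (G (?z y)) \<le> c / y ^ (N + 1)"
        using elim(1,2) by (simp only: norm_mult norm_power norm_divide) simp
      then have "y ^ N * norm (G (?z y)) \<le> y ^ N * (c / y ^ (N + 1))"
        using elim(2) by (intro mult_left_mono) auto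
      moreover have "y ^ N * (c / y ^ (N + 1)) = c / y" using elim(2) by simp
      moreover have "norm (E (?z y)) \<le> C / y" using C(2)[OF _ y] elim(2) by simp
      ultimately show ?case using 1 unfolding add_divide_distrib by linarith
    qed
    moreover have "((\<lambda>y. (c + C) / y) \<longlongrightarrow> 0) at_top"
      by (intro tendsto_divide_0[OF tendsto_const] filterlim_at_top_imp_at_infinity filterlim_ident)
    ultimately show "T = 0"
      by (rule poly_zero_of_tendsto_0_imaginary[OF Lim_null_comparison])
  next
    assume T: "T = 0"
    show "bigo_at_infinity_off \<Delta> (N + 1) G"
      unfolding bigo_at_infinity_off_def
    proof (intro allI impI landau_o.bigI)
      fix c :: real assume c: "c > 0"
      \<comment> \<open>The summand 1 keeps the constant positive when \<open>C\<close> is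
        0.\<close>
      show "C / c + 1 > 0" using C(1) c by (simp add: add_nonneg_pos)
      have "eventually (\<lambda>z::complex. 0 < norm z) at_infinity"
        by (auto simp: eventually_at_infinity intro!: exI[of _ 1])
      then show "eventually (\<lambda>z. norm (G z) \<le> (C / c + 1) * norm (1 / z ^ (N + 1)))
          (inf at_infinity (principal {z. c * norm z \<le> infdist z (complex_of_real ` \<Delta>)}))"
        unfolding eventually_inf_principal
      proof eventually_elim
        case (elim z)
        show ?case
        proof
          assume "z \<in> {z. c * norm z \<le> infdist z (complex_of_real ` \<Delta>)}"
          then have z: "c * norm z \<le> infdist z (complex_of_real ` \<Delta>)" by simp
          have pos: "c * norm z > 0" using c elim by simp
          have "norm z ^ N * norm (G z) = norm (z ^ N * G z)" by (simp add: norm_mult norm_power)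
          also have "\<dots> = norm (E z)" using F[OF off, of z] z pos T by simp
          also have "\<dots> \<le> C / (c * norm z)" using C(2)[OF pos z] .
          also have "\<dots> \<le> (C / c + 1) / norm z" using c elim by (simp add: field_simps)
          finally have "norm (G z) \<le> (C / c + 1) / norm z / norm z ^ N"
            using elim by (subst pos_le_divide_eq) (auto simp: mult.commute)
          also have "\<dots> = (C / c + 1) * norm (1 / z ^ (N + 1))"
            by (simp add: norm_divide norm_mult norm_power)
          finally show "norm (G z) \<le> (C / c + 1) * norm (1 / z ^ (N + 1))" .
        qed
      qed
    qed
  qed
qed

section \<open>Polynomials and sign changes\<close>

text \<open>Gaussian elimination: a pivot in row \<open>r\<close> is eliminated from the other rows,
  the smaller system is solved by induction, and the pivot unknown is recovered from row
  \<open>r\<close>.\<close>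

lemma homogeneous_system_nontrivial:
  fixes A :: "'r \<Rightarrow> 'i \<Rightarrow> 'f::field"
  assumes "finite R" "finite I" "card R < card I"
  shows "\<exists>x. (\<exists>i\<in>I. x i \<noteq> 0) \<and> (\<forall>r\<in>R. (\<Sum>i\<in>I. A r i * x i) = 0)"
  using assms
proof (induction R arbitrary: I A rule: finite_induct)
  case empty
  then have "I \<noteq> {}" by auto
  then show ?case by (auto intro!: exI[of _ "\<lambda>i. 1"])
next
  case (insert r R)
  show ?case
  proof (cases "\<forall>i\<in>I. A r i = 0")
    case True
    with insert.IH[of I A] insert.prems insert.hyps show ?thesis by force
  next
    case False
    then obtain p where p: "p \<in> I" "A r p \<noteq> 0" by auto
    let ?B = "\<lambda>s i. A s i - A s p * A r i / A r p"
    have "finite (I - {p})" "card R < card (I - {p})"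
      using insert.prems insert.hyps p by (auto simp: card_Diff_singleton)
    from insert.IH[OF this, of ?B]
    obtain x where x: "\<exists>i\<in>I - {p}. x i \<noteq> 0" "\<forall>s\<in>R. (\<Sum>i\<in>I - {p}. ?B s i * x i) = 0"
      by blast
    define c where "c = - (\<Sum>i\<in>I - {p}. A r i * x i) / A r p"
    let ?y = "x(p := c)"
    have split: "(\<Sum>i\<in>I. A s i * ?y i) = A s p * c + (\<Sum>i\<in>I - {p}. A s i * x i)" for s
      using p(1) insert.prems by (subst sum.remove[of I p]) (auto intro!: sum.cong)
    have "(\<Sum>i\<in>I. A s i * ?y i) = 0" if "s \<in> insert r R" for s
    proof (cases "s = r")
      case True
      then show ?thesis using p(2) by (subst split) (simp add: c_def)
    next
      case False
      then have "0 = (\<Sum>i\<in>I - {p}. ?B s i * x i)" using x(2) that by auto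
      also have "\<dots> = (\<Sum>i\<in>I - {p}. A s i * x i) - A s p / A r p * (\<Sum>i\<in>I - {p}. A r i * x i)"
        unfolding sum_distrib_left sum_subtractf[symmetric]
        by (intro sum.cong) (simp_all add: left_diff_distrib)
      finally show ?thesis by (subst split) (simp add: c_def mult_ac)
    qed
    moreover have "\<exists>i\<in>I. ?y i \<noteq> 0" using x(1) by auto
    ultimately show ?thesis by blast
  qed
qed

definition root_poly :: "'a::comm_ring_1 set \<Rightarrow> 'a poly" where
  "root_poly X = (\<Prod>t\<in>X. [:- t, 1:])"

lemma poly_root_poly: "poly (root_poly X) x = (\<Prod>t\<in>X. x - t)"
  by (simp add: root_poly_def poly_prod)

lemma degree_root_poly:
  fixes X :: "'a::idom set"
  shows "degree (root_poly X) = card X"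
  unfolding root_poly_def by (subst degree_prod_eq_sum_degree) auto

text \<open>Lagrange interpolation at the nodes \<open>X\<close> reproduces \<open>p\<close>,
  because its degree is less than their number; division by \<open>root_poly X\<close> leaves one
  simple fraction per node.\<close>

lemma partial_fractions:
  fixes p :: "'a::field poly"
  assumes X: "finite X" and p: "degree p < card X"
  shows "\<exists>c. \<forall>x. x \<notin> X \<longrightarrow> poly p x / poly (root_poly X) x = (\<Sum>t\<in>X. c t / (x - t))"
proof (intro exI allI impI)
  define w where "w t = poly (root_poly (X - {t})) t" for t
  define q where "q = (\<Sum>t\<in>X. smult (poly p t / w t) (root_poly (X - {t})))"
  have w: "w t \<noteq> 0" if "t \<in> X" for t
    using X by (auto simp: w_def poly_root_poly)
  have "p = q"
  proof (rule poly_eqI_degree)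
    fix x assume x: "x \<in> X"
    have "poly q x = (\<Sum>t\<in>X. if t = x then poly p x else 0)"
      unfolding q_def poly_sum
    proof (rule sum.cong)
      fix t assume t: "t \<in> X"
      have "poly (root_poly (X - {t})) x = 0" if "t \<noteq> x"
        using that X x by (auto simp: poly_root_poly)
      then show "poly (smult (poly p t / w t) (root_poly (X - {t}))) x = (if t = x then poly p x else 0)"
        using w[OF t] by (auto simp: w_def)
    qed simp
    then show "poly p x = poly q x" using X x by simp
  next
    have "degree q \<le> card X - 1"
      unfolding q_def
      by (intro degree_sum_le X order_trans[OF degree_smult_le])
         (use X in \<open>auto simp: degree_root_poly\<close>)
    then show "degree q < card X" using p by linarith
  qed (rule p)
  fix x assume x: "x \<notin> X"
  have "poly p x / poly (root_poly X) x = (\<Sum>t\<in>X. poly p t / w t * (poly (root_poly (X - {t})) x / poly (root_poly X) x))"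
    by (subst \<open>p = q\<close>) (simp add: q_def poly_sum sum_divide_distrib)
  also have "\<dots> = (\<Sum>t\<in>X. (poly p t / w t) / (x - t))"
  proof (rule sum.cong)
    fix t assume t: "t \<in> X"
    have "poly (root_poly X) x = (x - t) * poly (root_poly (X - {t})) x"
      using X t by (simp add: poly_root_poly prod.remove)
    moreover have "poly (root_poly (X - {t})) x \<noteq> 0"
      using X x by (auto simp: poly_root_poly)
    ultimately have "poly (root_poly (X - {t})) x / poly (root_poly X) x = 1 / (x - t)"
      by simp
    then show "poly p t / w t * (poly (root_poly (X - {t})) x / poly (root_poly X) x) =
        (poly p t / w t) / (x - t)" by simp
  qed simp
  finally show "poly p x / poly (root_poly X) x = (\<Sum>t\<in>X. (poly p t / w t) / (x - t))" .
qed

text \<open>A root outside \<open>X\<close> would exceed the degree, and a double root at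
  \<open>z\<close> would leave a cofactor of degree \<open>degree p - 2\<close> with at least
  \<open>card X - 1\<close> roots.\<close>

lemma roots_simple:
  fixes p :: "'a::field poly"
  assumes "p \<noteq> 0" "degree p \<le> card X" "finite X" "\<And>x. x \<in> X \<Longrightarrow> poly p x = 0" "poly p z = 0"
  shows "z \<in> X \<and> order z p = 1"
proof
  show z: "z \<in> X"
  proof (rule ccontr)
    assume "z \<notin> X"
    then have "card X + 1 = card (insert z X)" using assms by simp
    also have "\<dots> \<le> card {x. poly p x = 0}"
      using assms by (intro card_mono poly_roots_finite) auto
    also have "\<dots> \<le> degree p" by (rule card_poly_roots_bound[OF assms(1)])
    finally show False using assms by simp
  qed
  have "order z p \<ge> 1" using assms by (simp add: order_root Suc_le_eq)
  moreover have "\<not> order z p \<ge> 2"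
  proof
    assume "order z p \<ge> 2"
    then have "[:- z, 1:] ^ 2 dvd p" by (rule order_divides[THEN iffD2, OF disjI2])
    then obtain q where q: "p = [:- z, 1:] ^ 2 * q" by (elim dvdE)
    then have q0: "q \<noteq> 0" using assms(1) by auto
    have "degree p = 2 + degree q"
      unfolding q using q0 by (subst degree_mult_eq) (auto simp: degree_power_eq)
    moreover have "poly q x = 0" if "x \<in> X - {z}" for x
      using assms(4)[of x] that by (auto simp: q)
    then have "card (X - {z}) \<le> card {x. poly q x = 0}"
      using q0 by (intro card_mono poly_roots_finite) auto
    then have "card (X - {z}) \<le> degree q" using card_poly_roots_bound[OF q0] by linarith
    ultimately show False using assms z by (simp add: card_Diff_singleton)
  qed
  ultimately show "order z p = 1" by linarith
qed

lemma interval_nonzero_const_sign: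
  fixes f :: "real \<Rightarrow> real"
  assumes "is_interval I" "continuous_on I f" "\<And>x. x \<in> I \<Longrightarrow> f x \<noteq> 0"
  shows "(\<forall>x\<in>I. 0 < f x) \<or> (\<forall>x\<in>I. f x < 0)"
proof (rule ccontr)
  assume "\<not> ?thesis"
  then obtain x y where xy: "x \<in> I" "f x \<le> 0" "y \<in> I" "f y \<ge> 0" by (auto simp: not_less)
  have "is_interval (f ` I)"
    using assms connected_continuous_image by (simp add: is_interval_connected_1)
  then have "0 \<in> f ` I" using xy unfolding is_interval_1 by blast
  then show False using assms(3) by auto
qed

text \<open>Remove the largest zero \<open>b\<close>: the polynomial \<open>q\<close> for the part
  left of \<open>b\<close> has all its zeros there, so \<open>q * f\<close> has one sign to the
  right of \<open>b\<close>, and a factor \<open>b - x\<close> is added only if that sign is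
  negative.\<close>

lemma sign_polynomial:
  fixes f :: "real \<Rightarrow> real"
  assumes "finite Z" "is_interval I" "continuous_on I f" "Z = {x\<in>I. f x = 0}"
  shows "\<exists>q. degree q \<le> card Z \<and> (\<forall>x. poly q x = 0 \<longrightarrow> x \<in> Z) \<and> (\<forall>x\<in>I. 0 \<le> poly q x * f x)"
  using assms
proof (induction Z arbitrary: I rule: finite_linorder_max_induct)
  case empty
  then have "(\<forall>x\<in>I. 0 < f x) \<or> (\<forall>x\<in>I. f x < 0)"
    by (intro interval_nonzero_const_sign) auto
  then show ?case
  proof
    assume "\<forall>x\<in>I. 0 < f x"
    then show ?thesis by (intro exI[of _ 1]) (auto simp: less_imp_le)
  next
    assume "\<forall>x\<in>I. f x < 0"
    then show ?thesis by (intro exI[of _ "-1"]) (auto simp: less_imp_le)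
  qed
next
  case (insert b A)
  let ?L = "I \<inter> {..<b}" and ?R = "I \<inter> {b<..}"
  have iv: "is_interval ?L" "is_interval ?R"
    using insert.prems(1) by (auto intro!: convex_Int convex_real_interval simp: is_interval_convex_1)
  have b: "b \<in> I" "f b = 0" using insert.prems by auto
  have "A = {x \<in> ?L. f x = 0}" using insert.prems(3) insert.hyps(2) by auto
  with insert.IH[OF iv(1)] continuous_on_subset[OF insert.prems(2)] obtain q where
    q: "degree q \<le> card A" "\<And>x. poly q x = 0 \<Longrightarrow> x \<in> A" "\<And>x. x \<in> ?L \<Longrightarrow> 0 \<le> poly q x * f x"
    by blast
  have card: "card (insert b A) = Suc (card A)" using insert.hyps by auto
  have "continuous_on ?R (\<lambda>x. poly q x * f x)"
    using insert.prems(2) by (intro continuous_intros continuous_on_subset[OF insert.prems(2)]) auto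
  moreover have "poly q x * f x \<noteq> 0" if "x \<in> ?R" for x
    using that q(2)[of x] insert.hyps(2) insert.prems(3) by force
  ultimately have "(\<forall>x\<in>?R. 0 < poly q x * f x) \<or> (\<forall>x\<in>?R. poly q x * f x < 0)"
    by (intro interval_nonzero_const_sign iv)
  then show ?case
  proof
    assume R: "\<forall>x\<in>?R. 0 < poly q x * f x"
    have "0 \<le> poly q x * f x" if "x \<in> I" for x
      using R q(3)[of x] b that by (cases x b rule: linorder_cases) (auto simp: less_imp_le)
    then show ?thesis using q card by (intro exI[of _ q]) auto
  next
    assume R: "\<forall>x\<in>?R. poly q x * f x < 0"
    have "0 \<le> poly (q * [:b, -1:]) x * f x" if "x \<in> I" for x
    proof -
      have "0 \<le> (b - x) * (poly q x * f x)"
        using R q(3)[of x] b that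
        by (cases x b rule: linorder_cases) (auto simp: less_imp_le intro: mult_nonpos_nonpos)
      then show ?thesis by (simp add: algebra_simps)
    qed
    moreover have "degree (q * [:b, -1:]) \<le> Suc (card A)"
      using degree_mult_le[of q "[:b, -1:]"] q(1) by simp
    moreover have "x \<in> insert b A" if "poly (q * [:b, -1:]) x = 0" for x
      using that q(2)[of x] by auto
    ultimately show ?thesis using card by (intro exI[of _ "q * [:b, -1:]"]) auto
  qed
qed

lemma finite_interval_minus_interior:
  fixes S :: "real set"
  assumes "is_interval S"
  shows "finite (S - interior S)"
proof -
  have "S - interior S \<subseteq> {x\<in>S. \<forall>y\<in>S. x \<le> y} \<union> {x\<in>S. \<forall>y\<in>S. y \<le> x}"
  proof (rule subsetI, rule ccontr)
    fix x assume x: "x \<in> S - interior S"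
      and "x \<notin> {x\<in>S. \<forall>y\<in>S. x \<le> y} \<union> {x\<in>S. \<forall>y\<in>S. y \<le> x}"
    then obtain y z where yz: "y \<in> S" "z \<in> S" "y < x" "x < z" by (auto simp: not_le)
    then have "{y<..<z} \<subseteq> S" using assms[unfolded is_interval_1, rule_format, OF yz(1,2)] by auto
    then have "x \<in> interior S" using yz by (intro interiorI[of "{y<..<z}"]) auto
    then show False using x by simp
  qed
  moreover have "finite {x\<in>S. \<forall>y\<in>S. x \<le> y}"
    by (rule finite_subset[of _ "{Inf S}"]) (auto intro!: cInf_eq_minimum[symmetric])
  moreover have "finite {x\<in>S. \<forall>y\<in>S. y \<le> x}"
    by (rule finite_subset[of _ "{Sup S}"]) (auto intro!: cSup_eq_maximum[symmetric])
  ultimately show ?thesis by (meson finite_UnI finite_subset)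
qed

context cs_in
begin

text \<open>With fewer than \<open>n\<close> zeros, a sign polynomial \<open>q\<close> of degree
  below \<open>n\<close> makes \<open>q * f\<close> nonnegative; its integral is zero, so the
  measure would be carried by finitely many points. Continuity is asked on \<open>D\<close> only,
  since \<open>f\<close> may be singular at an endpoint shared with the next interval.\<close>

lemma zeros_of_orthogonal:
  assumes iv: "is_interval \<Delta>"
    and D: "interior \<Delta> \<subseteq> D" "D \<subseteq> \<Delta>" "AE x in cs_abs s. x \<in> D"
    and cont: "continuous_on D f"
    and orth: "\<And>p::real poly. degree p < n \<Longrightarrow> integrable (cs_abs s) (\<lambda>x. poly p x * f x) \<and>
        sint s (\<lambda>x. poly p x * f x) = 0"
  shows "\<exists>X. X \<subseteq> interior \<Delta> \<and> finite X \<and> card X = n \<and> (\<forall>x\<in>X. f x = 0)"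
proof -
  let ?Z = "{x \<in> interior \<Delta>. f x = 0}"
  show ?thesis
  proof (cases "finite ?Z \<and> card ?Z < n")
    case False
    obtain X where "X \<subseteq> ?Z" "finite X" "card X = n"
    proof (cases "finite ?Z")
      case True
      with False have "n \<le> card ?Z" by simp
      from obtain_subset_with_card_n[OF this] show ?thesis using that by metis
    next
      case False
      from infinite_arbitrarily_large[OF this] show ?thesis using that by metis
    qed
    then show ?thesis by auto
  next
    case True
    have "\<Delta> \<subseteq> interior \<Delta> \<union> (\<Delta> - interior \<Delta>)" by auto
    then have "infinite (interior \<Delta>)"
      using finite_interval_minus_interior[OF iv] infinite_carrier
      by (meson finite_UnI finite_subset)
    then have "interior \<Delta> \<noteq> {}" by auto
    then have cl: "D \<subseteq> closure (interior \<Delta>)"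
      using D(2) closure_subset[of \<Delta>] iv by (simp add: convex_closure_interior is_interval_convex_1)
    have "is_interval (interior \<Delta>)"
      using iv by (simp add: is_interval_convex_1 convex_interior)
    then obtain q where q: "degree q \<le> card ?Z" "\<And>x. poly q x = 0 \<Longrightarrow> x \<in> ?Z"
      "\<And>x. x \<in> interior \<Delta> \<Longrightarrow> 0 \<le> poly q x * f x"
      using sign_polynomial[of ?Z "interior \<Delta>" f] True continuous_on_subset[OF cont D(1)] by blast
    have cont': "continuous_on D (\<lambda>x. poly q x * f x)"
      by (intro continuous_intros cont)
    have nonneg: "0 \<le> poly q x * f x" if "x \<in> D" for x
    proof -
      show ?thesis
      proof (cases "x \<in> interior \<Delta>")
        case False
        \<comment> \<open>An endpoint in \<open>D\<close> is a limit of interior points, where the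
          sign is known, and \<open>q * f\<close> is continuous on \<open>D\<close>.\<close>
        have "((\<lambda>x. poly q x * f x) \<longlongrightarrow> poly q x * f x) (at x within interior \<Delta>)"
          using cont'[unfolded continuous_on_def, rule_format, OF that] D(1)
          by (rule tendsto_within_subset)
        moreover have "eventually (\<lambda>x. 0 \<le> poly q x * f x) (at x within interior \<Delta>)"
          unfolding eventually_at_filter by (rule always_eventually) (use q(3) in blast)
        moreover have "at x within interior \<Delta> \<noteq> bot"
          using cl that False by (auto simp: at_within_eq_bot_iff closure_def)
        ultimately show ?thesis by (rule tendsto_lowerbound)
      qed (rule q(3))
    qed
    have int: "integrable (cs_abs s) (\<lambda>x. poly q x * f x)" "sint s (\<lambda>x. poly q x * f x) = 0"
      using orth[of q] q(1) True by auto
    have "(LINT x|cs_abs s. poly q x * f x) = 0" using int(2) sgn by (auto simp: sint_def)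
    then have "AE x in cs_abs s. poly q x * f x = 0"
      using integral_nonneg_eq_0_iff_AE[OF int(1) eventually_mono[OF D(3) nonneg]] by simp
    then have "AE x in cs_abs s. x \<in> ?Z \<union> (\<Delta> - interior \<Delta>)"
      using D(3) by eventually_elim (use D(2) q(2) in auto)
    moreover have "finite (?Z \<union> (\<Delta> - interior \<Delta>))"
      using True finite_interval_minus_interior[OF iv] by simp
    ultimately show ?thesis using not_AE_finite by blast
  qed
qed

end

section \<open>Products of measures\<close>

text \<open>If \<open>A\<close> had points on both sides of \<open>B\<close>, it would contain the
  infinite set \<open>B\<close>, and the intersection would not be finite.\<close>

lemma interval_sides:
  fixes A B :: "real set"
  assumes "is_interval A" "is_interval B" "infinite B" "finite (A \<inter> B)"
  shows "(\<forall>a\<in>A - B. \<forall>b\<in>B. a < b) \<or> (\<forall>a\<in>A - B. \<forall>b\<in>B. b < a)"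
proof (rule ccontr)
  have side: "(\<forall>b\<in>B. a < b) \<or> (\<forall>b\<in>B. b < a)" if "a \<notin> B" for a
  proof (rule ccontr)
    assume "\<not> ?thesis"
    then obtain b b' where "b \<in> B" "b' \<in> B" "b \<le> a" "a \<le> b'" by (auto simp: not_less)
    then show False using that assms(2)[unfolded is_interval_1] by blast
  qed
  assume "\<not> ?thesis"
  then obtain a b a' b' where ab: "a \<in> A - B" "b \<in> B" "b \<le> a" "a' \<in> A - B" "b' \<in> B" "a' \<le> b'"
    by (auto simp: not_less)
  have "\<forall>x\<in>B. x < a" "\<forall>x\<in>B. a' < x" using side[of a] side[of a'] ab by fastforce+
  then have "B \<subseteq> A"
    using assms(1)[unfolded is_interval_1, rule_format, of a' a] ab(1,4)
    by (meson DiffD1 less_imp_le subsetI)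
  then have "A \<inter> B = B" by auto
  then show False using assms(3,4) by simp
qed

context cs_in
begin

lemma measurable_sint_cauchy [measurable]:
  fixes f :: "real \<Rightarrow> 'a::{real_normed_field, banach, second_countable_topology}"
  assumes [measurable]: "f \<in> borel_measurable borel"
  shows "(\<lambda>x. sint s (\<lambda>y. f y / (of_real x - of_real y))) \<in> borel_measurable borel"
  unfolding sint_def by measurable

lemma measurable_cauchy_on_reals [measurable]: "cauchy_on_reals s \<in> borel_measurable borel"
proof -
  show ?thesis using measurable_sint_cauchy[of "\<lambda>y. 1 :: real"] by (simp add: cauchy_on_reals_eq_sint[abs_def])
qed

lemma cauchy_on_reals_nonneg:
  assumes "\<And>y. y \<in> \<Delta> \<Longrightarrow> y < x"
  shows "0 \<le> cs_sign s * cauchy_on_reals s x"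
proof -
  have "0 \<le> (LINT y|cs_abs s. 1 / (x - y))"
    by (rule integral_nonneg_AE) (use AE_in in eventually_elim, use assms in \<open>simp add: less_imp_le\<close>)
  then show ?thesis using sgn by (auto simp: cauchy_on_reals_eq_sint sint_def)
qed

lemma cauchy_on_reals_nonpos:
  assumes "\<And>y. y \<in> \<Delta> \<Longrightarrow> x < y"
  shows "cs_sign s * cauchy_on_reals s x \<le> 0"
proof -
  have "0 \<le> (LINT y|cs_abs s. - (1 / (x - y)))"
    by (rule integral_nonneg_AE)
       (use AE_in in eventually_elim, use assms in \<open>simp add: less_imp_le divide_nonneg_neg\<close>)
  then show ?thesis using sgn by (auto simp: cauchy_on_reals_eq_sint sint_def)
qed

text \<open>A point off the interval lies on one side of it, so the kernel has constant sign and the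
  absolute value passes under the integral. The nonnegative integral on the right is the form to
  which Tonelli's theorem applies.\<close>

lemma abs_cauchy_on_reals:
  assumes "is_interval \<Delta>" "x \<notin> \<Delta>"
  shows "ennreal \<bar>cauchy_on_reals s x\<bar> = (\<integral>\<^sup>+y. ennreal (1 / \<bar>x - y\<bar>) \<partial>cs_abs s)"
proof -
  have int: "integrable (cs_abs s) (\<lambda>y. 1 / (x - y))"
    using integrable_cauchy[of x] assms(2) by (simp add: image_iff)
  have "(\<forall>y\<in>\<Delta>. x < y) \<or> (\<forall>y\<in>\<Delta>. y < x)"
    using interval_sides[OF _ assms(1) infinite_carrier, of "{x}"] assms(2)
    by (auto simp: is_interval_convex_1)
  then have "\<bar>LINT y|cs_abs s. 1 / (x - y)\<bar> = (LINT y|cs_abs s. 1 / \<bar>x - y\<bar>)"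
  proof
    assume less: "\<forall>y\<in>\<Delta>. x < y"
    have "(LINT y|cs_abs s. 1 / \<bar>x - y\<bar>) = (LINT y|cs_abs s. - (1 / (x - y)))"
      by (rule integral_cong_AE) (simp, simp, use AE_in in eventually_elim, use less in \<open>force simp: minus_divide_right\<close>)
    moreover have "0 \<le> (LINT y|cs_abs s. 1 / \<bar>x - y\<bar>)" by (rule integral_nonneg_AE) simp
    ultimately show ?thesis by simp
  next
    assume less: "\<forall>y\<in>\<Delta>. y < x"
    have "(LINT y|cs_abs s. 1 / \<bar>x - y\<bar>) = (LINT y|cs_abs s. 1 / (x - y))"
      by (rule integral_cong_AE) (simp, simp, use AE_in in eventually_elim, use less in force)
    moreover have "0 \<le> (LINT y|cs_abs s. 1 / \<bar>x - y\<bar>)" by (rule integral_nonneg_AE) simp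
    ultimately show ?thesis by simp
  qed
  then have "\<bar>cauchy_on_reals s x\<bar> = (LINT y|cs_abs s. 1 / \<bar>x - y\<bar>)"
    by (simp add: cauchy_on_reals_eq_sint sint_def abs_mult)
  also have "ennreal \<dots> = (\<integral>\<^sup>+y. ennreal (1 / \<bar>x - y\<bar>) \<partial>cs_abs s)"
    using integrable_abs[OF int] by (intro nn_integral_eq_integral[symmetric]) (simp_all add: abs_divide)
  finally show ?thesis .
qed

end

locale cs_in2 = S: cs_in s A + T: cs_in t B for s A t B
begin

sublocale P: pair_sigma_finite "cs_abs s" "cs_abs t" ..

lemma tonelli_cauchy:
  fixes F G :: "real \<Rightarrow> ennreal"
  assumes [measurable]: "F \<in> borel_measurable borel" "G \<in> borel_measurable borel"
  shows "(\<integral>\<^sup>+x. F x * (\<integral>\<^sup>+y. ennreal (1 / \<bar>x - y\<bar>) * G y \<partial>cs_abs t) \<partial>cs_abs s) =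
    (\<integral>\<^sup>+y. (\<integral>\<^sup>+x. ennreal (1 / \<bar>y - x\<bar>) * F x \<partial>cs_abs s) * G y \<partial>cs_abs t)"
proof -
  have "(\<integral>\<^sup>+x. F x * (\<integral>\<^sup>+y. ennreal (1 / \<bar>x - y\<bar>) * G y \<partial>cs_abs t) \<partial>cs_abs s) =
      (\<integral>\<^sup>+x. (\<integral>\<^sup>+y. F x * (ennreal (1 / \<bar>x - y\<bar>) * G y) \<partial>cs_abs t) \<partial>cs_abs s)"
    by (simp add: nn_integral_cmult)
  also have "\<dots> = (\<integral>\<^sup>+y. (\<integral>\<^sup>+x. F x * (ennreal (1 / \<bar>x - y\<bar>) * G y) \<partial>cs_abs s) \<partial>cs_abs t)"
    by (rule P.Fubini'[symmetric]) measurable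
  also have "\<dots> = (\<integral>\<^sup>+y. (\<integral>\<^sup>+x. (ennreal (1 / \<bar>y - x\<bar>) * F x) * G y \<partial>cs_abs s) \<partial>cs_abs t)"
    by (simp add: abs_minus_commute mult_ac)
  also have "\<dots> = (\<integral>\<^sup>+y. (\<integral>\<^sup>+x. ennreal (1 / \<bar>y - x\<bar>) * F x \<partial>cs_abs s) * G y \<partial>cs_abs t)"
    by (simp add: nn_integral_multc)
  finally show ?thesis .
qed

text \<open>The minus sign is the antisymmetry of the kernel,
  \<open>1 / (x - y) = - (1 / (y - x))\<close>. The kernel may be unbounded on touching intervals,
  so absolute integrability enters as a hypothesis.\<close>

lemma fubini_cauchy:
  fixes f :: "real \<Rightarrow> real" and g :: "real \<Rightarrow> complex"
  assumes [measurable]: "f \<in> borel_measurable borel" "g \<in> borel_measurable borel"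
    and fin: "(\<integral>\<^sup>+x. ennreal \<bar>f x\<bar> *
        (\<integral>\<^sup>+y. ennreal (1 / \<bar>x - y\<bar>) * ennreal (norm (g y)) \<partial>cs_abs t) \<partial>cs_abs s) < \<infinity>"
  shows "sint s (\<lambda>x. of_real (f x) * sint t (\<lambda>y. g y / (of_real x - of_real y))) =
    - sint t (\<lambda>y. of_real (sint s (\<lambda>x. f x / (y - x))) * g y)"
proof -
  define h where "h x y = of_real (f x / (x - y)) * g y" for x y
  have [measurable]: "(\<lambda>(x, y). h x y) \<in> borel_measurable (cs_abs s \<Otimes>\<^sub>M cs_abs t)"
    unfolding h_def by measurable
  have "integrable (cs_abs s \<Otimes>\<^sub>M cs_abs t) (\<lambda>(x, y). h x y)"
  proof (rule integrableI_bounded)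
    have "(\<integral>\<^sup>+xy. ennreal (norm (case xy of (x, y) \<Rightarrow> h x y)) \<partial>(cs_abs s \<Otimes>\<^sub>M cs_abs t)) =
        (\<integral>\<^sup>+x. \<integral>\<^sup>+y. ennreal (norm (h x y)) \<partial>cs_abs t \<partial>cs_abs s)"
      by (subst T.nn_integral_fst[symmetric]) simp_all
    also have "\<dots> = (\<integral>\<^sup>+x. (\<integral>\<^sup>+y. ennreal \<bar>f x\<bar> * (ennreal (1 / \<bar>x - y\<bar>) * ennreal (norm (g y))) \<partial>cs_abs t) \<partial>cs_abs s)"
      by (simp add: h_def norm_mult norm_divide ennreal_mult[symmetric] flip: of_real_diff)
    also have "\<dots> < \<infinity>" using fin by (simp add: nn_integral_cmult)
    finally show "(\<integral>\<^sup>+xy. ennreal (norm (case xy of (x, y) \<Rightarrow> h x y)) \<partial>(cs_abs s \<Otimes>\<^sub>M cs_abs t)) < \<infinity>" .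
  qed measurable
  from P.Fubini_integral[OF this]
  have F: "(LINT y|cs_abs t. LINT x|cs_abs s. h x y) = (LINT x|cs_abs s. LINT y|cs_abs t. h x y)" .
  have "sint s (\<lambda>x. of_real (f x) * sint t (\<lambda>y. g y / (of_real x - of_real y))) =
      (cs_sign s * cs_sign t) *\<^sub>R (LINT x|cs_abs s. LINT y|cs_abs t. h x y)"
  proof -
    have "(LINT y|cs_abs t. h x y) = of_real (f x) * (LINT y|cs_abs t. g y / (of_real x - of_real y))" for x
      unfolding integral_mult_right_zero[symmetric] by (rule Bochner_Integration.integral_cong) (simp_all add: h_def)
    then show ?thesis by (simp add: sint_def)
  qed
  also have "\<dots> = (cs_sign s * cs_sign t) *\<^sub>R (LINT y|cs_abs t. LINT x|cs_abs s. h x y)"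
    unfolding F ..
  also have "\<dots> = - sint t (\<lambda>y. of_real (sint s (\<lambda>x. f x / (y - x))) * g y)"
  proof -
    have "(LINT x|cs_abs s. h x y) = - (of_real (LINT x|cs_abs s. f x / (y - x)) * g y)" for y
    proof -
      have "(LINT x|cs_abs s. h x y) = (LINT x|cs_abs s. - (of_real (f x / (y - x)) * g y))"
        by (rule Bochner_Integration.integral_cong)
           (simp_all add: h_def minus_divide_right flip: of_real_diff of_real_divide of_real_minus mult_minus_left)
      then show ?thesis by (simp del: of_real_divide add: integral_of_real)
    qed
    then show ?thesis by (simp add: sint_def scaleR_conv_of_real mult.assoc)
  qed
  finally show ?thesis .
qed

end

text \<open>The last assumption makes the transform of \<open>t\<close> converge at almost every
  point with respect to \<open>s\<close>; finiteness of \<open>A \<inter> B\<close> covers disjoint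
  intervals as well as a common endpoint.\<close>

locale cs_prod_pair = cs_in2 +
  assumes iA: "is_interval A" and iB: "is_interval B" and fin: "finite (A \<inter> B)"
    and AE_out: "AE x in cs_abs s. x \<notin> B"
begin

text \<open>Almost every point lies in \<open>A - B\<close>, hence on one fixed side of
  \<open>B\<close>, which fixes the sign of the kernel. This is what makes the encoding of
  \<open>cs_prod\<close> by a sign and a positive density faithful.\<close>

lemma AE_constant_sign:
  "(AE x in cs_abs s. 0 \<le> cauchy_on_reals t x) \<or> (AE x in cs_abs s. cauchy_on_reals t x \<le> 0)"
proof -
  have AE: "AE x in cs_abs s. x \<in> A - B" using AE_out S.AE_in by eventually_elim auto
  from interval_sides[OF iA iB T.infinite_carrier fin]
  show ?thesis
  proof
    assume side: "\<forall>a\<in>A - B. \<forall>b\<in>B. a < b"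
    have "AE x in cs_abs s. cs_sign t * cauchy_on_reals t x \<le> 0"
      using AE by eventually_elim (use side in \<open>auto intro: T.cauchy_on_reals_nonpos\<close>)
    then show ?thesis using T.sgn by (elim disjE) simp_all
  next
    assume side: "\<forall>a\<in>A - B. \<forall>b\<in>B. b < a"
    have "AE x in cs_abs s. 0 \<le> cs_sign t * cauchy_on_reals t x"
      using AE by eventually_elim (use side in \<open>auto intro: T.cauchy_on_reals_nonneg\<close>)
    then show ?thesis using T.sgn by (elim disjE) simp_all
  qed
qed

lemma integrable_cs_prod:
  fixes f :: "real \<Rightarrow> 'a::{banach, second_countable_topology}"
  assumes [measurable]: "f \<in> borel_measurable borel"
  shows "integrable (cs_abs (cs_prod s t)) f \<longleftrightarrow>
    integrable (cs_abs s) (\<lambda>x. cauchy_on_reals t x *\<^sub>R f x)"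
proof -
  have "integrable (cs_abs (cs_prod s t)) f \<longleftrightarrow> integrable (cs_abs s) (\<lambda>x. \<bar>cauchy_on_reals t x\<bar> *\<^sub>R f x)"
    unfolding cs_prod_def cs_measure.sel by (rule integrable_density) simp_all
  also have "\<dots> \<longleftrightarrow> integrable (cs_abs s) (\<lambda>x. cauchy_on_reals t x *\<^sub>R f x)"
    by (subst (1 2) integrable_iff_bounded) simp
  finally show ?thesis .
qed

lemma sint_cs_prod:
  fixes f :: "real \<Rightarrow> 'a::{banach, second_countable_topology}"
  assumes [measurable]: "f \<in> borel_measurable borel"
  shows "sint (cs_prod s t) f = sint s (\<lambda>x. cauchy_on_reals t x *\<^sub>R f x)"
proof -
  have *: "(LINT x|cs_abs (cs_prod s t). f x) = (LINT x|cs_abs s. \<bar>cauchy_on_reals t x\<bar> *\<^sub>R f x)"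
    unfolding cs_prod_def cs_measure.sel by (rule integral_density) simp_all
  show ?thesis
  proof (cases "AE x in cs_abs s. 0 \<le> cauchy_on_reals t x")
    case True
    have "(LINT x|cs_abs s. \<bar>cauchy_on_reals t x\<bar> *\<^sub>R f x) = (LINT x|cs_abs s. cauchy_on_reals t x *\<^sub>R f x)"
      by (rule integral_cong_AE) (simp, simp, use True in eventually_elim, simp)
    then show ?thesis using True by (simp add: sint_def * ) (simp add: cs_prod_def)
  next
    case False
    then have nonpos: "AE x in cs_abs s. cauchy_on_reals t x \<le> 0" using AE_constant_sign by blast
    have "(LINT x|cs_abs s. \<bar>cauchy_on_reals t x\<bar> *\<^sub>R f x) = (LINT x|cs_abs s. - (cauchy_on_reals t x *\<^sub>R f x))"
      by (rule integral_cong_AE) (simp, simp, use nonpos in eventually_elim, simp)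
    then show ?thesis using False by (simp add: sint_def * ) (simp add: cs_prod_def)
  qed
qed

end

section \<open>Nikishin systems and reversed chains\<close>

lemma closed_measure_support: "closed (measure_support M)"
  unfolding closed_def
proof (subst open_subopen, intro ballI)
  fix x assume "x \<in> - measure_support M"
  then obtain U where U: "open U" "x \<in> U" "emeasure M U = 0" by (auto simp: measure_support_def)
  then have "U \<subseteq> - measure_support M" by (auto simp: measure_support_def)
  with U show "\<exists>T. open T \<and> x \<in> T \<and> T \<subseteq> - measure_support M" by blast
qed

text \<open>A point of the line off the hull has the whole closed set on one side and at positive
  distance, so a closed half-line contains the set but not the point.\<close>

lemma closed_convex_hull_real:
  fixes S :: "real set"
  assumes "closed S"
  shows "closed (convex hull S)"
  unfolding closed_def
proof (subst open_subopen, intro ballI)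
  fix x assume x: "x \<in> - (convex hull S)"
  then have "x \<notin> S" using hull_subset by fastforce
  then obtain e where e: "e > 0" "\<And>y. y \<in> S \<Longrightarrow> e \<le> \<bar>x - y\<bar>"
    using separate_point_closed[OF assms, of x] unfolding dist_real_def by blast
  have "is_interval (convex hull S)" by (simp add: is_interval_convex_1)
  then have "(\<forall>y\<in>S. y < x) \<or> (\<forall>y\<in>S. x < y)"
    using x hull_subset[of S convex] unfolding is_interval_1
    by (meson ComplD linorder_not_le subsetD)
  then show "\<exists>T. open T \<and> x \<in> T \<and> T \<subseteq> - (convex hull S)"
  proof
    assume "\<forall>y\<in>S. y < x"
    then have "S \<subseteq> {..x - e}" using e by fastforce
    then have "convex hull S \<subseteq> {..x - e}" by (intro hull_minimal convex_real_interval)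
    then show ?thesis using e by (intro exI[of _ "{x - e<..}"]) auto
  next
    assume "\<forall>y\<in>S. x < y"
    then have "S \<subseteq> {x + e..}" using e by fastforce
    then have "convex hull S \<subseteq> {x + e..}" by (intro hull_minimal convex_real_interval)
    then show ?thesis using e by (intro exI[of _ "{..<x + e}"]) auto
  qed
qed

lemma norm_integral_le_nn_integral:
  fixes f :: "_ \<Rightarrow> 'a::{banach, second_countable_topology}"
  shows "ennreal (norm (integral\<^sup>L M f)) \<le> (\<integral>\<^sup>+x. ennreal (norm (f x)) \<partial>M)"
  by (cases "integrable M f") (simp_all add: integral_norm_bound_ennreal not_integrable_integral_eq)

lemma nik_same [simp]: "nik \<sigma> j j = \<sigma> j"
  by (simp add: nik_def)

lemma nik_forward: "j < k \<Longrightarrow> nik \<sigma> j k = cs_prod (\<sigma> j) (nik \<sigma> (Suc j) k)"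
proof -
  assume "j < k"
  then have "[j..<Suc k] = j # Suc j # [Suc (Suc j)..<Suc k]" "[Suc j..<Suc k] = Suc j # [Suc (Suc j)..<Suc k]"
    by (simp_all add: upt_conv_Cons)
  then show ?thesis using \<open>j < k\<close> by (simp add: nik_def del: upt_Suc)
qed

lemma nik_backward: "j < k \<Longrightarrow> nik \<sigma> k j = cs_prod (\<sigma> k) (nik \<sigma> (k - 1) j)"
proof -
  assume jk: "j < k"
  then obtain l where l: "k = Suc l" "j \<le> l" by (cases k) auto
  have "nik \<sigma> l j = cs_prod_list (map \<sigma> (rev [j..<Suc l]))"
    using l by (cases "l = j") (simp_all add: nik_def)
  moreover have "nik \<sigma> k j = cs_prod_list (map \<sigma> (rev [j..<Suc k]))"
    using jk by (simp add: nik_def)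
  ultimately show ?thesis using l by simp
qed

section \<open>Neighbouring intervals and Cauchy transforms along chains of generators\<close>

locale nikishin =
  fixes m :: nat and \<Delta> :: "nat \<Rightarrow> real set" and \<sigma> :: "nat \<Rightarrow> cs_measure"
  assumes gen: "nikishin_generators m \<Delta> \<sigma>"
begin

lemma interval: "1 \<le> j \<Longrightarrow> j \<le> m \<Longrightarrow> is_interval (\<Delta> j)"
  using gen by (auto simp: nikishin_generators_def)

lemma closed: "1 \<le> j \<Longrightarrow> j \<le> m \<Longrightarrow> closed (\<Delta> j)"
  using gen closed_convex_hull_real[OF closed_measure_support, of "cs_abs (\<sigma> j)"]
  by (auto simp: nikishin_generators_def)

lemma nik_in: "1 \<le> j \<Longrightarrow> j \<le> k \<Longrightarrow> k \<le> m \<Longrightarrow> cs_in (nik \<sigma> j k) (\<Delta> j)"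
  and nik_rev_in: "1 \<le> j \<Longrightarrow> j \<le> k \<Longrightarrow> k \<le> m \<Longrightarrow> cs_in (nik \<sigma> k j) (\<Delta> k)"
  using gen closed by (auto simp: nikishin_generators_def intro!: cs_in.intro)

lemma gen_in: "1 \<le> j \<Longrightarrow> j \<le> m \<Longrightarrow> cs_in (\<sigma> j) (\<Delta> j)"
  using nik_in[of j j] by simp

lemma adjacent:
  assumes "1 \<le> j" "Suc j \<le> m"
  shows "finite (\<Delta> j \<inter> \<Delta> (Suc j))"
    and "AE x in cs_abs (\<sigma> j). x \<notin> \<Delta> (Suc j)"
    and "AE x in cs_abs (\<sigma> (Suc j)). x \<notin> \<Delta> j"
proof -
  interpret S: cs_in "\<sigma> j" "\<Delta> j" using gen_in[of j] assms by simp
  interpret T: cs_in "\<sigma> (Suc j)" "\<Delta> (Suc j)" using gen_in[of "Suc j"] assms by simp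
  have "j \<in> {1..<m}" using assms by simp
  then have "\<Delta> j \<inter> \<Delta> (Suc j) = {} \<or>
        (\<exists>x. \<Delta> j \<inter> \<Delta> (Suc j) = {x} \<and>
             emeasure (cs_abs (\<sigma> j)) {x} = 0 \<and> emeasure (cs_abs (\<sigma> (Suc j))) {x} = 0)"
    using gen unfolding nikishin_generators_def by blast
  then have "finite (\<Delta> j \<inter> \<Delta> (Suc j)) \<and> (AE x in cs_abs (\<sigma> j). x \<notin> \<Delta> (Suc j)) \<and>
    (AE x in cs_abs (\<sigma> (Suc j)). x \<notin> \<Delta> j)"
  proof
    assume disj: "\<Delta> j \<inter> \<Delta> (Suc j) = {}"
    have "AE x in cs_abs (\<sigma> j). x \<notin> \<Delta> (Suc j)"
      using S.AE_in by eventually_elim (use disj in auto)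
    moreover have "AE x in cs_abs (\<sigma> (Suc j)). x \<notin> \<Delta> j"
      using T.AE_in by eventually_elim (use disj in auto)
    ultimately show ?thesis using disj by simp
  next
    assume "\<exists>x. \<Delta> j \<inter> \<Delta> (Suc j) = {x} \<and>
             emeasure (cs_abs (\<sigma> j)) {x} = 0 \<and> emeasure (cs_abs (\<sigma> (Suc j))) {x} = 0"
    then obtain x where x: "\<Delta> j \<inter> \<Delta> (Suc j) = {x}"
      "emeasure (cs_abs (\<sigma> j)) {x} = 0" "emeasure (cs_abs (\<sigma> (Suc j))) {x} = 0" by blast
    have "AE y in cs_abs (\<sigma> j). y \<noteq> x" "AE y in cs_abs (\<sigma> (Suc j)). y \<noteq> x"
      using x(2,3) by (auto intro!: AE_I[where N="{x}"])
    then have "AE y in cs_abs (\<sigma> j). y \<notin> \<Delta> (Suc j)" "AE y in cs_abs (\<sigma> (Suc j)). y \<notin> \<Delta> j"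
      using S.AE_in T.AE_in x(1) by (auto elim!: eventually_elim2)
    then show ?thesis using x(1) by simp
  qed
  then show "finite (\<Delta> j \<inter> \<Delta> (Suc j))" "AE x in cs_abs (\<sigma> j). x \<notin> \<Delta> (Suc j)"
    "AE x in cs_abs (\<sigma> (Suc j)). x \<notin> \<Delta> j" by blast+
qed

lemma forward_pair:
  assumes "1 \<le> j" "j < k" "k \<le> m"
  shows "cs_prod_pair (\<sigma> j) (\<Delta> j) (nik \<sigma> (Suc j) k) (\<Delta> (Suc j))"
  using assms adjacent[of j]
  by (intro cs_prod_pair.intro cs_in2.intro cs_prod_pair_axioms.intro gen_in nik_in interval) auto

lemma backward_pair:
  assumes "1 \<le> j" "j < k" "k \<le> m"
  shows "cs_prod_pair (\<sigma> k) (\<Delta> k) (nik \<sigma> (k - 1) j) (\<Delta> (k - 1))"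
proof -
  have "Suc (k - 1) = k" using assms by simp
  note adj = adjacent[of "k - 1", unfolded this]
  show ?thesis
    by (intro cs_prod_pair.intro cs_in2.intro cs_prod_pair_axioms.intro gen_in nik_rev_in interval)
       (use assms adj in \<open>auto simp: Int_commute\<close>)
qed

text \<open>The empty chain is the constant 1, so that the lowest term of a linear form needs no
  separate treatment.\<close>

definition fw :: "nat \<Rightarrow> nat \<Rightarrow> real \<Rightarrow> real" where
  "fw j k x = (if k < j then 1 else cauchy_on_reals (nik \<sigma> j k) x)"

text \<open>In \<open>bw (k - 1) j\<close> with \<open>k = j\<close> the subtraction is on naturals;
  \<open>j \<ge> 1\<close> ensures \<open>k - 1 < j\<close>, so that the empty reversed chain is 1
  as well.\<close>

definition bw :: "nat \<Rightarrow> nat \<Rightarrow> real \<Rightarrow> real" where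
  "bw k j x = (if k < j then 1 else cauchy_on_reals (nik \<sigma> k j) x)"

lemma measurable_fw [measurable]: "1 \<le> j \<Longrightarrow> k \<le> m \<Longrightarrow> fw j k \<in> borel_measurable borel"
  using cs_in.measurable_cauchy_on_reals[OF nik_in, of j k] by (cases "k < j") (simp_all add: fw_def[abs_def])

lemma measurable_bw [measurable]: "1 \<le> j \<Longrightarrow> k \<le> m \<Longrightarrow> bw k j \<in> borel_measurable borel"
  using cs_in.measurable_cauchy_on_reals[OF nik_rev_in, of j k] by (cases "k < j") (simp_all add: bw_def[abs_def])

lemma sint_nik:
  assumes "1 \<le> j" "j \<le> k" "k \<le> m" "f \<in> borel_measurable borel"
  shows "sint (nik \<sigma> j k) f = sint (\<sigma> j) (\<lambda>x. fw (Suc j) k x *\<^sub>R f x)"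
proof (cases "j = k")
  case False
  then show ?thesis using cs_prod_pair.sint_cs_prod[OF forward_pair, of j k f] assms
    by (simp add: fw_def[abs_def] nik_forward[of j k])
qed (simp add: fw_def)

lemma integrable_nik:
  fixes f :: "real \<Rightarrow> 'a::{banach, second_countable_topology}"
  assumes "1 \<le> j" "j \<le> k" "k \<le> m" "f \<in> borel_measurable borel"
  shows "integrable (cs_abs (nik \<sigma> j k)) f \<longleftrightarrow> integrable (cs_abs (\<sigma> j)) (\<lambda>x. fw (Suc j) k x *\<^sub>R f x)"
proof (cases "j = k")
  case False
  then show ?thesis using cs_prod_pair.integrable_cs_prod[OF forward_pair, of j k f] assms
    by (simp add: fw_def[abs_def] nik_forward[of j k])
qed (simp add: fw_def)

lemma sint_nik_rev:
  assumes "1 \<le> j" "j \<le> k" "k \<le> m" "f \<in> borel_measurable borel"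
  shows "sint (nik \<sigma> k j) f = sint (\<sigma> k) (\<lambda>x. bw (k - 1) j x *\<^sub>R f x)"
proof (cases "j = k")
  case False
  then have "\<not> k - 1 < j" using assms by simp
  then show ?thesis using cs_prod_pair.sint_cs_prod[OF backward_pair, of j k f] assms False
    by (simp add: bw_def[abs_def] nik_backward[of j k])
next
  case True
  then show ?thesis using assms(1) by (simp add: bw_def)
qed

lemma nn_integral_nik:
  assumes "1 \<le> j" "j \<le> k" "k \<le> m" and [measurable]: "f \<in> borel_measurable borel"
  shows "(\<integral>\<^sup>+x. f x \<partial>cs_abs (nik \<sigma> j k)) = (\<integral>\<^sup>+x. ennreal \<bar>fw (Suc j) k x\<bar> * f x \<partial>cs_abs (\<sigma> j))"
proof (cases "j = k")
  case False
  interpret cs_prod_pair "\<sigma> j" "\<Delta> j" "nik \<sigma> (Suc j) k" "\<Delta> (Suc j)"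
    using forward_pair[of j k] False assms by simp
  show ?thesis using False assms(2)
    by (simp add: nik_forward[of j k] cs_prod_def nn_integral_density fw_def)
qed (simp add: fw_def)

lemma nn_integral_nik_rev:
  assumes "1 \<le> j" "j \<le> k" "k \<le> m" and [measurable]: "f \<in> borel_measurable borel"
  shows "(\<integral>\<^sup>+x. f x \<partial>cs_abs (nik \<sigma> k j)) = (\<integral>\<^sup>+x. ennreal \<bar>bw (k - 1) j x\<bar> * f x \<partial>cs_abs (\<sigma> k))"
proof (cases "j = k")
  case False
  interpret cs_prod_pair "\<sigma> k" "\<Delta> k" "nik \<sigma> (k - 1) j" "\<Delta> (k - 1)"
    using backward_pair[of j k] False assms by simp
  have "\<not> k - 1 < j" using False assms by simp
  then show ?thesis using False assms(2)
    by (simp add: nik_backward[of j k] cs_prod_def nn_integral_density bw_def del: One_nat_def)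
next
  case True
  then show ?thesis using assms(1) by (simp add: bw_def)
qed

text \<open>No cancellation occurs in the integral, so the modulus of an iterated Cauchy transform
  obeys the same recursion with the moduli of the kernels.\<close>

lemma abs_fw:
  assumes "1 \<le> j" "j \<le> k" "k \<le> m" "x \<notin> \<Delta> j"
  shows "ennreal \<bar>fw j k x\<bar> = (\<integral>\<^sup>+y. ennreal (1 / \<bar>x - y\<bar>) * ennreal \<bar>fw (Suc j) k y\<bar> \<partial>cs_abs (\<sigma> j))"
  using cs_in.abs_cauchy_on_reals[OF nik_in interval, of j k x] assms
  by (simp add: fw_def[of j] nn_integral_nik mult.commute)

lemma abs_bw:
  assumes "1 \<le> j" "j \<le> k" "k \<le> m" "x \<notin> \<Delta> k"
  shows "ennreal \<bar>bw k j x\<bar> = (\<integral>\<^sup>+y. ennreal (1 / \<bar>x - y\<bar>) * ennreal \<bar>bw (k - 1) j y\<bar> \<partial>cs_abs (\<sigma> k))"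
  using cs_in.abs_cauchy_on_reals[OF nik_rev_in interval, of j k x] assms
  by (simp add: bw_def[of k] nn_integral_nik_rev mult.commute)

lemma integrable_fw:
  assumes "1 \<le> j" "j \<le> k" "k \<le> m"
  shows "integrable (cs_abs (\<sigma> j)) (fw (Suc j) k)"
proof -
  interpret cs_in "nik \<sigma> j k" "\<Delta> j" using nik_in assms by blast
  show ?thesis using integrable_nik[of j k "\<lambda>x. 1 :: real"] assms integrable_power[of 0] by simp
qed

text \<open>For every \<open>k\<close> this is the same nonnegative iterated integral over
  \<open>x_i, ..., x_m\<close>, cut at \<open>x_k\<close>; Tonelli's theorem moves the cut. For
  \<open>k = i\<close> it is the total mass of the product measure \<open>nik \<sigma> i m\<close>,
  hence finite.\<close>

lemma chain_finite:
  assumes "1 \<le> i" "i \<le> k" "k \<le> m"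
  shows "(\<integral>\<^sup>+x. ennreal \<bar>bw (k - 1) i x\<bar> * ennreal \<bar>fw (Suc k) m x\<bar> \<partial>cs_abs (\<sigma> k)) < \<infinity>"
  using assms(2,3)
proof (induction k rule: dec_induct)
  case base
  have "integrable (cs_abs (\<sigma> i)) (fw (Suc i) m)" using assms by (intro integrable_fw) auto
  moreover have "i - 1 < i" using assms by simp
  ultimately show ?case by (simp add: integrable_iff_bounded bw_def)
next
  case (step k)
  interpret cs_in2 "\<sigma> k" "\<Delta> k" "\<sigma> (Suc k)" "\<Delta> (Suc k)"
    using step assms by (intro cs_in2.intro gen_in) auto
  have [measurable]: "bw (k - 1) i \<in> borel_measurable borel" "fw (Suc (Suc k)) m \<in> borel_measurable borel"
    using step assms by (auto intro!: measurable_bw measurable_fw)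
  have "(\<integral>\<^sup>+x. ennreal \<bar>bw k i x\<bar> * ennreal \<bar>fw (Suc (Suc k)) m x\<bar> \<partial>cs_abs (\<sigma> (Suc k))) =
      (\<integral>\<^sup>+x. (\<integral>\<^sup>+y. ennreal (1 / \<bar>x - y\<bar>) * ennreal \<bar>bw (k - 1) i y\<bar> \<partial>cs_abs (\<sigma> k)) *
        ennreal \<bar>fw (Suc (Suc k)) m x\<bar> \<partial>cs_abs (\<sigma> (Suc k)))"
  proof (rule nn_integral_cong_AE)
    have "AE x in cs_abs (\<sigma> (Suc k)). x \<notin> \<Delta> k" using adjacent(3)[of k] step assms by simp
    then show "AE x in cs_abs (\<sigma> (Suc k)). ennreal \<bar>bw k i x\<bar> * ennreal \<bar>fw (Suc (Suc k)) m x\<bar> =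
        (\<integral>\<^sup>+y. ennreal (1 / \<bar>x - y\<bar>) * ennreal \<bar>bw (k - 1) i y\<bar> \<partial>cs_abs (\<sigma> k)) *
        ennreal \<bar>fw (Suc (Suc k)) m x\<bar>"
      by eventually_elim (use step assms in \<open>simp add: abs_bw\<close>)
  qed
  also have "\<dots> = (\<integral>\<^sup>+x. ennreal \<bar>bw (k - 1) i x\<bar> *
      (\<integral>\<^sup>+y. ennreal (1 / \<bar>x - y\<bar>) * ennreal \<bar>fw (Suc (Suc k)) m y\<bar> \<partial>cs_abs (\<sigma> (Suc k))) \<partial>cs_abs (\<sigma> k))"
    by (rule tonelli_cauchy[symmetric]) measurable
  also have "\<dots> = (\<integral>\<^sup>+x. ennreal \<bar>bw (k - 1) i x\<bar> * ennreal \<bar>fw (Suc k) m x\<bar> \<partial>cs_abs (\<sigma> k))"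
  proof (rule nn_integral_cong_AE)
    have "AE x in cs_abs (\<sigma> k). x \<notin> \<Delta> (Suc k)" using adjacent(2)[of k] step assms by simp
    then show "AE x in cs_abs (\<sigma> k). ennreal \<bar>bw (k - 1) i x\<bar> *
      (\<integral>\<^sup>+y. ennreal (1 / \<bar>x - y\<bar>) * ennreal \<bar>fw (Suc (Suc k)) m y\<bar> \<partial>cs_abs (\<sigma> (Suc k))) =
      ennreal \<bar>bw (k - 1) i x\<bar> * ennreal \<bar>fw (Suc k) m x\<bar>"
      by eventually_elim (use step assms in \<open>simp add: abs_fw\<close>)
  qed
  finally show ?case using step assms by simp
qed

text \<open>
  \<open>chain w i z\<close> is \<open>(- 1) ^ m\<close> times the iterated integral of
  \<open>1 / ((z - x\<^sub>i) (x\<^sub>i - x\<^sub>i\<^sub>+\<^sub>1) \<dots> (x\<^sub>m\<^sub>-\<^sub>1 - x\<^sub>m) (x\<^sub>m - w))\<close>; the recursion runs downwards in \<open>i\<close>.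
\<close>

primrec chain_aux :: "complex \<Rightarrow> nat \<Rightarrow> complex \<Rightarrow> complex" where
  "chain_aux w 0 z = (- 1) ^ m / (z - w)"
| "chain_aux w (Suc d) z = sint (\<sigma> (m - d)) (\<lambda>x. chain_aux w d (of_real x) / (z - of_real x))"

definition chain :: "complex \<Rightarrow> nat \<Rightarrow> complex \<Rightarrow> complex" where
  "chain w i = chain_aux w (Suc m - i)"

lemma chain_last: "chain w (Suc m) z = (- 1) ^ m / (z - w)"
  by (simp add: chain_def)

lemma chain_rec:
  assumes "1 \<le> i" "i \<le> m"
  shows "chain w i z = sint (\<sigma> i) (\<lambda>x. chain w (Suc i) (of_real x) / (z - of_real x))"
  using assms by (simp add: chain_def Suc_diff_le)

lemma measurable_chain [measurable]:
  assumes "1 \<le> i" "i \<le> Suc m"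
  shows "(\<lambda>x. chain w i (of_real x)) \<in> borel_measurable borel"
  using assms(2,1)
proof (induction i rule: inc_induct)
  case base
  show ?case by (simp add: chain_last)
next
  case (step i)
  interpret cs_in "\<sigma> i" "\<Delta> i" using gen_in step by simp
  show ?case using step by (simp add: chain_rec measurable_sint_cauchy)
qed

text \<open>The last factor of the chain, with \<open>w\<close> in its denominator, is bounded by
  \<open>1 / |Im w|\<close>; the other kernels contribute the chain of moduli, which is
  \<open>|fw i m x|\<close>.\<close>

lemma norm_chain_le:
  assumes w: "Im w \<noteq> 0" and "1 \<le> i" "i \<le> Suc m" and x: "i \<le> m \<longrightarrow> x \<notin> \<Delta> i"
  shows "ennreal (norm (chain w i (of_real x))) \<le> ennreal (1 / \<bar>Im w\<bar>) * ennreal \<bar>fw i m x\<bar>"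
  using assms(3,2) x
proof (induction i arbitrary: x rule: inc_induct)
  case base
  have "\<bar>Im w\<bar> \<le> norm (of_real x - w)"
    using abs_Im_le_cmod[of "of_real x - w"] by simp
  then have "norm (chain w (Suc m) (of_real x)) \<le> 1 / \<bar>Im w\<bar>"
    using w by (simp add: chain_last norm_divide norm_power frac_le)
  then show ?case by (simp add: fw_def ennreal_leI)
next
  case (step i)
  interpret cs_in "\<sigma> i" "\<Delta> i" using gen_in step by simp
  have [measurable]: "(\<lambda>x. chain w (Suc i) (of_real x)) \<in> borel_measurable borel"
    "fw (Suc i) m \<in> borel_measurable borel"
    using step by (auto intro!: measurable_chain measurable_fw)
  have "ennreal (norm (chain w i (of_real x))) =
      ennreal (norm (LINT y|cs_abs (\<sigma> i). chain w (Suc i) (of_real y) / (of_real x - of_real y)))"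
    using step by (simp add: chain_rec sint_def)
  also have "\<dots> \<le> (\<integral>\<^sup>+y. ennreal (norm (chain w (Suc i) (of_real y) / (of_real x - of_real y))) \<partial>cs_abs (\<sigma> i))"
    by (rule norm_integral_le_nn_integral)
  also have "\<dots> \<le> (\<integral>\<^sup>+y. ennreal (1 / \<bar>Im w\<bar>) * (ennreal (1 / \<bar>x - y\<bar>) * ennreal \<bar>fw (Suc i) m y\<bar>) \<partial>cs_abs (\<sigma> i))"
  proof (rule nn_integral_mono_AE)
    have "AE y in cs_abs (\<sigma> i). Suc i \<le> m \<longrightarrow> y \<notin> \<Delta> (Suc i)"
      using adjacent(2)[of i] step by (cases "Suc i \<le> m") auto
    then show "AE y in cs_abs (\<sigma> i). ennreal (norm (chain w (Suc i) (of_real y) / (of_real x - of_real y)))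
        \<le> ennreal (1 / \<bar>Im w\<bar>) * (ennreal (1 / \<bar>x - y\<bar>) * ennreal \<bar>fw (Suc i) m y\<bar>)"
    proof eventually_elim
      case (elim y)
      have "ennreal (norm (chain w (Suc i) (of_real y) / (of_real x - of_real y))) =
          ennreal (1 / \<bar>x - y\<bar>) * ennreal (norm (chain w (Suc i) (of_real y)))"
        by (simp add: norm_divide ennreal_mult[symmetric] flip: of_real_diff)
      also have "\<dots> \<le> ennreal (1 / \<bar>x - y\<bar>) * (ennreal (1 / \<bar>Im w\<bar>) * ennreal \<bar>fw (Suc i) m y\<bar>)"
        using elim step by (intro mult_left_mono step.IH) auto
      finally show ?case by (simp add: mult_ac)
    qed
  qed
  also have "\<dots> = ennreal (1 / \<bar>Im w\<bar>) * ennreal \<bar>fw i m x\<bar>"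
    using step by (simp add: nn_integral_cmult abs_fw)
  finally show ?case .
qed

lemma integrable_chain:
  assumes "Im w \<noteq> 0" "1 \<le> i" "i \<le> m"
  shows "integrable (cs_abs (\<sigma> i)) (\<lambda>x. chain w (Suc i) (of_real x))"
proof -
  interpret cs_in "\<sigma> i" "\<Delta> i" using gen_in assms by simp
  have [measurable]: "(\<lambda>x. chain w (Suc i) (of_real x)) \<in> borel_measurable borel"
    using assms by (auto intro!: measurable_chain)
  have "integrable (cs_abs (\<sigma> i)) (\<lambda>x. 1 / \<bar>Im w\<bar> * fw (Suc i) m x)"
    using integrable_fw[of i m] assms by simp
  then show ?thesis
  proof (rule Bochner_Integration.integrable_bound)
    have "AE y in cs_abs (\<sigma> i). Suc i \<le> m \<longrightarrow> y \<notin> \<Delta> (Suc i)"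
      using adjacent(2)[of i] assms by (cases "Suc i \<le> m") auto
    then show "AE x in cs_abs (\<sigma> i). norm (chain w (Suc i) (of_real x)) \<le> norm (1 / \<bar>Im w\<bar> * fw (Suc i) m x)"
    proof eventually_elim
      case (elim x)
      then have "ennreal (norm (chain w (Suc i) (of_real x))) \<le> ennreal (1 / \<bar>Im w\<bar> * \<bar>fw (Suc i) m x\<bar>)"
        using norm_chain_le[of w "Suc i" x] assms by (subst ennreal_mult) auto
      then show ?case by (subst (asm) ennreal_le_iff) (simp_all add: abs_mult)
    qed
  qed simp
qed

text \<open>Fubini's theorem moves the kernel between \<open>x_k\<close> and \<open>x_(k+1)\<close>
  from the forward chain to the reversed one; absolute integrability comes from
  \<open>norm_chain_le\<close> and \<open>chain_finite\<close>.\<close>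

lemma chain_step:
  assumes w: "Im w \<noteq> 0" and "1 \<le> i" "i \<le> k" "Suc k \<le> m"
  shows "sint (\<sigma> k) (\<lambda>x. of_real (bw (k - 1) i x) * chain w (Suc k) (of_real x)) =
    - sint (\<sigma> (Suc k)) (\<lambda>x. of_real (bw k i x) * chain w (Suc (Suc k)) (of_real x))"
proof -
  interpret cs_in2 "\<sigma> k" "\<Delta> k" "\<sigma> (Suc k)" "\<Delta> (Suc k)"
    using assms by (intro cs_in2.intro gen_in) auto
  have [measurable]: "bw (k - 1) i \<in> borel_measurable borel" "fw (Suc (Suc k)) m \<in> borel_measurable borel"
    "fw (Suc k) m \<in> borel_measurable borel"
    "(\<lambda>x. chain w (Suc (Suc k)) (of_real x)) \<in> borel_measurable borel"
    using assms by (auto intro!: measurable_bw measurable_fw measurable_chain)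
  have "(\<integral>\<^sup>+x. ennreal \<bar>bw (k - 1) i x\<bar> * (\<integral>\<^sup>+y. ennreal (1 / \<bar>x - y\<bar>) *
        ennreal (norm (chain w (Suc (Suc k)) (of_real y))) \<partial>cs_abs (\<sigma> (Suc k))) \<partial>cs_abs (\<sigma> k)) \<le>
      (\<integral>\<^sup>+x. ennreal (1 / \<bar>Im w\<bar>) * (ennreal \<bar>bw (k - 1) i x\<bar> * ennreal \<bar>fw (Suc k) m x\<bar>) \<partial>cs_abs (\<sigma> k))"
  proof (rule nn_integral_mono_AE)
    have AE: "AE y in cs_abs (\<sigma> (Suc k)). Suc (Suc k) \<le> m \<longrightarrow> y \<notin> \<Delta> (Suc (Suc k))"
      using adjacent(2)[of "Suc k"] assms by (cases "Suc (Suc k) \<le> m") auto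
    have "AE x in cs_abs (\<sigma> k). x \<notin> \<Delta> (Suc k)" using adjacent(2)[of k] assms by simp
    then show "AE x in cs_abs (\<sigma> k). ennreal \<bar>bw (k - 1) i x\<bar> * (\<integral>\<^sup>+y. ennreal (1 / \<bar>x - y\<bar>) *
        ennreal (norm (chain w (Suc (Suc k)) (of_real y))) \<partial>cs_abs (\<sigma> (Suc k))) \<le>
      ennreal (1 / \<bar>Im w\<bar>) * (ennreal \<bar>bw (k - 1) i x\<bar> * ennreal \<bar>fw (Suc k) m x\<bar>)"
    proof eventually_elim
      case (elim x)
      have "(\<integral>\<^sup>+y. ennreal (1 / \<bar>x - y\<bar>) *
          ennreal (norm (chain w (Suc (Suc k)) (of_real y))) \<partial>cs_abs (\<sigma> (Suc k))) \<le>
        (\<integral>\<^sup>+y. ennreal (1 / \<bar>Im w\<bar>) * (ennreal (1 / \<bar>x - y\<bar>) * ennreal \<bar>fw (Suc (Suc k)) m y\<bar>) \<partial>cs_abs (\<sigma> (Suc k)))"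
      proof (rule nn_integral_mono_AE, use AE in eventually_elim)
        case (elim y)
        have "ennreal (norm (chain w (Suc (Suc k)) (of_real y))) \<le>
            ennreal (1 / \<bar>Im w\<bar>) * ennreal \<bar>fw (Suc (Suc k)) m y\<bar>"
          using norm_chain_le[OF w, of "Suc (Suc k)" y] elim assms by simp
        from mult_left_mono[OF this, of "ennreal (1 / \<bar>x - y\<bar>)"] show ?case by (simp add: mult_ac)
      qed
      also have "\<dots> = ennreal (1 / \<bar>Im w\<bar>) * ennreal \<bar>fw (Suc k) m x\<bar>"
        using elim assms by (simp add: nn_integral_cmult abs_fw)
      finally show ?case
        using mult_left_mono[of _ _ "ennreal \<bar>bw (k - 1) i x\<bar>"] by (fastforce simp: mult_ac)
    qed
  qed
  also have "\<dots> < \<infinity>"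
    using chain_finite[of i k] assms by (simp add: nn_integral_cmult ennreal_mult_less_top)
  finally have "sint (\<sigma> k) (\<lambda>x. of_real (bw (k - 1) i x) *
        sint (\<sigma> (Suc k)) (\<lambda>y. chain w (Suc (Suc k)) (of_real y) / (of_real x - of_real y))) =
    - sint (\<sigma> (Suc k)) (\<lambda>y. of_real (sint (\<sigma> k) (\<lambda>x. bw (k - 1) i x / (y - x))) *
        chain w (Suc (Suc k)) (of_real y))"
    by (intro fubini_cauchy) measurable
  moreover have "sint (\<sigma> k) (\<lambda>x. bw (k - 1) i x / (y - x)) = bw k i y" for y
    using sint_nik_rev[of i k "\<lambda>x. 1 / (y - x)"] assms
    by (simp add: bw_def[of k] cauchy_on_reals_eq_sint)
  ultimately show ?thesis using assms by (simp add: chain_rec)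
qed

text \<open>Moving the kernels one at a time turns the forward chain starting at \<open>i\<close>
  into the reversed chain starting at \<open>m\<close>, evaluated at \<open>w\<close>.\<close>

lemma sint_chain:
  assumes w: "Im w \<noteq> 0" and i: "1 \<le> i" "i \<le> m"
  shows "sint (\<sigma> i) (\<lambda>x. chain w (Suc i) (of_real x)) = - ((- 1) ^ i * cauchy_transform (nik \<sigma> m i) w)"
proof -
  have "sint (\<sigma> i) (\<lambda>x. of_real (bw (i - 1) i x) * chain w (Suc i) (of_real x)) =
      (- 1) ^ (i + k) * sint (\<sigma> k) (\<lambda>x. of_real (bw (k - 1) i x) * chain w (Suc k) (of_real x))"
    if "i \<le> k" "k \<le> m" for k
    using that
  proof (induction k rule: dec_induct)
    case base
    show ?case by (simp flip: mult_2)
  next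
    case (step k)
    then show ?case using chain_step[OF w i(1), of k] by simp
  qed
  from this[OF i(2) order_refl]
  have "sint (\<sigma> i) (\<lambda>x. chain w (Suc i) (of_real x)) =
      (- 1) ^ (i + m) * sint (\<sigma> m) (\<lambda>x. of_real (bw (m - 1) i x) * chain w (Suc m) (of_real x))"
    using i by (simp add: bw_def)
  \<comment> \<open>Turning \<open>1 / (x - w)\<close> into \<open>1 / (w - x)\<close> costs one
    more sign; with the \<open>(- 1) ^ m\<close> of \<open>chain_last\<close> and the sign of the
    moves the total is \<open>- ((- 1) ^ i)\<close>.\<close>
  also have "(\<lambda>x. of_real (bw (m - 1) i x) * chain w (Suc m) (of_real x)) =
      (\<lambda>x. - ((- 1) ^ m) * (bw (m - 1) i x *\<^sub>R (1 / (w - of_real x))))"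
  proof
    fix x
    have "1 / (of_real x - w) = - (1 / (w - of_real x))" by (simp add: minus_divide_right)
    then show "of_real (bw (m - 1) i x) * chain w (Suc m) (of_real x) =
      - ((- 1) ^ m) * (bw (m - 1) i x *\<^sub>R (1 / (w - of_real x)))"
      by (simp add: chain_last scaleR_conv_of_real divide_inverse mult_ac)
  qed
  also have "sint (\<sigma> m) \<dots> = - ((- 1) ^ m) * cauchy_transform (nik \<sigma> m i) w"
    unfolding sint_mult_left using sint_nik_rev[of i m "\<lambda>x. 1 / (w - of_real x)"] i
    by (simp add: cauchy_transform_eq_sint)
  finally show ?thesis by (simp add: power_add)
qed

section \<open>The identity between forward and reversed Cauchy transforms\<close>

definition fwc :: "nat \<Rightarrow> nat \<Rightarrow> complex \<Rightarrow> complex" where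
  "fwc j k z = (if k < j then 1 else cauchy_transform (nik \<sigma> j k) z)"

definition bwc :: "nat \<Rightarrow> nat \<Rightarrow> complex \<Rightarrow> complex" where
  "bwc k j z = (if k < j then 1 else cauchy_transform (nik \<sigma> k j) z)"

lemma fwc_of_real: "fwc j k (of_real x) = of_real (fw j k x)"
  by (simp add: fwc_def fw_def cauchy_transform_of_real)

lemma fwc_rec:
  assumes "1 \<le> j" "j \<le> k" "k \<le> m"
  shows "fwc j k z = sint (\<sigma> j) (\<lambda>x. fwc (Suc j) k (of_real x) / (z - of_real x))"
  using sint_nik[of j k "\<lambda>x. 1 / (z - of_real x)"] assms
  by (simp add: fwc_def[of j] fwc_of_real cauchy_transform_eq_sint scaleR_conv_of_real)

lemma integrable_fwc_divide:
  assumes "1 \<le> j" "j \<le> k" "k \<le> m" "z \<notin> of_real ` \<Delta> j"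
  shows "integrable (cs_abs (\<sigma> j)) (\<lambda>x. fwc (Suc j) k (of_real x) / (z - of_real x))"
proof -
  interpret cs_in "\<sigma> j" "\<Delta> j" using gen_in assms by simp
  show ?thesis unfolding fwc_of_real
    by (intro integrable_divide_off integrable_of_real integrable_fw assms)
qed

text \<open>
  The second argument \<open>w\<close> of the reversed chains is kept apart from \<open>z\<close>, since the induction
  evaluates the forward chains at real points, where the reversed chains need not converge.
\<close>

lemma mixed_identity:
  assumes w: "Im w \<noteq> 0" and "1 \<le> i" "i \<le> Suc m"
    and "i \<le> m \<longrightarrow> z \<notin> of_real ` \<Delta> i" "i = Suc m \<longrightarrow> z \<noteq> w"
  shows "(\<Sum>k=i..m. (- 1) ^ k * bwc m (Suc k) w * fwc i k z) - (- 1) ^ i * bwc m i w = (z - w) * chain w i z"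
  using assms(3,2,4,5)
proof (induction i arbitrary: z rule: inc_induct)
  case base
  then show ?case by (simp add: bwc_def chain_last)
next
  case (step i)
  then have i: "1 \<le> i" "i \<le> m" and z: "z \<notin> of_real ` \<Delta> i" by auto
  interpret cs_in "\<sigma> i" "\<Delta> i" using gen_in i by simp
  let ?G = "\<lambda>x. \<Sum>k=i..m. (- 1) ^ k * bwc m (Suc k) w * (fwc (Suc i) k (of_real x) / (z - of_real x))"
  let ?H = "\<lambda>x. chain w (Suc i) (of_real x)"
  have int: "integrable (cs_abs (\<sigma> i)) ?H" using integrable_chain[OF w i] .
  have int': "integrable (cs_abs (\<sigma> i)) (\<lambda>x. ?H x / (z - of_real x))"
    by (rule integrable_divide_off[OF int z])
  have intG: "integrable (cs_abs (\<sigma> i)) ?G"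
    using i z by (intro Bochner_Integration.integrable_sum integrable_mult_right integrable_fwc_divide) auto
  have "sint (\<sigma> i) ?G = (\<Sum>k=i..m. sint (\<sigma> i)
      (\<lambda>x. (- 1) ^ k * bwc m (Suc k) w * (fwc (Suc i) k (of_real x) / (z - of_real x))))"
    by (rule sint_sum, rule integrable_mult_right, rule integrable_fwc_divide) (use i z in auto)
  also have "\<dots> = (\<Sum>k=i..m. (- 1) ^ k * bwc m (Suc k) w * fwc i k z)"
    unfolding sint_mult_left using i by (intro sum.cong refl) (simp add: fwc_rec[of i])
  finally have "(\<Sum>k=i..m. (- 1) ^ k * bwc m (Suc k) w * fwc i k z) = sint (\<sigma> i) ?G" ..
  also have "\<dots> = sint (\<sigma> i) (\<lambda>x. (z - w) * (?H x / (z - of_real x)) - ?H x)"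
  proof (rule sint_cong_AE)
    have "AE y in cs_abs (\<sigma> i). Suc i \<le> m \<longrightarrow> y \<notin> \<Delta> (Suc i)"
      using adjacent(2)[of i] i by (cases "Suc i \<le> m") auto
    then show "AE x in cs_abs (\<sigma> i). ?G x = (z - w) * (?H x / (z - of_real x)) - ?H x"
      using AE_in
    proof eventually_elim
      case (elim x)
      have nz: "z - of_real x \<noteq> 0" using elim z by auto
      have "of_real x \<noteq> w" using w by auto
      moreover have "Suc i \<le> m \<longrightarrow> of_real x \<notin> (of_real ` \<Delta> (Suc i) :: complex set)" using elim by auto
      ultimately have IH: "(\<Sum>k=Suc i..m. (- 1) ^ k * bwc m (Suc k) w * fwc (Suc i) k (of_real x))
          - (- 1) ^ Suc i * bwc m (Suc i) w = (of_real x - w) * ?H x"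
        using step.IH[of "of_real x"] by simp
      have "?G x = (\<Sum>k=i..m. (- 1) ^ k * bwc m (Suc k) w * fwc (Suc i) k (of_real x)) / (z - of_real x)"
        by (simp add: sum_divide_distrib)
      \<comment> \<open>The new term \<open>k = i\<close> carries the empty chain 1 and is exactly
        the term subtracted in the induction hypothesis.\<close>
      also have "(\<Sum>k=i..m. (- 1) ^ k * bwc m (Suc k) w * fwc (Suc i) k (of_real x)) = (of_real x - w) * ?H x"
        unfolding IH[symmetric] using i by (simp add: sum.atLeast_Suc_atMost fwc_def)
      \<comment> \<open>With \<open>x - w = (z - w) - (z - x)\<close> the second part loses its
        denominator; its integral is the reversed transform by \<open>sint_chain\<close>.\<close>
      also have "\<dots> = (z - w) * ?H x - (z - of_real x) * ?H x" by (simp add: algebra_simps)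
      finally show ?case using nz by (simp add: diff_divide_distrib)
    qed
  qed (use int int' intG in \<open>auto intro!: borel_measurable_integrable Bochner_Integration.integrable_diff\<close>)
  also have "\<dots> = (z - w) * chain w i z - sint (\<sigma> i) ?H"
    using sint_diff[OF integrable_mult_right[OF int', of "z - w"] int] i
    by (simp only: sint_mult_left chain_rec[of i])
  also have "sint (\<sigma> i) ?H = - ((- 1) ^ i * bwc m i w)"
    using sint_chain[OF w i] i by (simp add: bwc_def)
  finally show ?case by simp
qed

text \<open>On the diagonal \<open>z = w\<close> the right-hand side of
  \<open>mixed_identity\<close> vanishes. This cancellation is what carries the DR conditions over
  to the ML conditions.\<close>

lemma nikishin_identity:
  assumes "Im w \<noteq> 0" "1 \<le> i" "i \<le> m"
  shows "(\<Sum>k=i..m. (- 1) ^ k * bwc m (Suc k) w * fwc i k w) = (- 1) ^ i * bwc m i w"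
proof -
  have "w \<notin> of_real ` \<Delta> i" using assms(1) by auto
  then show ?thesis using mixed_identity[of w i w] assms by simp
qed

end

section \<open>The linear systems\<close>

lemma (in cs_in) tendsto_sint_cauchy_imaginary:
  fixes f :: "real \<Rightarrow> complex"
  assumes f: "integrable (cs_abs s) f"
  shows "((\<lambda>y. sint s (\<lambda>x. f x / (\<i> * of_real y - of_real x))) \<longlongrightarrow> 0) at_top"
proof (rule Lim_null_comparison)
  show "eventually (\<lambda>y. norm (sint s (\<lambda>x. f x / (\<i> * of_real y - of_real x))) \<le>
      (LINT x|cs_abs s. norm (f x)) / y) at_top"
    using eventually_gt_at_top[of 0]
  proof eventually_elim
    case (elim y)
    have "y \<le> infdist (\<i> * complex_of_real y) (of_real ` \<Delta>)"
      using abs_le_infdist_imaginary[OF nonempty, of y] elim by simp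
    then show ?case by (intro norm_sint_cauchy_le f elim)
  qed
  show "((\<lambda>y. (LINT x|cs_abs s. norm (f x)) / y) \<longlongrightarrow> 0) at_top"
    by (intro tendsto_divide_0[OF tendsto_const] filterlim_at_top_imp_at_infinity filterlim_ident)
qed

context nikishin
begin

text \<open>The polynomial part at infinity of the level \<open>j\<close> form. The scalar type is
  generic, so that the same equations are available for complex vectors and for their real and
  imaginary parts.\<close>

definition ml_poly :: "(nat \<Rightarrow> 'a::{real_normed_field, banach, second_countable_topology} poly) \<Rightarrow> nat \<Rightarrow> 'a poly" where
  "ml_poly a j = smult ((- 1) ^ j) (a j) +
     (\<Sum>k=Suc j..m. smult ((- 1) ^ k) (second_kind (nik \<sigma> (Suc j) k) (a k)))"

text \<open>The coefficient of \<open>1 / z ^ Suc \<nu>\<close> in the expansion of the level 0 form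
  at infinity.\<close>

definition moment :: "(nat \<Rightarrow> 'a::{real_normed_field, banach, second_countable_topology} poly) \<Rightarrow> nat \<Rightarrow> 'a" where
  "moment a \<nu> = (\<Sum>k=1..m. (- 1) ^ k * pfun (nik \<sigma> 1 k) (monom 1 \<nu> * a k))"

definition ml_data :: "nat \<Rightarrow> (nat \<Rightarrow> 'a::{real_normed_field, banach, second_countable_topology} poly) \<Rightarrow> bool" where
  "ml_data n a \<longleftrightarrow> (\<forall>j<m. ml_poly a j = 0) \<and> (\<forall>\<nu><n. moment a \<nu> = 0)"

definition dr_data :: "nat \<Rightarrow> (nat \<Rightarrow> complex poly) \<Rightarrow> bool" where
  "dr_data n a \<longleftrightarrow> ml_poly a 0 = 0 \<and> (\<forall>\<nu><n. moment a \<nu> = 0) \<and>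
     (\<forall>j\<in>{1..<m}. a j = second_kind (nik \<sigma> m (Suc j)) (a m))"

lemma second_kind_signed:
  assumes "1 \<le> j" "j \<le> k" "k \<le> m"
  shows "second_kind (nik \<sigma> j k) (smult c p) = smult c (second_kind (nik \<sigma> j k) p)"
    "pfun (nik \<sigma> j k) (smult c p) = c * pfun (nik \<sigma> j k) p"
  using cs_in.second_kind_smult[OF nik_in] cs_in.pfun_smult[OF nik_in] assms by blast+

lemma bigo_form_iff:
  assumes "j < m"
  shows "bigo_at_infinity_off (\<Delta> (Suc j)) (N + 1) (multilevel_form m \<sigma> a j) \<longleftrightarrow>
    ml_poly a j = 0 \<and>
    (\<forall>\<nu><N. (\<Sum>k=Suc j..m. (- 1) ^ k * pfun (nik \<sigma> (Suc j) k) (monom 1 \<nu> * a k)) = 0)"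
proof -
  have "multilevel_form m \<sigma> a j = (\<lambda>z. poly (smult ((- 1) ^ j) (a j)) z +
      (\<Sum>k\<in>{Suc j..m}. poly (smult ((- 1) ^ k) (a k)) z * cauchy_transform (nik \<sigma> (Suc j) k) z))"
    by (simp add: multilevel_form_def fun_eq_iff)
  moreover have "nik \<sigma> (Suc j) k \<in> cs_class (\<Delta> (Suc j))" if "k \<in> {Suc j..m}" for k
    using cs_in.cs[OF nik_in, of "Suc j" k] that by simp
  ultimately have "bigo_at_infinity_off (\<Delta> (Suc j)) (N + 1) (multilevel_form m \<sigma> a j) \<longleftrightarrow>
    smult ((- 1) ^ j) (a j) + (\<Sum>k=Suc j..m. second_kind (nik \<sigma> (Suc j) k) (smult ((- 1) ^ k) (a k))) = 0 \<and>
    (\<forall>\<nu><N. (\<Sum>k=Suc j..m. pfun (nik \<sigma> (Suc j) k) (monom 1 \<nu> * smult ((- 1) ^ k) (a k))) = 0)"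
    using bigo_at_infinity_off_iff[of "\<Delta> (Suc j)" "{Suc j..m}" "nik \<sigma> (Suc j)" N
        "smult ((- 1) ^ j) (a j)" "\<lambda>k. smult ((- 1) ^ k) (a k)"] assms closed[of "Suc j"] by simp
  then show ?thesis by (simp add: ml_poly_def second_kind_signed)
qed

lemma HP_ML_iff:
  assumes "1 \<le> m"
  shows "HP_ML m \<Delta> \<sigma> n a \<longleftrightarrow> hp_vector m n a \<and> ml_data n a"
proof -
  have "(\<forall>j<m. ml_poly a j = 0) \<longleftrightarrow> ml_poly a 0 = 0 \<and> (\<forall>j\<in>{1..<m}. ml_poly a j = 0)"
    using assms by (auto simp: Suc_le_eq)
  then show ?thesis
    using bigo_form_iff[of 0 n a] bigo_form_iff[of _ 0 a] assms
    by (auto simp: HP_ML_def ml_data_def moment_def)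
qed

lemma HP_DR_iff:
  assumes "1 \<le> m"
  shows "HP_DR m \<Delta> \<sigma> n a \<longleftrightarrow> hp_vector m n a \<and> dr_data n a"
proof -
  have "bigo_at_infinity_off (\<Delta> m) 1 (\<lambda>z. (- 1) ^ j *
          (poly (a j) z - poly (a m) z * cauchy_transform (nik \<sigma> m (j + 1)) z)) \<longleftrightarrow>
      a j = second_kind (nik \<sigma> m (Suc j)) (a m)" if j: "j \<in> {1..<m}" for j
  proof -
    interpret cs_in "nik \<sigma> m (Suc j)" "\<Delta> m" using nik_rev_in j by simp
    \<comment> \<open>A one-element index set brings the condition with its single measure into the
      shape of the general equivalence; for \<open>N = 0\<close> only the polynomial part is
      constrained.\<close>
    have "(\<lambda>z. (- 1) ^ j * (poly (a j) z - poly (a m) z * cauchy_transform (nik \<sigma> m (j + 1)) z)) =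
        (\<lambda>z. poly (smult ((- 1) ^ j) (a j)) z +
          (\<Sum>k\<in>{()}. poly (smult (- ((- 1) ^ j)) (a m)) z * cauchy_transform (nik \<sigma> m (Suc j)) z))"
      by (simp add: fun_eq_iff algebra_simps)
    then have "bigo_at_infinity_off (\<Delta> m) 1 (\<lambda>z. (- 1) ^ j *
          (poly (a j) z - poly (a m) z * cauchy_transform (nik \<sigma> m (j + 1)) z)) \<longleftrightarrow>
        smult ((- 1) ^ j) (a j) + second_kind (nik \<sigma> m (Suc j)) (smult (- ((- 1) ^ j)) (a m)) = 0"
      using bigo_at_infinity_off_iff[OF closed, of "{()}" "\<lambda>_. nik \<sigma> m (Suc j)" 0
          "smult ((- 1) ^ j) (a j)" "\<lambda>_. smult (- ((- 1) ^ j)) (a m)"] cs by simp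
    also have "\<dots> \<longleftrightarrow> smult ((- 1) ^ j) (a j - second_kind (nik \<sigma> m (Suc j)) (a m)) = 0"
      by (simp add: second_kind_smult second_kind_minus smult_diff_right)
    finally show ?thesis by simp
  qed
  moreover have "(\<lambda>z. poly (a 0) z + (\<Sum>k=1..m. (- 1) ^ k * poly (a k) z * cauchy_transform (nik \<sigma> 1 k) z)) =
      multilevel_form m \<sigma> a 0"
    by (simp add: multilevel_form_def fun_eq_iff)
  ultimately show ?thesis
    using bigo_form_iff[of 0 n a] assms
    by (simp add: HP_DR_def dr_data_def moment_def cong: ball_cong_simp)
qed

text \<open>Off the real line \<open>a k\<close> is \<open>a m\<close> times a reversed transform up
  to \<open>S k\<close>, and each polynomial of the second kind is \<open>a k\<close> times a
  forward transform up to \<open>R k\<close>. The terms with \<open>a m\<close> cancel by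
  \<open>nikishin_identity\<close>; the rest tends to 0 along the imaginary axis, which a nonzero
  polynomial cannot do.\<close>

lemma ml_poly_eq_zero:
  assumes dr: "\<forall>k\<in>{1..<m}. a k = second_kind (nik \<sigma> m (Suc k)) (a m)" and j: "1 \<le> j" "j < m"
  shows "ml_poly a j = (0 :: complex poly)"
proof (rule poly_zero_of_tendsto_0_imaginary)
  \<comment> \<open>For \<open>k = m\<close> the reversed chain is the empty one, equal to 1, and
    the relation holds without remainder.\<close>
  define S where "S k w = (if k = m then 0 else
      sint (nik \<sigma> m (Suc k)) (\<lambda>x. poly (a m) (of_real x) / (w - of_real x)))" for k w
  define R where "R k w = sint (nik \<sigma> (Suc j) k) (\<lambda>x. poly (a k) (of_real x) / (w - of_real x))" for k w
  have a: "poly (a k) w = poly (a m) w * bwc m (Suc k) w - S k w"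
    if "1 \<le> k" "k \<le> m" "Im w \<noteq> 0" for k w
  proof (cases "k = m")
    case False
    then interpret cs_in "nik \<sigma> m (Suc k)" "\<Delta> m" using nik_rev_in that by simp
    have "w \<notin> of_real ` \<Delta> m" using that(3) by auto
    from poly_mult_cauchy[OF this, of "a m"] False dr that show ?thesis
      by (simp add: S_def bwc_def cauchy_transform_eq_sint)
  qed (simp add: S_def bwc_def)
  have Q: "poly (second_kind (nik \<sigma> (Suc j) k) (a k)) w = poly (a k) w * fwc (Suc j) k w - R k w"
    if "Suc j \<le> k" "k \<le> m" "Im w \<noteq> 0" for k w
  proof -
    interpret cs_in "nik \<sigma> (Suc j) k" "\<Delta> (Suc j)" using nik_in that by simp
    have "w \<notin> of_real ` \<Delta> (Suc j)" using that(3) by auto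
    from poly_mult_cauchy[OF this, of "a k"] that show ?thesis
      by (simp add: R_def fwc_def cauchy_transform_eq_sint)
  qed
  let ?E = "\<lambda>w. - ((- 1) ^ j * S j w) - (\<Sum>k=Suc j..m. (- 1) ^ k * (S k w * fwc (Suc j) k w + R k w))"
  have E: "poly (ml_poly a j) w = ?E w" if w: "Im w \<noteq> 0" for w
  proof -
    have "poly (ml_poly a j) w = (- 1) ^ j * (poly (a m) w * bwc m (Suc j) w - S j w) +
        (\<Sum>k=Suc j..m. (- 1) ^ k * ((poly (a m) w * bwc m (Suc k) w - S k w) * fwc (Suc j) k w - R k w))"
    proof -
      have "poly (ml_poly a j) w = (- 1) ^ j * poly (a j) w +
          (\<Sum>k=Suc j..m. (- 1) ^ k * poly (second_kind (nik \<sigma> (Suc j) k) (a k)) w)"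
        by (simp add: ml_poly_def poly_sum)
      moreover have "poly (second_kind (nik \<sigma> (Suc j) k) (a k)) w =
          (poly (a m) w * bwc m (Suc k) w - S k w) * fwc (Suc j) k w - R k w" if "k \<in> {Suc j..m}" for k
        using Q[of k w] a[of k w] that w by simp
      ultimately show ?thesis using a[of j w] j w by simp
    qed
    also have "\<dots> = poly (a m) w * ((- 1) ^ j * bwc m (Suc j) w +
        (\<Sum>k=Suc j..m. (- 1) ^ k * bwc m (Suc k) w * fwc (Suc j) k w)) + ?E w"
      by (simp add: algebra_simps sum_distrib_left sum.distrib sum_subtractf)
    also have "(\<Sum>k=Suc j..m. (- 1) ^ k * bwc m (Suc k) w * fwc (Suc j) k w) = (- 1) ^ Suc j * bwc m (Suc j) w"
      using j by (intro nikishin_identity w) auto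
    finally show ?thesis by simp
  qed
  have S: "((\<lambda>y. S k (\<i> * of_real y)) \<longlongrightarrow> 0) at_top" if "1 \<le> k" "k \<le> m" for k
  proof (cases "k = m")
    case False
    then interpret cs_in "nik \<sigma> m (Suc k)" "\<Delta> m" using nik_rev_in that by simp
    show ?thesis using False by (simp add: S_def tendsto_sint_cauchy_imaginary integrable_poly)
  qed (simp add: S_def)
  have R: "((\<lambda>y. R k (\<i> * of_real y)) \<longlongrightarrow> 0) at_top"
    and fwc: "((\<lambda>y. fwc (Suc j) k (\<i> * of_real y)) \<longlongrightarrow> 0) at_top" if "Suc j \<le> k" "k \<le> m" for k
  proof -
    interpret cs_in "nik \<sigma> (Suc j) k" "\<Delta> (Suc j)" using nik_in that by simp
    show "((\<lambda>y. R k (\<i> * of_real y)) \<longlongrightarrow> 0) at_top"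
      by (simp add: R_def tendsto_sint_cauchy_imaginary integrable_poly)
    show "((\<lambda>y. fwc (Suc j) k (\<i> * of_real y)) \<longlongrightarrow> 0) at_top"
      using tendsto_sint_cauchy_imaginary[of "\<lambda>x. 1"] that
      by (simp add: fwc_def cauchy_transform_eq_sint)
  qed
  have "((\<lambda>y. ?E (\<i> * of_real y)) \<longlongrightarrow> - ((- 1) ^ j * 0) - (\<Sum>k=Suc j..m. (- 1) ^ k * (0 * 0 + 0))) at_top"
  proof (intro tendsto_diff tendsto_minus tendsto_sum)
    show "((\<lambda>y. (- 1) ^ j * S j (\<i> * of_real y)) \<longlongrightarrow> (- 1) ^ j * 0) at_top"
      using j by (intro tendsto_mult tendsto_const S) auto
    fix k assume k: "k \<in> {Suc j..m}"
    show "((\<lambda>y. (- 1) ^ k * (S k (\<i> * of_real y) * fwc (Suc j) k (\<i> * of_real y) + R k (\<i> * of_real y)))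
        \<longlongrightarrow> (- 1) ^ k * (0 * 0 + 0)) at_top"
      by (rule tendsto_mult[OF tendsto_const tendsto_add[OF tendsto_mult[OF S fwc] R]]) (use k in auto)
  qed
  then have lim: "((\<lambda>y. ?E (\<i> * of_real y)) \<longlongrightarrow> 0) at_top" by simp
  have "eventually (\<lambda>y. ?E (\<i> * of_real y) = poly (ml_poly a j) (\<i> * of_real y)) at_top"
    using eventually_gt_at_top[of 0]
  proof eventually_elim
    case (elim y)
    then show ?case by (intro E[symmetric]) simp
  qed
  from Lim_transform_eventually[OF lim this]
  show "((\<lambda>y. poly (ml_poly a j) (\<i> * of_real y)) \<longlongrightarrow> 0) at_top" .
qed

lemma dr_data_imp_ml_data:
  assumes "dr_data n a" shows "ml_data n a"
proof -
  have dr: "ml_poly a 0 = 0" "\<forall>\<nu><n. moment a \<nu> = 0"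
    "\<forall>j\<in>{1..<m}. a j = second_kind (nik \<sigma> m (Suc j)) (a m)"
    using assms unfolding dr_data_def by blast+
  have "ml_poly a j = 0" if "j < m" for j
  proof (cases "j = 0")
    case False
    then show ?thesis using ml_poly_eq_zero[OF dr(3), of j] that by simp
  qed (simp add: dr(1))
  then show ?thesis using dr(2) unfolding ml_data_def by blast
qed

lemma exists_dr_data:
  assumes m: "1 \<le> m"
  shows "\<exists>a. hp_vector m n a \<and> dr_data n a"
proof -
  \<comment> \<open>The component of index \<open>k \<ge> 1\<close> that the DR conditions force
    once \<open>a m = p\<close>; it depends linearly on \<open>p\<close>.\<close>
  define B where "B p k = (if k = m then p else second_kind (nik \<sigma> m (Suc k)) p)" for p :: "complex poly" and k
  define L where "L \<nu> p = (\<Sum>k=1..m. (- 1) ^ k * pfun (nik \<sigma> 1 k) (monom 1 \<nu> * B p k))" for \<nu> p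
  have B_sum: "B (\<Sum>i\<le>n. smult (x i) (q i)) k = (\<Sum>i\<le>n. smult (x i) (B (q i) k))"
    if "1 \<le> k" "k \<le> m" for x q k
  proof (cases "k = m")
    case False
    then interpret cs_in "nik \<sigma> m (Suc k)" "\<Delta> m" using nik_rev_in that by simp
    show ?thesis using False by (simp add: B_def second_kind_sum second_kind_smult)
  qed (simp add: B_def)
  have L_sum: "L \<nu> (\<Sum>i\<le>n. smult (x i) (q i)) = (\<Sum>i\<le>n. L \<nu> (q i) * x i)" for \<nu> x q
  proof -
    have "(- 1) ^ k * pfun (nik \<sigma> 1 k) (monom 1 \<nu> * B (\<Sum>i\<le>n. smult (x i) (q i)) k) =
        (\<Sum>i\<le>n. (- 1) ^ k * pfun (nik \<sigma> 1 k) (monom 1 \<nu> * B (q i) k) * x i)" if k: "k \<in> {1..m}" for k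
    proof -
      interpret cs_in "nik \<sigma> 1 k" "\<Delta> 1" using nik_in k by simp
      show ?thesis using k by (simp add: B_sum sum_distrib_left pfun_sum pfun_smult mult_ac del: One_nat_def)
    qed
    then have "L \<nu> (\<Sum>i\<le>n. smult (x i) (q i)) =
        (\<Sum>k=1..m. \<Sum>i\<le>n. (- 1) ^ k * pfun (nik \<sigma> 1 k) (monom 1 \<nu> * B (q i) k) * x i)"
      by (simp add: L_def)
    also have "\<dots> = (\<Sum>i\<le>n. L \<nu> (q i) * x i)"
      by (subst sum.swap) (simp add: L_def sum_distrib_right)
    finally show ?thesis .
  qed
  obtain x where x: "\<exists>i\<in>{..n}. x i \<noteq> 0" "\<forall>\<nu>\<in>{..<n}. (\<Sum>i\<in>{..n}. L \<nu> (monom 1 i) * x i) = 0"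
    using homogeneous_system_nontrivial[of "{..<n}" "{..n}" "\<lambda>\<nu> i. L \<nu> (monom 1 i)"] by auto
  define p where "p = (\<Sum>i\<le>n. smult (x i) (monom 1 i))"
  have coeff_p: "coeff p i = x i" if "i \<le> n" for i
    using that by (simp add: p_def coeff_sum smult_monom)
  then have p: "p \<noteq> 0" using x(1) by force
  have deg_p: "degree p \<le> n"
    unfolding p_def by (intro degree_sum_le) (auto simp: smult_monom intro: order_trans[OF degree_monom_le])
  \<comment> \<open>Component 0 is chosen to cancel the polynomial part of the level 0 form.\<close>
  define a where "a k = (if k = 0 then - (\<Sum>k=1..m. smult ((- 1) ^ k) (second_kind (nik \<sigma> 1 k) (B p k))) else B p k)" for k
  have am: "a m = p" using m by (simp add: a_def B_def)
  have deg_B: "degree (B p k) \<le> n - 1" if "1 \<le> k" "k < m" for k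
  proof -
    interpret cs_in "nik \<sigma> m (Suc k)" "\<Delta> m" using nik_rev_in that by simp
    show ?thesis using degree_second_kind[of p] deg_p that by (simp add: B_def)
  qed
  have "degree (smult ((- 1) ^ k) (second_kind (nik \<sigma> 1 k) (B p k))) \<le> n - 1" if "k \<in> {1..m}" for k
  proof -
    interpret cs_in "nik \<sigma> 1 k" "\<Delta> 1" using nik_in that by simp
    have "degree (B p k) \<le> n" using deg_B[of k] that deg_p by (cases "k = m") (auto simp: B_def)
    then show ?thesis using degree_second_kind[of "B p k"] by (simp add: degree_smult_eq)
  qed
  then have "degree (a 0) \<le> n - 1"
    unfolding a_def if_P[OF refl] degree_minus by (intro degree_sum_le) auto
  moreover have "degree (a k) \<le> n - 1" if "0 < k" "k < m" for k
    using deg_B[of k] that by (simp add: a_def)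
  ultimately have "hp_vector m n a"
    using p am deg_p unfolding hp_vector_def by (metis gr0I order_refl)
  moreover have "dr_data n a"
  proof -
    have "moment a \<nu> = L \<nu> p" for \<nu> by (simp add: moment_def L_def a_def)
    moreover have "L \<nu> p = 0" if "\<nu> < n" for \<nu> using x(2) that by (simp add: p_def L_sum)
    moreover have "ml_poly a 0 = 0" by (simp add: ml_poly_def a_def)
    moreover have "a j = second_kind (nik \<sigma> m (Suc j)) (a m)" if "j \<in> {1..<m}" for j
      using that by (simp add: am) (simp add: a_def B_def)
    ultimately show ?thesis by (simp add: dr_data_def)
  qed
  ultimately show ?thesis by blast
qed

end

section \<open>Zeros of the forms\<close>

lemma (in cs_in) continuous_cauchy_on_reals: "continuous_on (- \<Delta>) (cauchy_on_reals s)"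
proof -
  have "isCont (cauchy_on_reals s) x" if x: "x \<in> - \<Delta>" for x
  proof -
    obtain d where d: "d > 0" "\<And>y. y \<in> \<Delta> \<Longrightarrow> d \<le> \<bar>x - y\<bar>"
      using off_dist[of x] x by (auto simp: image_iff)
    \<comment> \<open>The factor \<open>2\<close> over \<open>d\<close> squared comes from
      \<open>|x' - y| \<ge> d / 2\<close> and \<open>|x - y| \<ge> d\<close> in the denominator of
      the difference of the kernels.\<close>
    let ?C = "(LINT y|cs_abs s. 2 / d\<^sup>2)"
    have "((\<lambda>x'. cauchy_on_reals s x' - cauchy_on_reals s x) \<longlongrightarrow> 0) (at x)"
    proof (rule Lim_null_comparison)
      show "eventually (\<lambda>x'. norm (cauchy_on_reals s x' - cauchy_on_reals s x) \<le> \<bar>x - x'\<bar> * ?C) (at x)"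
      proof (rule eventually_at[THEN iffD2], intro exI[of _ "d / 2"] conjI ballI impI)
        fix x' assume "x' \<noteq> x \<and> dist x' x < d / 2"
        then have x': "\<bar>x - x'\<bar> < d / 2" by (simp add: dist_real_def abs_minus_commute)
        have d': "d / 2 \<le> \<bar>x' - y\<bar>" if "y \<in> \<Delta>" for y using d(2)[OF that] x' by linarith
        then have "x' \<notin> \<Delta>" using d(1) by force
        then have int: "integrable (cs_abs s) (\<lambda>y. 1 / (x' - y))" "integrable (cs_abs s) (\<lambda>y. 1 / (x - y))"
          using integrable_cauchy[of x'] integrable_cauchy[of x] x by (simp_all add: image_iff)
        have "norm (cauchy_on_reals s x' - cauchy_on_reals s x) = norm (sint s (\<lambda>y. 1 / (x' - y) - 1 / (x - y)))"
          unfolding cauchy_on_reals_eq_sint sint_diff[OF int] ..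
        also have "\<dots> \<le> (LINT y|cs_abs s. norm (1 / (x' - y) - 1 / (x - y)))"
          by (intro sint_norm_le abs_sgn)
        also have "\<dots> \<le> (LINT y|cs_abs s. \<bar>x - x'\<bar> * (2 / d\<^sup>2))"
        proof (rule integral_mono_AE)
          show "integrable (cs_abs s) (\<lambda>y. norm (1 / (x' - y) - 1 / (x - y)))"
            by (intro integrable_norm Bochner_Integration.integrable_diff int)
          show "AE y in cs_abs s. norm (1 / (x' - y) - 1 / (x - y)) \<le> \<bar>x - x'\<bar> * (2 / d\<^sup>2)"
            using AE_in
          proof eventually_elim
            case (elim y)
            have nz: "x' - y \<noteq> 0" "x - y \<noteq> 0" using d'[OF elim] d(2)[OF elim] d(1) by auto
            have "1 / (x' - y) - 1 / (x - y) = (x - x') / ((x' - y) * (x - y))"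
              using nz by (simp add: divide_simps)
            then have "norm (1 / (x' - y) - 1 / (x - y)) = \<bar>x - x'\<bar> / (\<bar>x' - y\<bar> * \<bar>x - y\<bar>)"
              by (simp add: abs_mult)
            also have "\<dots> \<le> \<bar>x - x'\<bar> / (d / 2 * d)"
              using d'[OF elim] d(2)[OF elim] d(1) by (intro divide_left_mono mult_mono mult_pos_pos) auto
            finally show ?case by (simp add: power2_eq_square)
          qed
        qed simp
        finally show "norm (cauchy_on_reals s x' - cauchy_on_reals s x) \<le> \<bar>x - x'\<bar> * ?C" by (simp add: mult_ac)
      qed (use d in simp)
      show "((\<lambda>x'. \<bar>x - x'\<bar> * ?C) \<longlongrightarrow> 0) (at x)"
        by (rule tendsto_eq_intros refl | simp)+
    qed
    then show ?thesis unfolding isCont_def by (rule LIM_zero_cancel)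
  qed
  then show ?thesis by (simp add: continuous_at_imp_continuous_on)
qed

text \<open>Induction on the largest point \<open>b\<close>: adjoining it adds only the gap between
  \<open>Max A\<close> and \<open>b\<close>, where the sign change gives a zero beyond all the
  earlier ones.\<close>

lemma interlacing_zeros:
  fixes f :: "real \<Rightarrow> real"
  assumes "finite X" "X \<noteq> {}" "continuous_on UNIV f"
    and "\<And>x y. x \<in> X \<Longrightarrow> y \<in> X \<Longrightarrow> x < y \<Longrightarrow> {x<..<y} \<inter> X = {} \<Longrightarrow> f x * f y < 0"
  shows "\<exists>Y. finite Y \<and> card Y = card X - 1 \<and> (\<forall>z\<in>Y. f z = 0 \<and> (\<exists>x\<in>X. \<exists>y\<in>X. x < z \<and> z < y))"
  using assms(1,2,4)
proof (induction X rule: finite_linorder_max_induct)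
  case (insert b A)
  show ?case
  proof (cases "A = {}")
    case False
    define a where "a = Max A"
    have a: "a \<in> A" "\<And>x. x \<in> A \<Longrightarrow> x \<le> a" using insert.hyps(1) False by (auto simp: a_def)
    have step: "f x * f y < 0" if "x \<in> A" "y \<in> A" "x < y" "{x<..<y} \<inter> A = {}" for x y
    proof -
      have "b \<notin> {x<..<y}" using insert.hyps(2) that(2) by fastforce
      then show ?thesis using insert.prems(2)[of x y] that by simp
    qed
    have "\<exists>Y. finite Y \<and> card Y = card A - 1 \<and> (\<forall>z\<in>Y. f z = 0 \<and> (\<exists>x\<in>A. \<exists>y\<in>A. x < z \<and> z < y))"
      by (rule insert.IH[OF False]) (rule step)
    then obtain Y where Y: "finite Y" "card Y = card A - 1"
      "\<forall>z\<in>Y. f z = 0 \<and> (\<exists>x\<in>A. \<exists>y\<in>A. x < z \<and> z < y)"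
      by (elim exE conjE)
    have ab: "a < b" using a insert.hyps(2) by auto
    have neg: "f a * f b < 0"
    proof -
      have "{a<..<b} \<inter> insert b A = {}" using a(2) by fastforce
      then show ?thesis using insert.prems(2)[of a b] a(1) ab by simp
    qed
    have "\<exists>z. a \<le> z \<and> z \<le> b \<and> f z = 0"
    proof (cases "f a < 0")
      case True
      then show ?thesis using neg ab continuous_on_subset[OF assms(3)]
        by (intro IVT') (auto simp: mult_less_0_iff)
    next
      case False
      then show ?thesis using neg ab continuous_on_subset[OF assms(3)]
        by (intro IVT2') (auto simp: mult_less_0_iff)
    qed
    then obtain z where z: "a \<le> z" "z \<le> b" "f z = 0" by blast
    with neg have z': "a < z" "z < b" by (auto simp: order_less_le)
    have "z \<notin> Y" using Y(3) a(2) z'(1) by force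
    moreover have "card (insert b A) = Suc (card A)" "card A > 0"
      using insert.hyps False by (auto simp: card_gt_0_iff)
    ultimately show ?thesis using Y z z' a(1)
      by (intro exI[of _ "insert z Y"]) auto
  qed (auto intro!: exI[of _ "{}"])
qed simp

context nikishin
begin

text \<open>An interior point of \<open>\<Delta> j\<close> in the next interval, which is infinite,
  would give a whole open interval of common points.\<close>

lemma interior_disjoint:
  assumes "1 \<le> j" "Suc j \<le> m"
  shows "interior (\<Delta> j) \<inter> \<Delta> (Suc j) = {}"
proof (rule ccontr)
  assume "interior (\<Delta> j) \<inter> \<Delta> (Suc j) \<noteq> {}"
  then obtain t where t: "t \<in> interior (\<Delta> j)" "t \<in> \<Delta> (Suc j)" by auto
  then obtain e where e: "e > 0" "ball t e \<subseteq> \<Delta> j" by (meson mem_interior)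
  interpret T: cs_in "\<sigma> (Suc j)" "\<Delta> (Suc j)" using gen_in[of "Suc j"] assms by simp
  have "infinite (\<Delta> (Suc j) - {t})" using T.infinite_carrier by simp
  then obtain u where u: "u \<in> \<Delta> (Suc j)" "u \<noteq> t" by (metis Diff_iff finite.emptyI insertCI subsetI subset_empty)
  have iv: "x \<in> \<Delta> (Suc j)" if "y \<in> \<Delta> (Suc j)" "z \<in> \<Delta> (Suc j)" "y \<le> x" "x \<le> z" for x y z
    using interval[of "Suc j", unfolded is_interval_1, rule_format, of y z x] assms that by simp
  have "\<exists>a b. a < b \<and> {a<..<b} \<subseteq> \<Delta> j \<inter> \<Delta> (Suc j)"
  proof (cases "t < u")
    case True
    have "{t<..<min u (t + e)} \<subseteq> \<Delta> j \<inter> \<Delta> (Suc j)"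
    proof
      fix x assume "x \<in> {t<..<min u (t + e)}"
      then show "x \<in> \<Delta> j \<inter> \<Delta> (Suc j)" using e iv[OF t(2) u(1), of x] by (auto simp: subset_iff dist_real_def)
    qed
    then show ?thesis using True e by (intro exI[of _ t] exI[of _ "min u (t + e)"]) auto
  next
    case False
    have "{max u (t - e)<..<t} \<subseteq> \<Delta> j \<inter> \<Delta> (Suc j)"
    proof
      fix x assume "x \<in> {max u (t - e)<..<t}"
      then show "x \<in> \<Delta> j \<inter> \<Delta> (Suc j)" using e iv[OF u(1) t(2), of x] by (auto simp: subset_iff dist_real_def)
    qed
    then show ?thesis using False u e by (intro exI[of _ "max u (t - e)"] exI[of _ t]) auto
  qed
  then show False using adjacent(1)[OF assms] by (meson finite_subset infinite_Ioo)
qed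

text \<open>The level \<open>j\<close> form of a real vector, restricted to the real line. With the
  empty chain 1 the term \<open>k = j\<close> is its polynomial summand.\<close>

definition form :: "(nat \<Rightarrow> real poly) \<Rightarrow> nat \<Rightarrow> real \<Rightarrow> real" where
  "form b j x = (\<Sum>k=j..m. (- 1) ^ k * (fw (Suc j) k x * poly (b k) x))"

lemma form_last: "form b m x = (- 1) ^ m * poly (b m) x"
  by (simp add: form_def fw_def)

lemma integrable_form_term:
  fixes p :: "real poly"
  assumes "1 \<le> j" "j \<le> k" "k \<le> m"
  shows "integrable (cs_abs (\<sigma> j)) (\<lambda>x. fw (Suc j) k x * poly p x)"
proof -
  interpret cs_in "nik \<sigma> j k" "\<Delta> j" using nik_in assms by blast
  have "(\<lambda>x. poly p x) \<in> borel_measurable borel"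
    using borel_measurable_integrable[OF integrable_poly[of p]] by simp
  then show ?thesis using integrable_nik[of j k "poly p"] assms integrable_poly[of p] by simp
qed

lemma integrable_form:
  assumes "1 \<le> j" "j \<le> m"
  shows "integrable (cs_abs (\<sigma> j)) (\<lambda>x. poly p x * form b j x)"
proof -
  have "integrable (cs_abs (\<sigma> j)) (\<lambda>x. \<Sum>k=j..m. (- 1) ^ k * (fw (Suc j) k x * poly (p * b k) x))"
    using assms by (intro Bochner_Integration.integrable_sum integrable_mult_right integrable_form_term) auto
  then show ?thesis by (simp add: form_def sum_distrib_left mult_ac)
qed

lemma sint_nik_poly:
  assumes "1 \<le> j" "j \<le> k" "k \<le> m"
  shows "pfun (nik \<sigma> j k) p = sint (\<sigma> j) (\<lambda>x. fw (Suc j) k x * poly (p :: real poly) x)"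
proof -
  interpret cs_in "nik \<sigma> j k" "\<Delta> j" using nik_in assms by blast
  have "(\<lambda>x. poly p x) \<in> borel_measurable borel"
    using borel_measurable_integrable[OF integrable_poly[of p]] by simp
  then show ?thesis using sint_nik[of j k "poly p"] assms by (simp add: pfun_def)
qed

text \<open>Expanding \<open>p\<close> into powers turns the integral into a combination of the
  moments of index below \<open>n\<close>, all of which vanish.\<close>

lemma form_first_orthogonal:
  assumes m: "1 \<le> m" and b: "ml_data n b" and p: "degree p < n"
  shows "sint (\<sigma> 1) (\<lambda>x. poly p x * form b 1 x) = 0"
proof -
  have nik1: "cs_in (nik \<sigma> 1 k) (\<Delta> 1)" if "k \<in> {1..m}" for k using nik_in that by simp
  have "sint (\<sigma> 1) (\<lambda>x. poly p x * form b 1 x) =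
      sint (\<sigma> 1) (\<lambda>x. \<Sum>k=1..m. (- 1) ^ k * (fw (Suc 1) k x * poly (p * b k) x))"
    by (simp add: form_def sum_distrib_left mult_ac)
  also have "\<dots> = (\<Sum>k=1..m. sint (\<sigma> 1) (\<lambda>x. (- 1) ^ k * (fw (Suc 1) k x * poly (p * b k) x)))"
    by (rule sint_sum, rule integrable_mult_right, rule integrable_form_term) auto
  also have "\<dots> = (\<Sum>k=1..m. (- 1) ^ k * pfun (nik \<sigma> 1 k) (p * b k))"
    unfolding sint_mult_left by (intro sum.cong refl) (use sint_nik_poly[of 1] in simp)
  also have "\<dots> = (\<Sum>k=1..m. \<Sum>\<nu>\<le>degree p. coeff p \<nu> * ((- 1) ^ k * pfun (nik \<sigma> 1 k) (monom 1 \<nu> * b k)))"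
  proof (intro sum.cong refl)
    fix k assume k: "k \<in> {1..m}"
    interpret cs_in "nik \<sigma> 1 k" "\<Delta> 1" by (rule nik1[OF k])
    have "p * b k = (\<Sum>\<nu>\<le>degree p. smult (coeff p \<nu>) (monom 1 \<nu> * b k))"
      by (subst (1) poly_as_sum_of_monoms[symmetric]) (simp add: sum_distrib_right smult_monom flip: mult_smult_left)
    then show "(- 1) ^ k * pfun (nik \<sigma> 1 k) (p * b k) =
        (\<Sum>\<nu>\<le>degree p. coeff p \<nu> * ((- 1) ^ k * pfun (nik \<sigma> 1 k) (monom 1 \<nu> * b k)))"
      by (simp only: pfun_sum pfun_smult sum_distrib_left mult_ac)
  qed
  also have "\<dots> = (\<Sum>\<nu>\<le>degree p. coeff p \<nu> * moment b \<nu>)"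
    by (subst sum.swap) (simp add: moment_def sum_distrib_left)
  also have "\<dots> = 0" using b p by (intro sum.neutral) (auto simp: ml_data_def)
  finally show ?thesis .
qed

text \<open>Each product of \<open>b k\<close> with a transform splits into its polynomial part and
  a Cauchy integral; together with \<open>b j\<close> the polynomial parts add up to
  \<open>ml_poly b j\<close>, which is zero.\<close>

lemma form_eq_integral:
  assumes "j < m" and t: "t \<notin> \<Delta> (Suc j)" and b: "ml_poly b j = 0"
  shows "form b j t = sint (\<sigma> (Suc j)) (\<lambda>x. form b (Suc j) x / (t - x))"
    and "integrable (cs_abs (\<sigma> (Suc j))) (\<lambda>x. form b (Suc j) x / (t - x))"
proof -
  interpret G: cs_in "\<sigma> (Suc j)" "\<Delta> (Suc j)" using gen_in[of "Suc j"] assms by simp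
  have t': "t \<notin> of_real ` \<Delta> (Suc j)" using t by simp
  have int: "integrable (cs_abs (\<sigma> (Suc j))) (\<lambda>x. fw (Suc (Suc j)) k x * poly (b k) x / (t - x))"
    if "k \<in> {Suc j..m}" for k
    using G.integrable_divide_off[OF integrable_form_term t', of k "b k"] that by simp
  have eq: "poly (b k) t * fw (Suc j) k t = poly (second_kind (nik \<sigma> (Suc j) k) (b k)) t +
      sint (\<sigma> (Suc j)) (\<lambda>x. fw (Suc (Suc j)) k x * poly (b k) x / (t - x))" if k: "k \<in> {Suc j..m}" for k
  proof -
    interpret cs_in "nik \<sigma> (Suc j) k" "\<Delta> (Suc j)" using nik_in k by simp
    have "(\<lambda>x. poly (b k) x / (t - x)) \<in> borel_measurable borel"
      using borel_measurable_integrable[OF integrable_divide_off[OF integrable_poly[of "b k"] t']] by simp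
    then show ?thesis
      using poly_mult_cauchy[OF t', of "b k"] sint_nik[of "Suc j" k "\<lambda>x. poly (b k) x / (t - x)"] k
      by (simp add: fw_def[of "Suc j"] cauchy_on_reals_eq_sint)
  qed
  have sum: "(\<lambda>x. form b (Suc j) x / (t - x)) =
      (\<lambda>x. \<Sum>k=Suc j..m. (- 1) ^ k * (fw (Suc (Suc j)) k x * poly (b k) x / (t - x)))"
    by (simp add: form_def sum_divide_distrib)
  show "integrable (cs_abs (\<sigma> (Suc j))) (\<lambda>x. form b (Suc j) x / (t - x))"
    unfolding sum by (intro Bochner_Integration.integrable_sum integrable_mult_right int)
  have "form b j t = (- 1) ^ j * poly (b j) t + (\<Sum>k=Suc j..m. (- 1) ^ k * (poly (b k) t * fw (Suc j) k t))"
    using assms(1) by (simp add: form_def sum.atLeast_Suc_atMost[of j] fw_def mult_ac)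
  also have "\<dots> = poly (ml_poly b j) t + (\<Sum>k=Suc j..m. (- 1) ^ k *
      sint (\<sigma> (Suc j)) (\<lambda>x. fw (Suc (Suc j)) k x * poly (b k) x / (t - x)))"
    by (simp add: eq ml_poly_def poly_sum distrib_left sum.distrib)
  also have "\<dots> = (\<Sum>k=Suc j..m. sint (\<sigma> (Suc j)) (\<lambda>x. (- 1) ^ k * (fw (Suc (Suc j)) k x * poly (b k) x / (t - x))))"
    unfolding b sint_mult_left by simp
  also have "\<dots> = sint (\<sigma> (Suc j)) (\<lambda>x. form b (Suc j) x / (t - x))"
    unfolding sum by (rule sint_sum[symmetric], rule integrable_mult_right, rule int)
  finally show "form b j t = sint (\<sigma> (Suc j)) (\<lambda>x. form b (Suc j) x / (t - x))" .
qed

text \<open>The form of level \<open>j < m\<close> contains transforms of measures on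
  \<open>\<Delta> (Suc j)\<close> and may be singular at a common endpoint, so that interval is
  taken out. The form of level \<open>m\<close> is a polynomial.\<close>

definition regular_part :: "nat \<Rightarrow> real set" where
  "regular_part j = (if j < m then \<Delta> j - \<Delta> (Suc j) else \<Delta> j)"

lemma regular_part:
  assumes "1 \<le> j" "j \<le> m"
  shows "interior (\<Delta> j) \<subseteq> regular_part j" "regular_part j \<subseteq> \<Delta> j"
    "AE x in cs_abs (\<sigma> j). x \<in> regular_part j"
proof -
  interpret cs_in "\<sigma> j" "\<Delta> j" using gen_in assms by simp
  show "interior (\<Delta> j) \<subseteq> regular_part j"
    using interior_disjoint[of j] assms interior_subset[of "\<Delta> j"] by (auto simp: regular_part_def)
  show "regular_part j \<subseteq> \<Delta> j" by (auto simp: regular_part_def)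
  have "AE x in cs_abs (\<sigma> j). j < m \<longrightarrow> x \<notin> \<Delta> (Suc j)"
    using adjacent(2)[of j] assms by (cases "j < m") auto
  then show "AE x in cs_abs (\<sigma> j). x \<in> regular_part j"
    using AE_in by eventually_elim (auto simp: regular_part_def)
qed

lemma continuous_form:
  assumes "1 \<le> j" "j \<le> m"
  shows "continuous_on (regular_part j) (form b j)"
  unfolding form_def[abs_def]
proof (intro continuous_intros)
  fix k assume k: "k \<in> {j..m}"
  show "continuous_on (regular_part j) (fw (Suc j) k)"
  proof (cases "k = j")
    case True
    then have "fw (Suc j) k = (\<lambda>x. 1)" by (simp add: fw_def[abs_def])
    then show ?thesis by simp
  next
    case False
    then have "fw (Suc j) k = cauchy_on_reals (nik \<sigma> (Suc j) k)" "regular_part j \<subseteq> - \<Delta> (Suc j)"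
      using k assms by (auto simp: fw_def regular_part_def)
    then show ?thesis
      using cs_in.continuous_cauchy_on_reals[OF nik_in, of "Suc j" k] False k
      by (metis atLeastAtMost_iff continuous_on_subset le_neq_implies_less less_eq_Suc_le One_nat_def Suc_le_mono le0)
  qed
qed

lemma root_poly_nonzero:
  assumes "1 \<le> j" "Suc j \<le> m" "X \<subseteq> interior (\<Delta> j)" "finite X" "x \<in> \<Delta> (Suc j)"
  shows "poly (root_poly X) x \<noteq> 0"
  using assms interior_disjoint[of j] by (auto simp: poly_root_poly)

text \<open>The points of \<open>X\<close> are interior to \<open>\<Delta> j\<close>, hence off
  \<open>\<Delta> (Suc j)\<close>: the denominator has no zero there, and each partial fraction
  integrates to a multiple of \<open>form b j t = 0\<close>.\<close>

lemma form_next_orthogonal: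
  assumes j: "1 \<le> j" "Suc j \<le> m" and b: "ml_data n b"
    and X: "X \<subseteq> interior (\<Delta> j)" "finite X" "card X = n" "\<And>x. x \<in> X \<Longrightarrow> form b j x = 0"
    and p: "degree p < n"
  shows "integrable (cs_abs (\<sigma> (Suc j))) (\<lambda>x. poly p x * (form b (Suc j) x / poly (root_poly X) x)) \<and>
    sint (\<sigma> (Suc j)) (\<lambda>x. poly p x * (form b (Suc j) x / poly (root_poly X) x)) = 0"
proof -
  interpret cs_in "\<sigma> (Suc j)" "\<Delta> (Suc j)" using gen_in[of "Suc j"] j by simp
  obtain c where c: "\<And>x. x \<notin> X \<Longrightarrow> poly p x / poly (root_poly X) x = (\<Sum>t\<in>X. c t / (x - t))"
    using partial_fractions[of X p] X p by blast
  have off: "t \<notin> \<Delta> (Suc j)" if "t \<in> X" for t using interior_disjoint[OF j] X(1) that by auto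
  have E: "form b j t = sint (\<sigma> (Suc j)) (\<lambda>x. form b (Suc j) x / (t - x))"
    "integrable (cs_abs (\<sigma> (Suc j))) (\<lambda>x. form b (Suc j) x / (t - x))" if "t \<in> X" for t
    using form_eq_integral[of j t b] off[OF that] j b by (auto simp: ml_data_def)
  let ?f = "\<lambda>x. poly p x * (form b (Suc j) x / poly (root_poly X) x)"
  \<comment> \<open>The minus sign is due to the kernel \<open>1 / (t - x)\<close> in
    \<open>form_eq_integral\<close>, whereas the partial fractions have
    \<open>1 / (x - t)\<close>.\<close>
  let ?g = "\<lambda>x. \<Sum>t\<in>X. - c t * (form b (Suc j) x / (t - x))"
  have g: "integrable (cs_abs (\<sigma> (Suc j))) ?g"
    by (intro Bochner_Integration.integrable_sum integrable_mult_right E)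
  have "integrable (cs_abs (\<sigma> (Suc j))) (\<lambda>x. poly 1 x * form b (Suc j) x)"
    using j by (intro integrable_form) auto
  then have meas: "form b (Suc j) \<in> borel_measurable borel"
    using borel_measurable_integrable by fastforce
  have pm: "(\<lambda>x. poly q x) \<in> borel_measurable borel" for q :: "real poly"
    using borel_measurable_integrable[OF integrable_poly[of q]] by simp
  have f_meas: "?f \<in> borel_measurable borel"
    by (intro borel_measurable_times borel_measurable_divide pm meas)
  have AE: "AE x in cs_abs (\<sigma> (Suc j)). ?f x = ?g x"
    using AE_in
  proof eventually_elim
    case (elim x)
    then have "x \<notin> X" using off by auto
    have "?f x = poly p x / poly (root_poly X) x * form b (Suc j) x" by simp
    also have "\<dots> = (\<Sum>t\<in>X. c t / (x - t) * form b (Suc j) x)"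
      by (simp only: c[OF \<open>x \<notin> X\<close>] sum_distrib_right)
    also have "\<dots> = ?g x"
    proof (intro sum.cong refl)
      fix t
      have "c t / (x - t) = - c t / (t - x)" by (metis minus_diff_eq minus_divide_divide minus_minus)
      then show "c t / (x - t) * form b (Suc j) x = - c t * (form b (Suc j) x / (t - x))" by simp
    qed
    finally show ?case .
  qed
  have "integrable (cs_abs (\<sigma> (Suc j))) ?f"
    by (rule integrable_cong_AE_imp[OF g]) (use f_meas AE in \<open>auto elim: eventually_mono\<close>)
  moreover have "sint (\<sigma> (Suc j)) ?f = sint (\<sigma> (Suc j)) ?g"
    by (rule sint_cong_AE[OF AE]) (use f_meas borel_measurable_integrable[OF g] in simp_all)
  moreover have "sint (\<sigma> (Suc j)) ?g = (\<Sum>t\<in>X. sint (\<sigma> (Suc j)) (\<lambda>x. - c t * (form b (Suc j) x / (t - x))))"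
    by (intro sint_sum integrable_mult_right E)
  moreover have "\<dots> = 0"
    unfolding sint_mult_left using E(1) X(4) by (intro sum.neutral) auto
  ultimately show ?thesis by simp
qed

lemma form_zeros:
  assumes b: "ml_data n b" and j: "1 \<le> j" "j \<le> m"
  shows "\<exists>X. X \<subseteq> interior (\<Delta> j) \<and> finite X \<and> card X = n \<and> (\<forall>x\<in>X. form b j x = 0)"
  using j
proof (induction j rule: nat_induct_at_least)
  case base
  interpret cs_in "\<sigma> 1" "\<Delta> 1" using gen_in base by simp
  show ?case
    using zeros_of_orthogonal[OF interval regular_part continuous_form, of n b] base
      form_first_orthogonal[OF _ b] integrable_form[of 1] by simp
next
  case (Suc j)
  then obtain X where X: "X \<subseteq> interior (\<Delta> j)" "finite X" "card X = n" "\<And>x. x \<in> X \<Longrightarrow> form b j x = 0"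
    by auto
  interpret cs_in "\<sigma> (Suc j)" "\<Delta> (Suc j)" using gen_in[of "Suc j"] Suc by simp
  \<comment> \<open>The divisor has no zero on \<open>\<Delta> (Suc j)\<close>, so the division
    preserves continuity and the zeros of the form.\<close>
  let ?f = "\<lambda>x. form b (Suc j) x / poly (root_poly X) x"
  have nz: "poly (root_poly X) x \<noteq> 0" if "x \<in> \<Delta> (Suc j)" for x
    using root_poly_nonzero[of j X x] Suc X that by simp
  have j': "1 \<le> Suc j" using Suc by simp
  have cont: "continuous_on (regular_part (Suc j)) ?f"
    using nz regular_part(2)[of "Suc j"] Suc by (intro continuous_intros continuous_form) auto
  obtain Z where Z: "Z \<subseteq> interior (\<Delta> (Suc j))" "finite Z" "card Z = n" "\<forall>x\<in>Z. ?f x = 0"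
    using zeros_of_orthogonal[OF interval[OF j' Suc.prems] regular_part[OF j' Suc.prems] cont
        form_next_orthogonal[OF Suc.hyps Suc.prems b X]] by blast
  have "form b (Suc j) x = 0" if "x \<in> Z" for x
  proof -
    have "x \<in> \<Delta> (Suc j)" using Z(1) that interior_subset by blast
    from nz[OF this] bspec[OF Z(4) that] show ?thesis by simp
  qed
  with Z show ?case by auto
qed

text \<open>Downwards in \<open>j\<close>: once all higher components vanish,
  \<open>ml_poly b j\<close> is \<open>b j\<close> up to sign.\<close>

lemma ml_data_trivial:
  fixes b :: "nat \<Rightarrow> 'a::{real_normed_field, banach, second_countable_topology} poly"
  assumes b: "ml_data n b" and bm: "b m = 0" and j: "j \<le> m"
  shows "b j = 0"
  using j
proof (induction "m - j" arbitrary: j rule: less_induct)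
  case less
  show ?case
  proof (cases "j = m")
    case False
    have "b k = 0" if "k \<in> {Suc j..m}" for k using less that by auto
    then have "ml_poly b j = smult ((- 1) ^ j) (b j)"
      by (simp add: ml_poly_def second_kind_def)
    then show ?thesis using b less.prems False by (auto simp: ml_data_def)
  qed (simp add: bm)
qed

text \<open>Here \<open>b m\<close> has \<open>n\<close> zeros but degree below \<open>n\<close>.
  The hypothesis on coefficient \<open>n\<close> fits differences of vectors with matched leading
  coefficients and imaginary parts of normalised vectors.\<close>

lemma real_ml_data_unique:
  fixes b :: "nat \<Rightarrow> real poly"
  assumes m: "1 \<le> m" and b: "ml_data n b" and deg: "degree (b m) \<le> n" and coeff: "coeff (b m) n = 0"
    and j: "j \<le> m"
  shows "b j = 0"
proof (rule ml_data_trivial[OF b _ j])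
  obtain X where X: "finite X" "card X = n" "\<forall>x\<in>X. form b m x = 0"
    using form_zeros[OF b m order_refl] by blast
  show "b m = 0"
  proof (rule ccontr)
    assume nz: "b m \<noteq> 0"
    then have "degree (b m) < n" using deg coeff by (metis le_neq_implies_less leading_coeff_0_iff)
    moreover have "card X \<le> card {x. poly (b m) x = 0}"
      using X nz by (intro card_mono poly_roots_finite) (auto simp: form_last)
    ultimately show False using card_poly_roots_bound[OF nz] X by simp
  qed
qed

end

section \<open>Quadrature and uniqueness\<close>

lemma degree_map_poly_le: "f 0 = 0 \<Longrightarrow> degree (map_poly f p) \<le> degree p"
  by (rule degree_le) (simp add: coeff_map_poly coeff_eq_0)

context cs_in
begin

text \<open>For \<open>B = [:- r, 1:] * u\<close> the derivative of \<open>B\<close> at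
  \<open>r\<close> is \<open>u r\<close>; if it is nonzero, the value here divided by
  \<open>u r\<close> is the weight at \<open>r\<close> of interpolatory quadrature at the zeros of
  \<open>B\<close>.\<close>

lemma poly_second_kind_root:
  fixes u :: "'a::{real_normed_field, banach, second_countable_topology} poly"
  shows "poly (second_kind s ([:- r, 1:] * u)) r = pfun s u"
proof -
  have "[:- r, 1:] * u = pCons 0 u - smult r u" by simp
  then show ?thesis
    by (simp only: second_kind_diff second_kind_smult second_kind_pCons) simp
qed

text \<open>
  Positivity of the weight at \<open>r\<close> of the Gauss quadrature with nodes at the zeros of
  \<open>B = [:- r, 1:] * u\<close>: as \<open>u W - (W r / u r) u\<^sup>2\<close> is divisible by \<open>B\<close>, the integral of \<open>u\<close> is
  \<open>W r / u r\<close> times that of \<open>u\<^sup>2 / W\<close>.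
\<close>

lemma quadrature_weight_pos:
  fixes u W :: "real poly"
  assumes iv: "is_interval \<Delta>"
    and W: "degree W \<le> n" "\<And>x. x \<in> \<Delta> \<Longrightarrow> poly W x \<noteq> 0"
    and u: "degree u < n" "r \<in> \<Delta>" "poly u r \<noteq> 0"
    and orth: "\<And>v. degree v < n \<Longrightarrow>
      integrable (cs_abs s) (\<lambda>x. poly v x * (poly ([:- r, 1:] * u) x / poly W x)) \<and>
      sint s (\<lambda>x. poly v x * (poly ([:- r, 1:] * u) x / poly W x)) = 0"
  shows "0 < cs_sign s * (poly u r * pfun s u)"
proof -
  define c where "c = poly W r / poly u r"
  have "poly (W - smult c u) r = 0" using u(3) by (simp add: c_def)
  then have "[:- r, 1:] dvd W - smult c u" by (simp only: poly_eq_0_iff_dvd)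
  then obtain v where v: "W - smult c u = [:- r, 1:] * v" by (elim dvdE)
  have deg: "degree v < n"
  proof (cases "v = 0")
    case False
    have "degree (W - smult c u) \<le> n"
      using W(1) u(1) by (intro degree_diff_le) (auto intro: order_trans[OF degree_smult_le])
    moreover have "degree (W - smult c u) = Suc (degree v)"
      unfolding v using False by (subst degree_mult_eq) auto
    ultimately show ?thesis by simp
  qed (use u(1) in simp)
  let ?h = "\<lambda>x. poly v x * (poly ([:- r, 1:] * u) x / poly W x)"
  \<comment> \<open>As \<open>?h\<close> integrates to 0 by orthogonality, \<open>?g\<close> has the
    integral whose sign is sought; on \<open>\<Delta>\<close> it is a positive function times the
    square of \<open>u\<close>.\<close>
  let ?g = "\<lambda>x. poly u r * (poly u x - ?h x)"
  have int: "integrable (cs_abs s) (\<lambda>x. poly u x)" "integrable (cs_abs s) ?h" "sint s ?h = 0"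
    using integrable_poly[of u] orth[OF deg] by auto
  have g: "integrable (cs_abs s) ?g"
    by (intro integrable_mult_right Bochner_Integration.integrable_diff int)
  have sint_g: "sint s ?g = poly u r * pfun s u"
    unfolding sint_mult_left sint_diff[OF int(1,2)] int(3) by (simp add: pfun_def)
  have "(\<forall>x\<in>\<Delta>. 0 < poly W x) \<or> (\<forall>x\<in>\<Delta>. poly W x < 0)"
    by (intro interval_nonzero_const_sign iv W) (intro continuous_intros)
  then have W_pos: "0 < poly W r / poly W x" if "x \<in> \<Delta>" for x
    using that u(2) by (auto simp: divide_neg_neg)
  have g_eq: "?g x = poly W r / poly W x * (poly u x)\<^sup>2" if "x \<in> \<Delta>" for x
  proof -
    have "(x - r) * poly v x = poly W x - c * poly u x"
      using arg_cong[OF v, of "\<lambda>p. poly p x"] by (simp add: algebra_simps)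
    moreover have "?h x = (x - r) * poly v x * poly u x / poly W x"
      by (simp add: algebra_simps)
    ultimately have "?h x = (poly W x - c * poly u x) * poly u x / poly W x" by simp
    also have "\<dots> = poly u x - c * (poly u x)\<^sup>2 / poly W x"
      using W(2)[OF that] by (simp add: left_diff_distrib diff_divide_distrib power2_eq_square)
    finally show ?thesis using u(3) by (simp add: c_def)
  qed
  have nonneg: "AE x in cs_abs s. 0 \<le> ?g x"
    using AE_in
  proof eventually_elim
    case (elim x)
    then show ?case
      unfolding g_eq[OF elim] by (intro mult_nonneg_nonneg less_imp_le[OF W_pos]) simp_all
  qed
  have "(LINT x|cs_abs s. ?g x) \<noteq> 0"
  proof
    assume "(LINT x|cs_abs s. ?g x) = 0"
    then have "AE x in cs_abs s. ?g x = 0"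
      using integral_nonneg_eq_0_iff_AE[OF g nonneg] by simp
    then have "AE x in cs_abs s. x \<in> {x. poly u x = 0}"
      using AE_in
    proof eventually_elim
      case (elim x)
      then show ?case using g_eq[OF elim(2)] W_pos[OF elim(2)] by auto
    qed
    moreover have "u \<noteq> 0" using u(3) by auto
    ultimately show False using not_AE_finite poly_roots_finite by blast
  qed
  moreover have "0 \<le> (LINT x|cs_abs s. ?g x)" by (rule integral_nonneg_AE[OF nonneg])
  ultimately have "0 < (LINT x|cs_abs s. ?g x)" unfolding less_le by metis
  moreover have "cs_sign s * sint s ?g = (LINT x|cs_abs s. ?g x)"
    using sgn by (auto simp: sint_def)
  ultimately have "0 < cs_sign s * sint s ?g" by (simp only:)
  then show ?thesis by (simp only: sint_g)
qed

text \<open>The measures are real, so a real-linear map applied coefficientwise commutes with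
  integration; \<open>Re\<close> and \<open>Im\<close> are the instances of interest.\<close>

lemma pfun_map_poly:
  fixes h :: "complex \<Rightarrow> real"
  assumes h: "bounded_linear h"
  shows "pfun s (map_poly h p) = h (pfun s p)"
proof -
  interpret bounded_linear h by (rule h)
  have "poly (map_poly h p) x = h (poly p (of_real x))" for x
    by (induction p) (simp_all add: zero map_poly_pCons add scaleR flip: scaleR_conv_of_real)
  then show ?thesis
    using integral_bounded_linear[OF h integrable_poly[of p]] by (simp add: pfun_def sint_def scaleR)
qed

lemma second_kind_map_poly:
  fixes h :: "complex \<Rightarrow> real"
  assumes h: "bounded_linear h"
  shows "second_kind s (map_poly h p) = map_poly h (second_kind s p)"
proof (rule poly_eqI)
  interpret bounded_linear h by (rule h)
  fix i
  have "poly_shift (Suc i) (map_poly h p) = map_poly h (poly_shift (Suc i) p)"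
    by (intro poly_eqI) (simp add: coeff_poly_shift coeff_map_poly zero)
  then show "coeff (second_kind s (map_poly h p)) i = coeff (map_poly h (second_kind s p)) i"
    by (simp add: coeff_second_kind coeff_map_poly zero pfun_map_poly h)
qed

end

context nikishin
begin

text \<open>At level \<open>m - 1\<close> the equation reads
  \<open>b (m - 1) = second_kind (\<sigma> m) (b m)\<close>, so at a zero of \<open>b m\<close> the
  value of \<open>b (m - 1)\<close> is a quadrature weight times the derivative of
  \<open>b m\<close>. The weights have one sign and the derivatives alternate, hence so do the
  values.\<close>

lemma previous_zeros:
  fixes b :: "nat \<Rightarrow> real poly"
  assumes m: "2 \<le> m" and n: "1 \<le> n" and b: "ml_data n b" and deg: "degree (b m) = n" and nz: "b m \<noteq> 0"
    and X: "X \<subseteq> interior (\<Delta> m)" "finite X" "card X = n" "\<And>x. x \<in> X \<Longrightarrow> poly (b m) x = 0"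
  shows "\<exists>Y. Y \<subseteq> interior (\<Delta> m) \<and> finite Y \<and> card Y = n - 1 \<and> (\<forall>y\<in>Y. poly (b (m - 1)) y = 0)"
proof -
  interpret cs_in "\<sigma> m" "\<Delta> m" using gen_in m by simp
  define j where "j = m - 1"
  have j: "1 \<le> j" "Suc j = m" "j \<le> m" using m by (auto simp: j_def)
  have iv: "is_interval (\<Delta> m)" using interval m by simp
  obtain Z where Z: "Z \<subseteq> interior (\<Delta> j)" "finite Z" "card Z = n" "\<And>x. x \<in> Z \<Longrightarrow> form b j x = 0"
    using form_zeros[OF b j(1,3)] by blast
  \<comment> \<open>The zeros of the form of level \<open>m - 1\<close> give the denominator of the
    weight with respect to which \<open>b m\<close> is orthogonal.\<close>
  define W where "W = root_poly Z"
  have orth: "integrable (cs_abs (\<sigma> m)) (\<lambda>x. poly v x * (poly (b m) x / poly W x)) \<and>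
      sint (\<sigma> m) (\<lambda>x. poly v x * (poly (b m) x / poly W x)) = 0" if v: "degree v < n" for v
  proof -
    have "(\<lambda>x. poly ((- 1) ^ m * v) x * (form b m x / poly W x)) = (\<lambda>x. poly v x * (poly (b m) x / poly W x))"
      by (cases "even m") (simp_all add: form_last)
    moreover have "degree ((- 1) ^ m * v) < n"
      using v by (cases "even m") simp_all
    ultimately show ?thesis
      using form_next_orthogonal[of j n b Z "(- 1) ^ m * v"] j b Z by (simp add: W_def)
  qed
  have "ml_poly b j = 0" using b j by (simp add: ml_data_def)
  moreover have "(- 1 :: real) ^ m = - ((- 1) ^ j)"
    using j(2) by (metis mult_minus1 power_Suc)
  ultimately have "smult ((- 1) ^ j) (b j) + smult (- ((- 1) ^ j)) (second_kind (\<sigma> m) (b m)) = 0"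
    by (simp add: ml_poly_def j(2))
  then have "smult ((- 1) ^ j) (b j - second_kind (\<sigma> m) (b m)) = 0" by (simp add: smult_diff_right)
  then have bj: "b j = second_kind (\<sigma> m) (b m)" by simp
  obtain c where bm: "b m = smult c (root_poly X)" "c \<noteq> 0"
  proof
    let ?c = "lead_coeff (b m)"
    show "b m = smult ?c (root_poly X)"
    proof (rule poly_eqI_degree_lead_coeff[of _ n _ X])
      have "lead_coeff (root_poly X) = 1" by (simp add: root_poly_def lead_coeff_prod)
      then show "coeff (b m) n = coeff (smult ?c (root_poly X)) n"
        using deg X by (simp add: degree_root_poly)
    qed (use X deg in \<open>auto simp: degree_root_poly poly_root_poly\<close>)
    show "?c \<noteq> 0" using nz by simp
  qed
  have weight: "0 < cs_sign (\<sigma> m) * (poly u r * poly (b j) r)"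
    if r: "r \<in> X" and u: "u = smult c (root_poly (X - {r}))" for r u
  proof -
    have fac: "b m = [:- r, 1:] * u"
      unfolding bm(1) u root_poly_def using prod.remove[OF X(2) r, of "\<lambda>t. [:- t, 1:]"] by simp
    have "poly u r \<noteq> 0" using X(2) bm(2) by (simp add: u poly_root_poly)
    moreover have "degree u < n" using X r bm(2) n by (simp add: u degree_root_poly card_Diff_singleton)
    moreover have "r \<in> \<Delta> m" using r X(1) interior_subset by blast
    moreover have "poly W x \<noteq> 0" if "x \<in> \<Delta> m" for x
      using root_poly_nonzero[of j Z x] j Z that by (simp add: W_def)
    moreover have "degree W \<le> n" using Z by (simp add: W_def degree_root_poly)
    ultimately have "0 < cs_sign (\<sigma> m) * (poly u r * pfun (\<sigma> m) u)"
      using orth unfolding fac by (intro quadrature_weight_pos[OF iv, of W n]) auto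
    then show ?thesis unfolding bj fac poly_second_kind_root .
  qed
  have neg: "poly (b j) x * poly (b j) y < 0"
    if xy: "x \<in> X" "y \<in> X" "x < y" "{x<..<y} \<inter> X = {}" for x y
  proof -
    \<comment> \<open>The common factor of the cofactors at \<open>x\<close> and \<open>y\<close>.
      It has no zero on \<open>{x..y}\<close>, so its values at both ends have the same sign and
      only \<open>x - y\<close> against \<open>y - x\<close> makes a difference.\<close>
    define v where "v = smult c (root_poly (X - {x} - {y}))"
    have "poly (smult c (root_poly (X - {x}))) x = (x - y) * poly v x"
      using xy X(2) by (simp add: v_def poly_root_poly prod.remove[of "X - {x}" y])
    moreover have "poly (smult c (root_poly (X - {y}))) y = (y - x) * poly v y"
      using xy X(2) by (simp add: v_def poly_root_poly prod.remove[of "X - {y}" x] Diff_insert2[symmetric] insert_commute)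
    ultimately have w: "0 < cs_sign (\<sigma> m) * ((x - y) * poly v x * poly (b j) x)"
      "0 < cs_sign (\<sigma> m) * ((y - x) * poly v y * poly (b j) y)"
      using weight[OF xy(1) refl] weight[OF xy(2) refl] by simp_all
    have pos: "0 < (cs_sign (\<sigma> m) * ((x - y) * poly v x * poly (b j) x)) *
        (cs_sign (\<sigma> m) * ((y - x) * poly v y * poly (b j) y))"
      by (rule mult_pos_pos[OF w])
    have "\<forall>z\<in>{x..y}. poly v z \<noteq> 0"
    proof
      fix z assume z: "z \<in> {x..y}"
      have "\<not> (x < z \<and> z < y \<and> z \<in> X)" using xy(4) by auto
      then have "z \<notin> X - {x} - {y}" using z by (auto simp: order.order_iff_strict)
      then show "poly v z \<noteq> 0" using bm(2) X(2) by (auto simp: v_def poly_root_poly)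
    qed
    then have "(\<forall>z\<in>{x..y}. 0 < poly v z) \<or> (\<forall>z\<in>{x..y}. poly v z < 0)"
      by (intro interval_nonzero_const_sign) (auto intro!: continuous_intros simp: is_interval_cc)
    then have vv: "0 < poly v x * poly v y"
      using xy(3) by (auto simp: mult_neg_neg)
    let ?K = "(cs_sign (\<sigma> m))\<^sup>2 * (y - x)\<^sup>2 * (poly v x * poly v y)"
    let ?M = "poly (b j) x * poly (b j) y"
    have "(cs_sign (\<sigma> m) * ((x - y) * poly v x * poly (b j) x)) *
        (cs_sign (\<sigma> m) * ((y - x) * poly v y * poly (b j) y)) = - (?K * ?M)"
      by (simp add: power2_eq_square algebra_simps)
    then have "?K * ?M < 0" using pos by linarith
    moreover have "0 < ?K" using vv xy(3) sgn by auto
    ultimately show ?thesis using mult_less_cancel_left_pos[of ?K ?M 0] by (simp only: mult_zero_right)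
  qed
  have "X \<noteq> {}" using X(3) n by auto
  have "\<exists>Y. finite Y \<and> card Y = card X - 1 \<and>
      (\<forall>z\<in>Y. poly (b j) z = 0 \<and> (\<exists>x\<in>X. \<exists>y\<in>X. x < z \<and> z < y))"
    by (rule interlacing_zeros[OF X(2) \<open>X \<noteq> {}\<close>]) (intro continuous_intros, rule neg)
  then obtain Y where Y: "finite Y" "card Y = card X - 1"
    "\<forall>z\<in>Y. poly (b j) z = 0 \<and> (\<exists>x\<in>X. \<exists>y\<in>X. x < z \<and> z < y)"
    by (elim exE conjE)
  have "z \<in> interior (\<Delta> m)" if "z \<in> Y" for z
  proof -
    obtain x y where "x \<in> X" "y \<in> X" "x < z" "z < y" using Y(3) \<open>z \<in> Y\<close> by blast
    moreover have "is_interval (interior (\<Delta> m))"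
      using iv by (simp add: is_interval_convex_1 convex_interior)
    ultimately show ?thesis using X(1) unfolding is_interval_1 by (meson less_imp_le subsetD)
  qed
  then show ?thesis using Y X(3) by (intro exI[of _ Y]) (auto simp: j_def)
qed

section \<open>Real and imaginary parts and linear combinations of solutions\<close>

lemma ml_poly_map_poly:
  fixes h :: "complex \<Rightarrow> real"
  assumes h: "bounded_linear h"
  shows "ml_poly (\<lambda>k. map_poly h (a k)) j = map_poly h (ml_poly a j)"
proof (rule poly_eqI)
  interpret bounded_linear h by (rule h)
  have sg: "h ((- 1) ^ k * x) = (- 1) ^ k * h x" for k x
    by (cases "even k") (simp_all add: neg)
  fix i
  have "coeff (second_kind (nik \<sigma> (Suc j) k) (map_poly h (a k))) i = h (coeff (second_kind (nik \<sigma> (Suc j) k) (a k)) i)"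
    if "k \<in> {Suc j..m}" for k
  proof -
    interpret cs_in "nik \<sigma> (Suc j) k" "\<Delta> (Suc j)" using nik_in that by simp
    show ?thesis by (simp add: second_kind_map_poly[OF h] coeff_map_poly zero)
  qed
  then show "coeff (ml_poly (\<lambda>k. map_poly h (a k)) j) i = coeff (map_poly h (ml_poly a j)) i"
    by (simp add: ml_poly_def coeff_sum coeff_map_poly zero add sum sg)
qed

lemma moment_map_poly:
  fixes h :: "complex \<Rightarrow> real"
  assumes h: "bounded_linear h"
  shows "moment (\<lambda>k. map_poly h (a k)) \<nu> = h (moment a \<nu>)"
proof -
  interpret bounded_linear h by (rule h)
  have sg: "h ((- 1) ^ k * x) = (- 1) ^ k * h x" for k x
    by (cases "even k") (simp_all add: neg)
  have "pfun (nik \<sigma> 1 k) (monom 1 \<nu> * map_poly h (a k)) = h (pfun (nik \<sigma> 1 k) (monom 1 \<nu> * a k))"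
    if "k \<in> {1..m}" for k
  proof -
    interpret cs_in "nik \<sigma> 1 k" "\<Delta> 1" using nik_in that by simp
    have "monom 1 \<nu> * map_poly h (a k) = map_poly h (monom 1 \<nu> * a k)"
      by (intro poly_eqI) (simp add: coeff_monom_mult coeff_map_poly zero)
    then show ?thesis by (simp only: pfun_map_poly[OF h])
  qed
  then show ?thesis by (simp add: moment_def sum sg)
qed

lemma ml_data_map_poly:
  fixes h :: "complex \<Rightarrow> real"
  assumes "bounded_linear h" "ml_data n a"
  shows "ml_data n (\<lambda>k. map_poly h (a k))"
proof -
  interpret bounded_linear h by (rule assms)
  show ?thesis using assms by (simp add: ml_data_def ml_poly_map_poly moment_map_poly zero)
qed

lemma ml_data_diff_smult:
  fixes a b :: "nat \<Rightarrow> 'a::{real_normed_field, banach, second_countable_topology} poly"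
  assumes "ml_data n a" "ml_data n b"
  shows "ml_data n (\<lambda>k. a k - smult c (b k))"
proof -
  have "ml_poly (\<lambda>k. a k - smult c (b k)) j = ml_poly a j - smult c (ml_poly b j)" for j
  proof -
    have "second_kind (nik \<sigma> (Suc j) k) (a k - smult c (b k)) =
        second_kind (nik \<sigma> (Suc j) k) (a k) - smult c (second_kind (nik \<sigma> (Suc j) k) (b k))"
      if "k \<in> {Suc j..m}" for k
    proof -
      interpret cs_in "nik \<sigma> (Suc j) k" "\<Delta> (Suc j)" using nik_in that by simp
      show ?thesis by (simp add: second_kind_diff second_kind_smult)
    qed
    then have "ml_poly (\<lambda>k. a k - smult c (b k)) j = smult ((- 1) ^ j) (a j - smult c (b j)) +
        (\<Sum>k=Suc j..m. smult ((- 1) ^ k) (second_kind (nik \<sigma> (Suc j) k) (a k) -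
          smult c (second_kind (nik \<sigma> (Suc j) k) (b k))))"
      by (simp add: ml_poly_def)
    then show ?thesis
      by (intro poly_eqI) (simp add: ml_poly_def coeff_sum algebra_simps sum_subtractf sum_distrib_left)
  qed
  moreover have "moment (\<lambda>k. a k - smult c (b k)) \<nu> = moment a \<nu> - c * moment b \<nu>" for \<nu>
  proof -
    have "pfun (nik \<sigma> 1 k) (monom 1 \<nu> * (a k - smult c (b k))) =
        pfun (nik \<sigma> 1 k) (monom 1 \<nu> * a k) - c * pfun (nik \<sigma> 1 k) (monom 1 \<nu> * b k)"
      if "k \<in> {1..m}" for k
    proof -
      interpret cs_in "nik \<sigma> 1 k" "\<Delta> 1" using nik_in that by simp
      show ?thesis by (simp add: right_diff_distrib pfun_diff pfun_smult del: One_nat_def)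
    qed
    then have "moment (\<lambda>k. a k - smult c (b k)) \<nu> = (\<Sum>k=1..m. (- 1) ^ k *
        (pfun (nik \<sigma> 1 k) (monom 1 \<nu> * a k) - c * pfun (nik \<sigma> 1 k) (monom 1 \<nu> * b k)))"
      by (simp add: moment_def)
    then show ?thesis
      by (simp add: moment_def right_diff_distrib sum_subtractf sum_distrib_left mult.left_commute)
  qed
  ultimately show ?thesis using assms by (simp add: ml_data_def)
qed

lemma complex_ml_data_unique:
  fixes a :: "nat \<Rightarrow> complex poly"
  assumes m: "1 \<le> m" and a: "ml_data n a" and deg: "degree (a m) \<le> n" and coeff: "coeff (a m) n = 0"
    and j: "j \<le> m"
  shows "a j = 0"
proof -
  have "map_poly h (a j) = 0" if h: "bounded_linear h" for h :: "complex \<Rightarrow> real"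
  proof -
    interpret bounded_linear h by (rule h)
    show ?thesis
      by (rule real_ml_data_unique[OF m ml_data_map_poly[OF h a] _ _ j])
         (use deg coeff in \<open>simp_all add: coeff_map_poly zero order_trans[OF degree_map_poly_le]\<close>)
  qed
  from this[OF bounded_linear_Re] this[OF bounded_linear_Im] show ?thesis
    by (simp add: poly_eq_iff coeff_map_poly complex_eq_iff)
qed

text \<open>In \<open>ml_poly a j = 0\<close> the coefficient of degree \<open>n - 1\<close>
  receives only that of \<open>a j\<close> and, from \<open>a m\<close>, up to sign its coefficient
  of degree \<open>n\<close> times the total mass of a measure of constant sign, which is not
  0.\<close>

lemma ml_data_degree:
  fixes a :: "nat \<Rightarrow> complex poly"
  assumes n: "1 \<le> n" and a: "ml_data n a" "hp_vector m n a" and c: "coeff (a m) n \<noteq> 0" and j: "j < m"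
  shows "a j \<noteq> 0 \<and> degree (a j) = n - 1"
proof -
  have deg: "degree (a k) \<le> n - 1" if "k < m" for k using a(2) that by (simp add: hp_vector_def)
  have degm: "degree (a m) \<le> n" using a(2) by (simp add: hp_vector_def)
  have Suc: "Suc (n - 1) = n" using n by simp
  have 0: "coeff (second_kind (nik \<sigma> (Suc j) k) (a k)) (n - 1) = 0" if k: "k \<in> {Suc j..<m}" for k
  proof -
    interpret cs_in "nik \<sigma> (Suc j) k" "\<Delta> (Suc j)" using nik_in k by simp
    have "poly_shift n (a k) = 0"
      using deg[of k] k n by (intro poly_shift_eq_0) auto
    then show ?thesis by (simp only: coeff_second_kind Suc pfun_0)
  qed
  have M: "coeff (second_kind (nik \<sigma> (Suc j) m) (a m)) (n - 1) \<noteq> 0"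
  proof -
    interpret cs_in "nik \<sigma> (Suc j) m" "\<Delta> (Suc j)" using nik_in j by simp
    have "poly_shift n (a m) = smult (coeff (a m) n) 1"
      using degm by (intro poly_eqI) (auto simp: coeff_poly_shift coeff_pCons split: nat.splits intro!: coeff_eq_0)
    then have "coeff (second_kind (nik \<sigma> (Suc j) m) (a m)) (n - 1) = coeff (a m) n * pfun (nik \<sigma> (Suc j) m) 1"
      by (simp only: coeff_second_kind Suc pfun_smult)
    then show ?thesis using c pfun_1_nonzero by simp
  qed
  have "{Suc j..m} = insert m {Suc j..<m}" using j by auto
  then have "coeff (ml_poly a j) (n - 1) = (- 1) ^ j * coeff (a j) (n - 1) +
      (- 1) ^ m * coeff (second_kind (nik \<sigma> (Suc j) m) (a m)) (n - 1)"
    using 0 by (simp add: ml_poly_def coeff_sum)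
  moreover have "ml_poly a j = 0" using a(1) j by (simp add: ml_data_def)
  ultimately have "coeff (a j) (n - 1) \<noteq> 0" using M by auto
  then show ?thesis using deg[OF j] le_degree[of "a j" "n - 1"] by auto
qed

lemma ml_data_leading_nonzero:
  assumes "1 \<le> m" "hp_vector m n a" "ml_data n a"
  shows "coeff (a m) n \<noteq> 0"
  using complex_ml_data_unique[OF assms(1,3)] assms(2) by (auto simp: hp_vector_def)

lemma ml_data_zeros:
  fixes a :: "nat \<Rightarrow> complex poly"
  assumes m: "2 \<le> m" and n: "1 \<le> n" and a: "hp_vector m n a" "ml_data n a"
    and j: "j \<in> {m - 1, m}" and z: "poly (a j) z = 0"
  shows "order z (a j) = 1 \<and> z \<in> complex_of_real ` interior (\<Delta> m)"
proof -
  have m1: "1 \<le> m" using m by simp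
  define c where "c = coeff (a m) n"
  have c: "c \<noteq> 0" using ml_data_leading_nonzero[OF m1 a] by (simp add: c_def)
  have deg: "degree (a m) \<le> n" using a(1) by (simp add: hp_vector_def)
  define a' where "a' k = 0 - smult (- inverse c) (a k)" for k
  have "ml_data n (\<lambda>k. 0 :: complex poly)"
    by (simp add: ml_data_def ml_poly_def moment_def second_kind_def pfun_def)
  from ml_data_diff_smult[OF this a(2), of "- inverse c"] have a': "ml_data n a'"
    by (simp add: a'_def[abs_def])
  have coeff_a': "coeff (a' m) n = 1" using c by (simp add: a'_def c_def)
  have deg_a': "degree (a' k) = degree (a k)" for k using c by (simp add: a'_def)
  have ml: "ml_data n (\<lambda>k. map_poly h (a' k))" if "bounded_linear h" for h :: "complex \<Rightarrow> real"
    using ml_data_map_poly[OF that a'] .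
  define b where "b k = map_poly Re (a' k)" for k
  have b: "ml_data n b" using ml[OF bounded_linear_Re] by (simp add: b_def[abs_def])
  \<comment> \<open>The imaginary part has coefficient \<open>Im 1 = 0\<close> in degree
    \<open>n\<close>, so uniqueness annihilates it and the normalised vector is real.\<close>
  have im: "map_poly Im (a' k) = 0" if "k \<le> m" for k
    by (rule real_ml_data_unique[OF m1 ml[OF bounded_linear_Im] _ _ that])
       (use deg_a'[of m] deg coeff_a' in \<open>simp_all add: coeff_map_poly order_trans[OF degree_map_poly_le]\<close>)
  have real: "poly (a' k) (of_real x) = of_real (poly (b k) x)" if "k \<le> m" for k x
  proof -
    have "a' k = map_poly of_real (b k)"
      using im[OF that] by (simp add: poly_eq_iff b_def coeff_map_poly complex_eq_iff)
    moreover have "poly (map_poly of_real p) (of_real x) = complex_of_real (poly p x)" for p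
      by (induction p) (simp_all add: map_poly_pCons)
    ultimately show ?thesis by simp
  qed
  have deg_b: "degree (b m) = n" "b m \<noteq> 0"
  proof -
    have "coeff (b m) n = 1" by (simp add: b_def coeff_map_poly coeff_a')
    moreover have "degree (b m) \<le> n"
      using deg_a'[of m] deg by (simp add: b_def order_trans[OF degree_map_poly_le])
    ultimately show "degree (b m) = n" "b m \<noteq> 0" using le_degree[of "b m" n] by auto
  qed
  obtain X where X: "X \<subseteq> interior (\<Delta> m)" "finite X" "card X = n" "\<forall>x\<in>X. form b m x = 0"
    using form_zeros[OF b m1 order_refl] by blast
  then have X0: "\<And>x. x \<in> X \<Longrightarrow> poly (b m) x = 0" by (simp add: form_last)
  obtain Y where Y: "Y \<subseteq> interior (\<Delta> m)" "finite Y" "card Y = n - 1" "\<forall>y\<in>Y. poly (b (m - 1)) y = 0"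
    using previous_zeros[OF m n b deg_b X(1,2,3) X0] by blast
  \<comment> \<open>For either index the known interior zeros are as many as the degree allows,
    which excludes nonreal and multiple zeros.\<close>
  obtain Z where Z: "Z \<subseteq> interior (\<Delta> m)" "finite Z" "degree (a j) \<le> card Z" "\<And>x. x \<in> Z \<Longrightarrow> poly (b j) x = 0"
    and nz: "a j \<noteq> 0"
  proof (cases "j = m")
    case True
    moreover have "a m \<noteq> 0" using c by (auto simp: c_def)
    ultimately show ?thesis using that[of X] X X0 deg by auto
  next
    case False
    then have "j = m - 1" using j by simp
    then show ?thesis
      using that[of Y] Y ml_data_degree[OF n a(2,1), of j] c m by (auto simp: c_def)
  qed
  have root: "poly (a j) z = 0" if z: "z \<in> complex_of_real ` Z" for z
  proof -
    obtain x where "x \<in> Z" "z = of_real x" using z by auto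
    then have "poly (a' j) z = 0" using real[of j x] Z(4)[of x] j by auto
    then show ?thesis using c by (simp add: a'_def)
  qed
  have "card (complex_of_real ` Z) = card Z" by (intro card_image inj_onI) simp
  then have "z \<in> complex_of_real ` Z \<and> order z (a j) = 1"
    using Z root nz z by (intro roots_simple) auto
  then show ?thesis using Z(1) by auto
qed

end

theorem theorem1p4:
  fixes m n :: nat and \<Delta> :: "nat \<Rightarrow> real set" and \<sigma> :: "nat \<Rightarrow> cs_measure"
  assumes "m \<ge> 2" and "n \<ge> 1" and "nikishin_generators m \<Delta> \<sigma>"
  shows "(\<forall>a. HP_DR m \<Delta> \<sigma> n a \<longleftrightarrow> HP_ML m \<Delta> \<sigma> n a) \<and>
    (\<exists>a. HP_DR m \<Delta> \<sigma> n a) \<and>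
    (\<forall>a b. HP_DR m \<Delta> \<sigma> n a \<longrightarrow> HP_DR m \<Delta> \<sigma> n b \<longrightarrow>
       (\<exists>c. c \<noteq> 0 \<and> (\<forall>j\<le>m. b j = smult c (a j)))) \<and>
    (\<forall>a. HP_DR m \<Delta> \<sigma> n a \<longrightarrow>
       (\<forall>j<m. a j \<noteq> 0 \<and> degree (a j) = n - 1) \<and>
       a m \<noteq> 0 \<and> degree (a m) = n \<and>
       (\<forall>j\<in>{m - 1, m}. \<forall>z. poly (a j) z = 0 \<longrightarrow>
          order z (a j) = 1 \<and> z \<in> complex_of_real ` interior (\<Delta> m)))"
proof -
  interpret nikishin m \<Delta> \<sigma> by (rule nikishin.intro[OF assms(3)])
  have m: "1 \<le> m" using assms(1) by simp
  note dr_iff = HP_DR_iff[OF m, of n] and ml_iff = HP_ML_iff[OF m, of n]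
  have dr_ml: "HP_ML m \<Delta> \<sigma> n a" if "HP_DR m \<Delta> \<sigma> n a" for a
    using that dr_data_imp_ml_data by (simp add: dr_iff ml_iff)
  have unique: "\<exists>c. c \<noteq> 0 \<and> (\<forall>j\<le>m. b j = smult c (a j))"
    if "HP_ML m \<Delta> \<sigma> n a" "HP_ML m \<Delta> \<sigma> n b" for a b
  proof -
    from that have a: "hp_vector m n a" "ml_data n a" and b: "hp_vector m n b" "ml_data n b"
      by (simp_all add: ml_iff)
    \<comment> \<open>This ratio removes the coefficient of degree \<open>n\<close> from
      \<open>b m - smult c (a m)\<close>, so uniqueness applies to the difference.\<close>
    define c where "c = coeff (b m) n / coeff (a m) n"
    have nz: "coeff (a m) n \<noteq> 0" "coeff (b m) n \<noteq> 0"
      using ml_data_leading_nonzero[OF m] a b by blast+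
    have "b j - smult c (a j) = 0" if "j \<le> m" for j
    proof (rule complex_ml_data_unique[OF m ml_data_diff_smult[OF b(2) a(2)] _ _ that])
      show "degree (b m - smult c (a m)) \<le> n"
        using a(1) b(1) by (intro degree_diff_le) (auto simp: hp_vector_def intro: order_trans[OF degree_smult_le])
      show "coeff (b m - smult c (a m)) n = 0" using nz by (simp add: c_def)
    qed
    moreover have "c \<noteq> 0" using nz by (simp add: c_def)
    ultimately show ?thesis by auto
  qed
  obtain a0 where a0: "HP_DR m \<Delta> \<sigma> n a0" using exists_dr_data[OF m] dr_iff by blast
  have ml_dr: "HP_DR m \<Delta> \<sigma> n a" if a: "HP_ML m \<Delta> \<sigma> n a" for a
  proof -
    obtain c where c: "c \<noteq> 0" "\<And>j. j \<le> m \<Longrightarrow> a j = smult c (a0 j)"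
      using unique[OF dr_ml[OF a0] a] by blast
    \<comment> \<open>Level 0 is common to both systems; the remaining DR conditions are linear and
      hold for \<open>a0\<close>, of which \<open>a\<close> is a multiple.\<close>
    have "a j = second_kind (nik \<sigma> m (Suc j)) (a m)" if j: "j \<in> {1..<m}" for j
    proof -
      interpret cs_in "nik \<sigma> m (Suc j)" "\<Delta> m" using nik_rev_in j by simp
      have "a0 j = second_kind (nik \<sigma> m (Suc j)) (a0 m)" using a0 j by (simp add: dr_iff dr_data_def)
      then show ?thesis using j by (simp add: c(2) second_kind_smult)
    qed
    then show ?thesis using a m by (simp add: dr_iff ml_iff dr_data_def ml_data_def)
  qed
  have props: "(\<forall>j<m. a j \<noteq> 0 \<and> degree (a j) = n - 1) \<and> a m \<noteq> 0 \<and> degree (a m) = n \<and>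
       (\<forall>j\<in>{m - 1, m}. \<forall>z. poly (a j) z = 0 \<longrightarrow>
          order z (a j) = 1 \<and> z \<in> complex_of_real ` interior (\<Delta> m))" if "HP_DR m \<Delta> \<sigma> n a" for a
  proof -
    from dr_ml[OF that] have a: "hp_vector m n a" "ml_data n a" by (simp_all add: ml_iff)
    have nz: "coeff (a m) n \<noteq> 0" using ml_data_leading_nonzero[OF m a] .
    then have "a m \<noteq> 0 \<and> degree (a m) = n"
      using a(1) le_degree[OF nz] by (auto simp: hp_vector_def)
    then show ?thesis
      using ml_data_degree[OF assms(2) a(2,1) nz] ml_data_zeros[OF assms(1,2) a] by blast
  qed
  have equiv: "HP_DR m \<Delta> \<sigma> n a \<longleftrightarrow> HP_ML m \<Delta> \<sigma> n a" for a
    using dr_ml ml_dr by blast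
  show ?thesis
    using props unique[unfolded equiv[symmetric]] by (intro conjI allI impI equiv exI[of _ a0] a0) blast+
qed

end
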